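(* Any two billiard ball maps can be joined by a Hamiltonian path: for any two billiard tables $\alpha,\beta\in\mathcal{B}$ there is a Hamiltonian path $(\psi_s)_{s\in[0,1]}$ with $\psi_0=\psi_\alpha$ and $\psi_1=\psi_\beta$; hence all billiard ball maps belong to the set $\mathcal{BM}=\psi_D\cdot \mathrm{Ham}(A,\partial A)=\{\psi_D\circ\varphi:\varphi\in \mathrm{Ham}(A,\partial A)\}$. Furthermore, for any two billiard tables $\alpha,\beta\in\mathcal{B}$ with corresponding billiard ball maps $\psi_\alpha,\psi_\beta$ one has \[ d_H(\psi_\alpha,\psi_\beta)\le 4\cdot d_B(\alpha,\beta). \]
   Context: Billiard tables. $S^1=\mathbb{R}/\mathbb{Z}$. A billiard table is a smooth convex body $K\subset\mathbb{R}^2$ whose boundary has length $1$ and positive curvature; a marked billiard table is such a $K$ together with a point $S\in\partial K$. A marked billiard table is identified with the counterclockwise arc-length parametrization $\gamma\colon S^1\to\mathbb{R}^2$ of $\partial K$ with $\gamma(0)=S$. $\mathcal{B}$ denotes the set of all marked billiard tables (equivalently, of all such curves $\gamma$), called simply billiard tables. Geometric distance. For $\alpha,\beta\in\mathcal{B}$, $d_B(\alpha,\beta)=\inf l_B(\gamma_s)$, the infimum being over all smooth homotopies $\gamma_s$, $s\in[0,1]$, from $\alpha$ to $\beta$ with $\gamma_s\in\mathcal{B}$ for every $s$, where $l_B(\gamma_s)=\int_0^1\max_{q\in S^1}\left\|\frac{\partial\gamma_s}{\partial s}(q)\right\|ds$ and $\|\cdot\|$ is the Euclidean norm. Annulus.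 $A=S^1\times(-1,1)$ with coordinates $(q,p)$ and symplectic form $\omega=dp\wedge dq$; $\bar A=S^1\times[-1,1]$. Billiard ball map. For $\gamma\in\mathcal{B}$, the billiard ball map $\psi_\gamma\colon A\to A$, $\psi_\gamma(q,p)=(Q,P)$, is the unique map (with $Q\neq q$) such that $p=\left\langle\frac{\gamma(Q)-\gamma(q)}{\|\gamma(Q)-\gamma(q)\|},\gamma'(q)\right\rangle$ and $P=\left\langle\frac{\gamma(Q)-\gamma(q)}{\|\gamma(Q)-\gamma(q)\|},\gamma'(Q)\right\rangle$. It is a smooth symplectomorphism of $A$ extending continuously to $\bar A$ by the identity on $\partial A$. $\psi_D$ is the billiard ball map of the round disc $D$ of perimeter $1$. Hamiltonian paths. A smooth path $\psi_s$, $s\in[0,1]$, of symplectomorphisms of $A$ that extends continuously as a map $A\times[0,1]\to A$ to a map $\bar A\times[0,1]\to\bar A$ by setting $\psi_s|_{\partial A}=\mathrm{id}_{\partial A}$ is called Hamiltonian if there is a smooth family of functions $H_s\colon A\to\mathbb{R}$ with $i_{X_s}\omega=-dH_s$ for every $s$, where $X_s$ is determined by $\frac{d\psi_s}{ds}=X_s\circ\psi_s$, and such that $H_s$, as a function on $A\times[0,1]$, extends continuously to $\bar A\times[0,1]$ by setting $H_s|_{\partial A}=0$. (The family $H_s$ is then unique.) $\mathrm{Ham}(A,\partial A)$ is the set of all $\psi_1$, where $\psi_s$ is a Hamiltonian path with $\psi_0=\mathrm{id}_A$. Hofer distance. The Hofer length of a Hamiltonian path $\psi_s$ with functions $H_s$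 is $l_H(\psi_s)=\int_0^1(\sup_A H_s-\inf_A H_s)\,ds$. For smooth symplectomorphisms $\varphi,\psi$ of $A$ extending continuously to $\bar A$ by the identity on $\partial A$, $d_H(\varphi,\psi)$ is the infimum of the Hofer lengths of Hamiltonian paths joining $\varphi$ and $\psi$. *)

theory Defs
  imports "HOL-Analysis.Analysis" "HOL-Library.FuncSet"
begin

section \<open>Smooth functions\<close>

text \<open>
  Only used for sets \<open>S\<close> such as \<open>UNIV\<close>, \<open>\<real> \<times> (-1,1)\<close> and \<open>[0,1] \<times> \<real> \<times> (-1,1)\<close>, on which the
  derivative within \<open>S\<close> is unique (one-sided at the end points of \<open>[0,1]\<close>). In finite dimension,
  continuity of all directional derivatives \<open>f' x v\<close> in \<open>x\<close> is continuity of the derivative.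
\<close>

primrec Ck_on ::
  "nat \<Rightarrow> 'a::euclidean_space set \<Rightarrow> ('a \<Rightarrow> 'b::real_normed_vector) \<Rightarrow> bool" where
  "Ck_on 0 S f \<longleftrightarrow> continuous_on S f"
| "Ck_on (Suc k) S f \<longleftrightarrow>
     (\<exists>f'. (\<forall>x\<in>S. (f has_derivative f' x) (at x within S)) \<and> (\<forall>v. Ck_on k S (\<lambda>x. f' x v)))"

definition smooth_on :: "'a::euclidean_space set \<Rightarrow> ('a \<Rightarrow> 'b::real_normed_vector) \<Rightarrow> bool" where
  "smooth_on S f \<longleftrightarrow> (\<forall>k. Ck_on k S f)"


section \<open>The circle and the annulus\<close>

definition circle_rel :: "real \<Rightarrow> real \<Rightarrow> bool" where
  "circle_rel x y \<longleftrightarrow> x - y \<in> \<int>"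

lemma equivp_circle_rel: "equivp circle_rel"
proof (rule equivpI)
  show "reflp circle_rel"
    by (simp add: reflp_def circle_rel_def)
  show "symp circle_rel"
    unfolding symp_def circle_rel_def by (metis Ints_minus minus_diff_eq)
  show "transp circle_rel"
    unfolding transp_def circle_rel_def by (metis Ints_add diff_add_cancel add_diff_eq)
qed

quotient_type circle = real / circle_rel
  morphisms rep_circle circ
  by (rule equivp_circle_rel)

text \<open>The topology of \<open>\<real>/\<int>\<close> is the quotient topology.\<close>

instantiation circle :: topological_space
begin

definition open_circle :: "circle set \<Rightarrow> bool" where
  "open_circle U \<longleftrightarrow> open (circ -` U)"

instance
  by standard (auto simp: open_circle_def vimage_Union)

end

text \<open>
  The derivative of a function on the circle. It does not depend on the representative, since
  \<open>\<lambda>t. f (circ t)\<close> is 1-periodic.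
\<close>

definition circle_deriv :: "(circle \<Rightarrow> 'a::real_normed_vector) \<Rightarrow> circle \<Rightarrow> 'a" where
  "circle_deriv f q = vector_derivative (\<lambda>t. f (circ t)) (at (rep_circle q))"

definition annulus :: "(circle \<times> real) set" where
  "annulus = UNIV \<times> {-1<..<1}"

definition closed_annulus :: "(circle \<times> real) set" where
  "closed_annulus = UNIV \<times> {-1..1}"

definition strip :: "(real \<times> real) set" where
  "strip = UNIV \<times> {-1<..<1}"

text \<open>
  The universal covering \<open>strip \<rightarrow> annulus\<close>. It is a local diffeomorphism, so differential
  conditions on the annulus are stated in the coordinates \<open>(q, p)\<close> on \<open>strip\<close>.
\<close>

definition cov :: "real \<times> real \<Rightarrow> circle \<times> real" where
  "cov z = (circ (fst z), snd z)"

text \<open>The form \<open>dp \<and> dq\<close>; tangent vectors are written \<open>(dq, dp)\<close>.\<close>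

definition omega :: "real \<times> real \<Rightarrow> real \<times> real \<Rightarrow> real" where
  "omega v w = snd v * fst w - fst v * snd w"

text \<open>
  \<open>F\<close> is a smooth lift of the annulus-valued map \<open>f\<close>. On the simply connected domains used here,
  \<open>f\<close> is smooth iff it has such a lift; lifts differ by integer translations in \<open>q\<close>.
\<close>

definition smooth_lift ::
  "'a::euclidean_space set \<Rightarrow> ('a \<Rightarrow> circle \<times> real) \<Rightarrow> ('a \<Rightarrow> real \<times> real) \<Rightarrow> bool" where
  "smooth_lift S f F \<longleftrightarrow> smooth_on S F \<and> (\<forall>x\<in>S. cov (F x) = f x)"

text \<open>
  Self-maps of the annulus are extensional functions (\<open>undefined\<close> off the annulus), so that
  equality of functions is equality of maps.
\<close>

definition symplectomorphism :: "(circle \<times> real \<Rightarrow> circle \<times> real) \<Rightarrow> bool" where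
  "symplectomorphism \<psi> \<longleftrightarrow>
     \<psi> \<in> extensional annulus \<and> bij_betw \<psi> annulus annulus \<and>
     (\<exists>F. smooth_lift strip (\<lambda>z. \<psi> (cov z)) F \<and>
        (\<forall>z\<in>strip. \<forall>v w.
           omega (frechet_derivative F (at z) v) (frechet_derivative F (at z) w) = omega v w)) \<and>
     (\<exists>G. smooth_lift strip (\<lambda>z. inv_into annulus \<psi> (cov z)) G)"


section \<open>Billiard tables\<close>

definition det2 :: "real^2 \<Rightarrow> real^2 \<Rightarrow> real" where
  "det2 u v = u $ 1 * v $ 2 - u $ 2 * v $ 1"

text \<open>
  \<open>\<gamma>\<close> is a smooth counterclockwise arc-length parametrization of the boundary of the convex set \<open>K\<close>:
  counterclockwise means that \<open>K\<close> lies to the left of every tangent. Injectivity on \<open>\<real>/\<int>\<close> and unit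
  speed force the boundary to have length 1.
\<close>

definition boundary_param :: "(real^2) set \<Rightarrow> (circle \<Rightarrow> real^2) \<Rightarrow> bool" where
  "boundary_param K \<gamma> \<longleftrightarrow>
     smooth_on UNIV (\<lambda>t. \<gamma> (circ t)) \<and> inj \<gamma> \<and> range \<gamma> = frontier K \<and>
     (\<forall>q. norm (circle_deriv \<gamma> q) = 1) \<and>
     (\<forall>q. \<forall>x\<in>K. 0 \<le> det2 (circle_deriv \<gamma> q) (x - \<gamma> q))"

text \<open>
  For an arc-length parametrization \<open>det2 \<gamma>' \<gamma>''\<close> is the curvature, with the sign for which the
  counterclockwise boundary of a disc has positive curvature.
\<close>

definition billiard_tables :: "(circle \<Rightarrow> real^2) set" where
  "billiard_tables =
     {\<gamma>. \<exists>K. compact K \<and> convex K \<and> interior K \<noteq> {} \<and> boundary_param K \<gamma> \<and>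
        (\<forall>q. 0 < det2 (circle_deriv \<gamma> q) (circle_deriv (circle_deriv \<gamma>) q))}"

definition table_homotopy ::
  "(real \<Rightarrow> circle \<Rightarrow> real^2) \<Rightarrow> (circle \<Rightarrow> real^2) \<Rightarrow> (circle \<Rightarrow> real^2) \<Rightarrow> bool" where
  "table_homotopy \<Gamma> \<alpha> \<beta> \<longleftrightarrow>
     smooth_on ({0..1} \<times> UNIV) (\<lambda>(s, t). \<Gamma> s (circ t)) \<and>
     (\<forall>s\<in>{0..1}. \<Gamma> s \<in> billiard_tables) \<and> \<Gamma> 0 = \<alpha> \<and> \<Gamma> 1 = \<beta>"

definition homotopy_length :: "(real \<Rightarrow> circle \<Rightarrow> real^2) \<Rightarrow> real" where
  "homotopy_length \<Gamma> =
     integral {0..1} (\<lambda>s. SUP q. norm (vector_derivative (\<lambda>r. \<Gamma> r q) (at s within {0..1})))"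

definition geometric_dist :: "(circle \<Rightarrow> real^2) \<Rightarrow> (circle \<Rightarrow> real^2) \<Rightarrow> ereal" where
  "geometric_dist \<alpha> \<beta> = Inf {ereal (homotopy_length \<Gamma>) | \<Gamma>. table_homotopy \<Gamma> \<alpha> \<beta>}"


section \<open>Billiard ball maps\<close>

definition chord_dir :: "(circle \<Rightarrow> real^2) \<Rightarrow> circle \<Rightarrow> circle \<Rightarrow> real^2" where
  "chord_dir \<gamma> q Q = (1 / norm (\<gamma> Q - \<gamma> q)) *\<^sub>R (\<gamma> Q - \<gamma> q)"

definition billiard_map :: "(circle \<Rightarrow> real^2) \<Rightarrow> circle \<times> real \<Rightarrow> circle \<times> real" where
  "billiard_map \<gamma> = (\<lambda>z\<in>annulus. THE Z.
     fst Z \<noteq> fst z \<and>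
     snd z = chord_dir \<gamma> (fst z) (fst Z) \<bullet> circle_deriv \<gamma> (fst z) \<and>
     snd Z = chord_dir \<gamma> (fst z) (fst Z) \<bullet> circle_deriv \<gamma> (fst Z))"

text \<open>The round disc of perimeter 1. By symmetry its billiard ball map does not depend on the
  choice of the centre and of the marked point.\<close>

lift_definition disc_table :: "circle \<Rightarrow> real^2" is
  "\<lambda>t. (1 / (2 * pi)) *\<^sub>R vector [cos (2 * pi * t), sin (2 * pi * t)]"
proof -
  fix x y :: real
  assume "circle_rel x y"
  then obtain k :: int where "x = y + of_int k"
    unfolding circle_rel_def by (metis Ints_cases add.commute diff_add_cancel)
  then have "2 * pi * x = 2 * pi * y + 2 * pi * of_int k"
    by (simp add: algebra_simps)
  then have "cos (2 * pi * x) = cos (2 * pi * y)" "sin (2 * pi * x) = sin (2 * pi * y)"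
    by (simp_all add: cos_add sin_add)
  then show "(1 / (2 * pi)) *\<^sub>R (vector [cos (2 * pi * x), sin (2 * pi * x)] :: real^2) =
      (1 / (2 * pi)) *\<^sub>R vector [cos (2 * pi * y), sin (2 * pi * y)]"
    by simp
qed


section \<open>Hamiltonian paths and the Hofer distance\<close>

text \<open>
  \<open>\<psi>\<close> is a Hamiltonian path with family of functions \<open>H\<close>. The last two conjuncts say
  \<open>d\<psi>\<^sub>s/ds = X\<^sub>s \<circ> \<psi>\<^sub>s\<close> and \<open>dH\<^sub>s = - i\<^bsub>X\<^sub>s\<^esub> \<omega>\<close>. The values \<open>\<psi> s\<close>, \<open>H s\<close> for \<open>s\<close> outside \<open>[0,1]\<close> and
  \<open>H s z\<close> for \<open>z\<close> outside the annulus are irrelevant.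
\<close>

definition hamiltonian_path_with ::
  "(real \<Rightarrow> circle \<times> real \<Rightarrow> circle \<times> real) \<Rightarrow> (real \<Rightarrow> circle \<times> real \<Rightarrow> real) \<Rightarrow> bool" where
  "hamiltonian_path_with \<psi> H \<longleftrightarrow>
     (\<forall>s\<in>{0..1}. symplectomorphism (\<psi> s)) \<and>
     continuous_on ({0..1} \<times> closed_annulus) (\<lambda>(s, z). if z \<in> annulus then \<psi> s z else z) \<and>
     smooth_on ({0..1} \<times> strip) (\<lambda>(s, z). H s (cov z)) \<and>
     continuous_on ({0..1} \<times> closed_annulus) (\<lambda>(s, z). if z \<in> annulus then H s z else 0) \<and>
     (\<exists>F X. smooth_lift ({0..1} \<times> strip) (\<lambda>(s, z). \<psi> s (cov z)) F \<and>
        (\<forall>s\<in>{0..1}. \<forall>z\<in>strip.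
           ((\<lambda>r. F (r, z)) has_vector_derivative X s (\<psi> s (cov z))) (at s within {0..1})) \<and>
        (\<forall>s\<in>{0..1}. \<forall>z\<in>strip.
           ((\<lambda>y. H s (cov y)) has_derivative (\<lambda>w. - omega (X s (cov z)) w)) (at z)))"

definition hamiltonian_path :: "(real \<Rightarrow> circle \<times> real \<Rightarrow> circle \<times> real) \<Rightarrow> bool" where
  "hamiltonian_path \<psi> \<longleftrightarrow> (\<exists>H. hamiltonian_path_with \<psi> H)"

definition Ham :: "(circle \<times> real \<Rightarrow> circle \<times> real) set" where
  "Ham = {\<psi> 1 | \<psi>. hamiltonian_path \<psi> \<and> \<psi> 0 = (\<lambda>z\<in>annulus. z)}"

definition BM :: "(circle \<times> real \<Rightarrow> circle \<times> real) set" where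
  "BM = {compose annulus (billiard_map disc_table) \<phi> | \<phi>. \<phi> \<in> Ham}"

definition hofer_length :: "(real \<Rightarrow> circle \<times> real \<Rightarrow> real) \<Rightarrow> real" where
  "hofer_length H = integral {0..1} (\<lambda>s. (SUP z\<in>annulus. H s z) - (INF z\<in>annulus. H s z))"

definition hofer_dist ::
  "(circle \<times> real \<Rightarrow> circle \<times> real) \<Rightarrow> (circle \<times> real \<Rightarrow> circle \<times> real) \<Rightarrow> ereal" where
  "hofer_dist \<phi> \<psi> =
     Inf {ereal (hofer_length H) | \<Psi> H. hamiltonian_path_with \<Psi> H \<and> \<Psi> 0 = \<phi> \<and> \<Psi> 1 = \<psi>}"

end

theory Submission
  imports Defs
begin

text \<open>
  For a path of tables \<open>\<gamma>\<^sub>s\<close> let \<open>h(s,q,Q) = |\<gamma>\<^sub>s(Q) - \<gamma>\<^sub>s(q)|\<close>. The billiard ball map \<open>\<psi>\<^sub>s(q,p) = (Q,P)\<close> is given by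
  \<open>P dQ - p dq = dh\<close> for fixed \<open>s\<close>, and varying \<open>s\<close> adds the term \<open>\<partial>\<^sub>sh ds\<close>; taking the exterior derivative shows
  that \<open>\<psi>\<^sub>s\<close> is symplectic and Hamiltonian with \<open>H\<^sub>s \<circ> \<psi>\<^sub>s = - \<partial>\<^sub>sh\<close>. Since \<open>|\<partial>\<^sub>sh| \<le> 2 max |\<partial>\<^sub>s\<gamma>\<^sub>s|\<close>, the oscillation of
  \<open>H\<^sub>s\<close> is at most \<open>4 max |\<partial>\<^sub>s\<gamma>\<^sub>s|\<close>, which is the inequality. Strict convexity makes \<open>p\<close> a strictly decreasing function
  of \<open>Q\<close>, so \<open>Q(s,q,p)\<close> is smooth by the implicit function theorem, up to the end points of \<open>[0,1]\<close>.
  Any two tables are joined by interpolating their radii of curvature as functions of the tangent direction.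
\<close>

section \<open>Calculus of smooth functions\<close>

text \<open>Two requirements shape the proof. Smoothness must reach \<open>s = 0\<close> and
  \<open>s = 1\<close>, so derivatives are taken within sets, and the mixed derivatives in
  \<open>s\<close> and \<open>t\<close> have to agree at the end points as well. The annulus is
  treated through its covering: the map, its inverse and the Hamiltonian live on the strip and are
  equivariant under \<open>q \<mapsto> q + 1\<close>. A chord collapses both as \<open>Q - q\<close>
  tends to 0 (at \<open>p = 1\<close>) and as it tends to 1 (at \<open>p = -1\<close>), so boundary
  limits of the lift are known only up to an integer. The Hamiltonian tends to 0 there because the
  two ends of a collapsing chord acquire the same velocity. Interpolating radii of curvature works
  since the closing condition and the total length are linear in the radius as a function of
  direction, and positivity is preserved. Membership in \<open>BM\<close> asks for a factor on the
  right. It is the end point of the path \<open>\<psi>_0^{-1} \<psi>_s\<close>, whose Hamiltonian is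
  \<open>H_s\<close> composed with \<open>\<psi>_0\<close>.\<close>

lemma Ck_on_cong: "Ck_on k S f \<Longrightarrow> (\<And>x. x \<in> S \<Longrightarrow> f x = g x) \<Longrightarrow> Ck_on k S g"
proof (cases k)
  case 0
  assume "Ck_on k S f" "\<And>x. x \<in> S \<Longrightarrow> f x = g x"
  with 0 show ?thesis by (auto cong: continuous_on_cong)
next
  case (Suc l)
  assume *: "Ck_on k S f" "\<And>x. x \<in> S \<Longrightarrow> f x = g x"
  with Suc obtain f' where "\<forall>x\<in>S. (f has_derivative f' x) (at x within S)" "\<forall>v. Ck_on l S (\<lambda>x. f' x v)"
    by auto
  with * Suc show ?thesis
    by (auto intro!: exI[of _ f'] has_derivative_transform[of _ S g f])
qed

lemma Ck_on_SucD: "Ck_on (Suc k) S f \<Longrightarrow> Ck_on k S f"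
proof (induction k arbitrary: f)
  case 0
  then show ?case
    by (auto simp: continuous_on_eq_continuous_within intro: has_derivative_continuous)
next
  case (Suc k)
  then obtain f' where "\<forall>x\<in>S. (f has_derivative f' x) (at x within S)"
      "\<forall>v. Ck_on (Suc k) S (\<lambda>x. f' x v)"
    unfolding Ck_on.simps(2)[of "Suc k"] by blast
  with Suc.IH show ?case by auto
qed

lemma Ck_on_const: "Ck_on k S (\<lambda>x. c)"
proof (induction k arbitrary: c)
  case (Suc k)
  then show ?case by (auto intro!: exI[of _ "\<lambda>_ _. 0"])
qed auto

lemma Ck_on_bounded_linear:
  assumes "bounded_linear L" shows "Ck_on k S f \<Longrightarrow> Ck_on k S (\<lambda>x. L (f x))"
proof (induction k arbitrary: f)
  case 0
  then show ?case using assms by (auto intro: bounded_linear.continuous_on)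
next
  case (Suc k)
  then obtain f' where "\<forall>x\<in>S. (f has_derivative f' x) (at x within S)" "\<forall>v. Ck_on k S (\<lambda>x. f' x v)"
    by auto
  with Suc.IH show ?case
    by (auto intro!: exI[of _ "\<lambda>x v. L (f' x v)"] bounded_linear.has_derivative[OF assms])
qed

lemma Ck_on_id: "Ck_on k S (\<lambda>x. x)"
  by (cases k) (auto intro!: exI[of _ "\<lambda>_ v. v"] Ck_on_const)

lemma Ck_on_add: "Ck_on k S f \<Longrightarrow> Ck_on k S g \<Longrightarrow> Ck_on k S (\<lambda>x. f x + g x)"
proof (induction k arbitrary: f g)
  case 0
  then show ?case by (auto intro: continuous_on_add)
next
  case (Suc k)
  then obtain f' g' where "\<forall>x\<in>S. (f has_derivative f' x) (at x within S)" "\<forall>v. Ck_on k S (\<lambda>x. f' x v)"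
      "\<forall>x\<in>S. (g has_derivative g' x) (at x within S)" "\<forall>v. Ck_on k S (\<lambda>x. g' x v)"
    by auto
  with Suc.IH show ?case
    by (auto intro!: exI[of _ "\<lambda>x v. f' x v + g' x v"] has_derivative_add)
qed

lemma Ck_on_sum: "(\<And>i. i \<in> A \<Longrightarrow> Ck_on k S (f i)) \<Longrightarrow> Ck_on k S (\<lambda>x. \<Sum>i\<in>A. f i x)"
  by (induction A rule: infinite_finite_induct) (auto intro: Ck_on_const Ck_on_add)

lemma Ck_on_bilinear:
  assumes "bounded_bilinear B"
  shows "Ck_on k S f \<Longrightarrow> Ck_on k S g \<Longrightarrow> Ck_on k S (\<lambda>x. B (f x) (g x))"
proof (induction k arbitrary: f g)
  case 0
  then show ?case using assms by (auto intro: bounded_bilinear.continuous_on)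
next
  case (Suc k)
  then obtain f' g' where *: "\<forall>x\<in>S. (f has_derivative f' x) (at x within S)" "\<forall>v. Ck_on k S (\<lambda>x. f' x v)"
      "\<forall>x\<in>S. (g has_derivative g' x) (at x within S)" "\<forall>v. Ck_on k S (\<lambda>x. g' x v)"
    by auto
  have "Ck_on k S f" "Ck_on k S g"
    using Suc.prems Ck_on_SucD by blast+
  with * Suc.IH show ?case
    by (auto intro!: exI[of _ "\<lambda>x v. B (f x) (g' x v) + B (f' x v) (g x)"] Ck_on_add
        bounded_bilinear.FDERIV[OF assms])
qed

lemma Ck_on_Pair: "Ck_on k S f \<Longrightarrow> Ck_on k S g \<Longrightarrow> Ck_on k S (\<lambda>x. (f x, g x))"
proof (induction k arbitrary: f g)
  case 0
  then show ?case by (auto intro: continuous_on_Pair)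
next
  case (Suc k)
  then obtain f' g' where "\<forall>x\<in>S. (f has_derivative f' x) (at x within S)" "\<forall>v. Ck_on k S (\<lambda>x. f' x v)"
      "\<forall>x\<in>S. (g has_derivative g' x) (at x within S)" "\<forall>v. Ck_on k S (\<lambda>x. g' x v)"
    by auto
  with Suc.IH show ?case
    by (auto intro!: exI[of _ "\<lambda>x v. (f' x v, g' x v)"] has_derivative_Pair)
qed

text \<open>\<open>Ck_on\<close> controls \<open>g' x v\<close> for fixed \<open>v\<close> only,
  while the chain rule produces a direction depending on the point; expanding it in the basis
  returns to fixed directions.\<close>

lemma linear_euclidean_expand:
  fixes L :: "'a::euclidean_space \<Rightarrow> 'b::real_normed_vector"
  assumes "linear L"
  shows "L v = (\<Sum>b\<in>Basis. (v \<bullet> b) *\<^sub>R L b)"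
proof -
  have "L v = L (\<Sum>b\<in>Basis. (v \<bullet> b) *\<^sub>R b)" by (simp add: euclidean_representation)
  then show ?thesis by (simp add: linear_sum[OF assms] linear_scale[OF assms])
qed

lemma Ck_on_compose:
  fixes g :: "'b::euclidean_space \<Rightarrow> 'c::real_normed_vector"
  shows "Ck_on k T g \<Longrightarrow> Ck_on k S f \<Longrightarrow> f ` S \<subseteq> T \<Longrightarrow> Ck_on k S (\<lambda>x. g (f x))"
proof (induction k arbitrary: g)
  case 0
  then show ?case by (auto intro: continuous_on_compose2)
next
  case (Suc k)
  then obtain f' g' where *: "\<forall>x\<in>S. (f has_derivative f' x) (at x within S)" "\<forall>v. Ck_on k S (\<lambda>x. f' x v)"
      "\<forall>x\<in>T. (g has_derivative g' x) (at x within T)" "\<forall>v. Ck_on k T (\<lambda>x. g' x v)"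
    by auto
  have f: "Ck_on k S f" using Suc.prems Ck_on_SucD by blast
  show ?case
    unfolding Ck_on.simps
  proof (intro exI conjI allI ballI)
    fix x assume x: "x \<in> S"
    have "(g has_derivative g' (f x)) (at (f x) within f ` S)"
      using *(3) x Suc.prems(3) by (auto intro: has_derivative_subset)
    then show "((\<lambda>x. g (f x)) has_derivative (\<lambda>v. g' (f x) (f' x v))) (at x within S)"
      using *(1) x by (auto intro: has_derivative_in_compose)
  next
    fix v
    have "Ck_on k S (\<lambda>x. \<Sum>b\<in>Basis. (f' x v \<bullet> b) *\<^sub>R g' (f x) b)"
      using *(2,4) Suc.prems(3)
      by (intro Ck_on_sum Ck_on_bilinear[OF bounded_bilinear_scaleR] Suc.IH f
          Ck_on_bilinear[OF bounded_bilinear_inner] Ck_on_const) auto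
    moreover have "(\<Sum>b\<in>Basis. (f' x v \<bullet> b) *\<^sub>R g' (f x) b) = g' (f x) (f' x v)" if "x \<in> S" for x
      using *(3) Suc.prems(3) that
      by (intro linear_euclidean_expand[symmetric]) (auto dest!: has_derivative_linear)
    ultimately show "Ck_on k S (\<lambda>x. g' (f x) (f' x v))"
      by (rule Ck_on_cong) auto
  qed
qed

lemma Ck_on_real_Suc:
  fixes f :: "real \<Rightarrow> real"
  assumes "\<And>x. x \<in> S \<Longrightarrow> (f has_real_derivative f' x) (at x)" "Ck_on k S f'"
  shows "Ck_on (Suc k) S f"
  using assms
  by (auto intro!: exI[of _ "\<lambda>x v. f' x * v"] Ck_on_bilinear[OF bounded_bilinear_mult] Ck_on_const
      simp: has_field_derivative_def intro: has_derivative_at_withinI)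

text \<open>The derivative is a constant times a product of \<open>inverse\<close> with itself, so
  the induction hypothesis covers it. The square root below is treated in the same way.\<close>

lemma Ck_on_inverse_real: "Ck_on k {x::real. x \<noteq> 0} inverse"
proof (induction k)
  case 0
  then show ?case by (auto intro!: continuous_on_inverse)
next
  case (Suc k)
  show ?case
  proof (rule Ck_on_real_Suc)
    show "(inverse has_real_derivative (-1) * (inverse x * inverse x)) (at x)"
      if "x \<in> {x. x \<noteq> 0}" for x :: real
      using that by (auto intro!: derivative_eq_intros)
    show "Ck_on k {x::real. x \<noteq> 0} (\<lambda>x. (-1) * (inverse x * inverse x))"
      by (intro Ck_on_bilinear[OF bounded_bilinear_mult] Ck_on_const Suc)
  qed
qed

lemma Ck_on_sqrt: "Ck_on k {0<..} sqrt"
proof (induction k)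
  case 0
  then show ?case by (auto intro!: continuous_on_real_sqrt)
next
  case (Suc k)
  show ?case
  proof (rule Ck_on_real_Suc)
    show "(sqrt has_real_derivative (inverse (sqrt x) * (1/2))) (at x)"
      if "x \<in> {0<..}" for x :: real
      using that by (auto intro!: derivative_eq_intros)
    show "Ck_on k {0<..} (\<lambda>x. inverse (sqrt x) * (1/2))"
      by (intro Ck_on_bilinear[OF bounded_bilinear_mult] Ck_on_const
          Ck_on_compose[OF Ck_on_inverse_real Suc]) auto
  qed
qed

lemma Ck_on_sin_cos: "Ck_on k S (sin :: real \<Rightarrow> real) \<and> Ck_on k S (cos :: real \<Rightarrow> real)"
proof (induction k)
  case 0
  then show ?case by (auto intro!: continuous_intros)
next
  case (Suc k)
  have "Ck_on k S (\<lambda>x::real. (-1) * sin x)"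
    using Suc by (intro Ck_on_bilinear[OF bounded_bilinear_mult] Ck_on_const) auto
  with Suc show ?case
    by (auto intro!: Ck_on_real_Suc[of S sin cos k] Ck_on_real_Suc[of S cos "\<lambda>x. (-1) * sin x" k]
        derivative_eq_intros simp del: Ck_on.simps)
qed

lemma smooth_on_cong: "smooth_on S f \<Longrightarrow> (\<And>x. x \<in> S \<Longrightarrow> f x = g x) \<Longrightarrow> smooth_on S g"
  unfolding smooth_on_def using Ck_on_cong by blast

lemma smooth_on_const: "smooth_on S (\<lambda>x. c)"
  and smooth_on_id: "smooth_on S (\<lambda>x. x)"
  and smooth_on_add:
    "smooth_on S f \<Longrightarrow> smooth_on S g \<Longrightarrow> smooth_on S (\<lambda>x. f x + g x)"
  and smooth_on_Pair:
    "smooth_on S f1 \<Longrightarrow> smooth_on S g1 \<Longrightarrow> smooth_on S (\<lambda>x. (f1 x, g1 x))"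
  by (auto simp: smooth_on_def Ck_on_const Ck_on_id Ck_on_add Ck_on_Pair)

lemma smooth_on_bounded_linear:
  "bounded_linear L \<Longrightarrow> smooth_on S f \<Longrightarrow> smooth_on S (\<lambda>x. L (f x))"
  by (auto simp: smooth_on_def Ck_on_bounded_linear)

lemma smooth_on_bilinear:
  "bounded_bilinear B \<Longrightarrow> smooth_on S f \<Longrightarrow> smooth_on S g \<Longrightarrow> smooth_on S (\<lambda>x. B (f x) (g x))"
  by (auto simp: smooth_on_def Ck_on_bilinear)

lemmas smooth_on_fst = smooth_on_bounded_linear[OF bounded_linear_fst]
lemmas smooth_on_snd = smooth_on_bounded_linear[OF bounded_linear_snd]
lemmas smooth_on_minus =
  smooth_on_bounded_linear[OF bounded_linear_minus[OF bounded_linear_ident]]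
lemmas smooth_on_scaleR = smooth_on_bilinear[OF bounded_bilinear_scaleR]
lemmas smooth_on_inner = smooth_on_bilinear[OF bounded_bilinear_inner]
lemmas smooth_on_mult =
  smooth_on_bilinear[OF bounded_bilinear_mult[where 'a=real]]

lemma smooth_on_diff:
  "smooth_on S f \<Longrightarrow> smooth_on S g \<Longrightarrow> smooth_on S (\<lambda>x. f x - g x)"
  using smooth_on_add[OF _ smooth_on_minus, of S f g] by simp

lemma smooth_on_compose:
  fixes g :: "'b::euclidean_space \<Rightarrow> 'c::real_normed_vector"
  shows "smooth_on T g \<Longrightarrow> smooth_on S f \<Longrightarrow> (\<And>x. x \<in> S \<Longrightarrow> f x \<in> T) \<Longrightarrow> smooth_on S (\<lambda>x. g (f x))"
  unfolding smooth_on_def using Ck_on_compose[of _ T g S f] by (simp add: image_subset_iff)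

lemma smooth_on_inverse:
  fixes f :: "'a::euclidean_space \<Rightarrow> real"
  shows "smooth_on S f \<Longrightarrow> (\<And>x. x \<in> S \<Longrightarrow> f x \<noteq> 0) \<Longrightarrow> smooth_on S (\<lambda>x. inverse (f x))"
  by (rule smooth_on_compose[of "{x. x \<noteq> 0}"]) (auto simp: smooth_on_def Ck_on_inverse_real)

lemma smooth_on_norm:
  fixes f :: "'a::euclidean_space \<Rightarrow> 'b::real_inner"
  assumes "smooth_on S f" "\<And>x. x \<in> S \<Longrightarrow> f x \<noteq> 0"
  shows "smooth_on S (\<lambda>x. norm (f x))"
  unfolding norm_eq_sqrt_inner using assms
  by (rule_tac smooth_on_compose[of "{0<..}" sqrt])
    (auto simp: smooth_on_def Ck_on_sqrt intro!: Ck_on_bilinear[OF bounded_bilinear_inner])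

lemma smooth_on_sin: "smooth_on S f \<Longrightarrow> smooth_on S (\<lambda>x. sin (f x :: real))"
  by (rule smooth_on_compose[of UNIV sin]) (auto simp: smooth_on_def Ck_on_sin_cos)

lemma smooth_on_cos: "smooth_on S f \<Longrightarrow> smooth_on S (\<lambda>x. cos (f x :: real))"
  by (rule smooth_on_compose[of UNIV cos]) (auto simp: smooth_on_def Ck_on_sin_cos)

lemma smooth_on_imp_continuous_on: "smooth_on S f \<Longrightarrow> continuous_on S f"
  unfolding smooth_on_def by (metis Ck_on.simps(1))

lemma smooth_on_vec2:
  fixes f :: "'a::euclidean_space \<Rightarrow> real^2"
  assumes "smooth_on S (\<lambda>x. f x $ 1)" "smooth_on S (\<lambda>x. f x $ 2)"
  shows "smooth_on S f"
proof -
  have "smooth_on S (\<lambda>x. (f x $ 1) *\<^sub>R axis 1 1 + (f x $ 2) *\<^sub>R axis 2 (1::real))"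
    using assms by (intro smooth_on_add smooth_on_scaleR smooth_on_const)
  then show ?thesis
    by (rule smooth_on_cong) (auto simp: vec_eq_iff forall_2 axis_def)
qed

lemma smooth_on_realI:
  fixes f :: "real \<Rightarrow> real"
  assumes "\<And>x. (f has_real_derivative f' x) (at x)" "smooth_on UNIV f'"
  shows "smooth_on UNIV f"
  unfolding smooth_on_def
proof
  fix k show "Ck_on k UNIV f"
    using assms Ck_on_real_Suc[of UNIV f f' k] Ck_on_SucD unfolding smooth_on_def by blast
qed

text \<open>Sets on which the derivative within the set is unique.\<close>

definition fat :: "'a::euclidean_space set \<Rightarrow> bool" where
  "fat S \<longleftrightarrow> (\<forall>x\<in>S. \<forall>i\<in>Basis. \<forall>e>0. \<exists>d. 0 < \<bar>d\<bar> \<and> \<bar>d\<bar> < e \<and> x + d *\<^sub>R i \<in> S)"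

lemma fat_open: "open S \<Longrightarrow> fat S"
  unfolding fat_def
proof (intro ballI allI impI)
  fix x i and e :: real assume *: "open S" "x \<in> S" "i \<in> (Basis::'a set)" "0 < e"
  then obtain d where d: "0 < d" "ball x d \<subseteq> S" by (auto elim: openE)
  then have "x + (min d e / 2) *\<^sub>R i \<in> S" using * by (intro subsetD[OF d(2)]) (auto simp: dist_norm)
  then show "\<exists>d. 0 < \<bar>d\<bar> \<and> \<bar>d\<bar> < e \<and> x + d *\<^sub>R i \<in> S"
    using d * by (intro exI[of _ "min d e / 2"]) auto
qed

lemma fat_Times: "fat S \<Longrightarrow> fat T \<Longrightarrow> fat (S \<times> T)"
  unfolding fat_def
proof (intro ballI allI impI, goal_cases)
  case (1 x i e)
  then consider (l) j where "j \<in> Basis" "i = (j, 0)" | (r) j where "j \<in> Basis" "i = (0, j)"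
    by (auto simp: Basis_prod_def)
  then show ?case
  proof cases
    case l
    with 1 obtain d where "0 < \<bar>d\<bar>" "\<bar>d\<bar> < e" "fst x + d *\<^sub>R j \<in> S" unfolding mem_Times_iff by blast
    with l 1 show ?thesis by (intro exI[of _ d]) (auto simp: mem_Times_iff)
  next
    case r
    with 1 obtain d where "0 < \<bar>d\<bar>" "\<bar>d\<bar> < e" "snd x + d *\<^sub>R j \<in> T" unfolding mem_Times_iff by blast
    with r 1 show ?thesis by (intro exI[of _ d]) (auto simp: mem_Times_iff)
  qed
qed

lemma fat_Icc: "fat {0..1::real}"
  unfolding fat_def
proof (intro ballI allI impI)
  fix x i e :: real assume *: "x \<in> {0..1}" "i \<in> Basis" "0 < e"
  show "\<exists>d. 0 < \<bar>d\<bar> \<and> \<bar>d\<bar> < e \<and> x + d *\<^sub>R i \<in> {0..1}"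
  proof (cases "x \<le> 1/2")
    case True
    with * show ?thesis by (intro exI[of _ "min e (1/2) / 2"]) auto
  next
    case False
    with * show ?thesis by (intro exI[of _ "- min e (1/2) / 2"]) auto
  qed
qed

lemma fat_derivative_unique:
  assumes "fat S" "x \<in> S" "(f has_derivative f') (at x within S)" "(f has_derivative f'') (at x within S)"
  shows "f' = f''"
  using assms frechet_derivative_unique_within[OF assms(3,4)] unfolding fat_def by blast

text \<open>Every order \<open>k\<close> comes with its own derivative. Fatness makes derivatives
  unique, so all these choices agree on \<open>S\<close> and one of them serves all orders.\<close>

lemma smooth_on_derivative:
  assumes S: "fat S" and f: "smooth_on S f"
  obtains f' where "\<And>x. x \<in> S \<Longrightarrow> (f has_derivative f' x) (at x within S)"
    "\<And>v. smooth_on S (\<lambda>x. f' x v)"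
proof -
  have "\<exists>f'. (\<forall>x\<in>S. (f has_derivative f' x) (at x within S)) \<and> (\<forall>v. Ck_on k S (\<lambda>x. f' x v))" for k
    using f unfolding smooth_on_def by (metis Ck_on.simps(2))
  then obtain D where D: "\<And>k x. x \<in> S \<Longrightarrow> (f has_derivative D k x) (at x within S)"
      "\<And>k v. Ck_on k S (\<lambda>x. D k x v)"
    by metis
  have "smooth_on S (\<lambda>x. D 0 x v)" for v
    unfolding smooth_on_def
  proof
    fix k
    have "D k x v = D 0 x v" if "x \<in> S" for x
      using fat_derivative_unique[OF S that D(1) D(1)] that by metis
    then show "Ck_on k S (\<lambda>x. D 0 x v)"
      by (rule Ck_on_cong[OF D(2)])
  qed
  with D(1) that show ?thesis by blast
qed

text \<open>Along the graph of \<open>y\<close> the function \<open>E\<close> vanishes, so its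
  linear part at the increment is of lower order; dividing by the slope \<open>E' (0, 1)\<close>
  isolates the increment of \<open>y\<close>. Everything happens within \<open>S\<close>, so
  boundary points of \<open>S\<close> are covered.\<close>

lemma has_derivative_implicit:
  fixes E :: "'a::real_normed_vector \<times> real \<Rightarrow> real"
  assumes E: "(E has_derivative E') (at (x0, y x0) within S \<times> I)"
    and y: "\<And>x. x \<in> S \<Longrightarrow> y x \<in> I \<and> E (x, y x) = 0" and x0: "x0 \<in> S"
    and cont: "continuous (at x0 within S) y" and b: "E' (0, 1) \<noteq> 0"
  shows "(y has_derivative (\<lambda>v. - E' (v, 0) / E' (0, 1))) (at x0 within S)"
  unfolding has_derivative_within_alt
proof (intro conjI allI impI)
  let ?b = "E' (0, 1)"
  define B where "B = \<bar>?b\<bar>"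
  have B: "B > 0" using b by (simp add: B_def)
  from E interpret E': bounded_linear E' by (rule has_derivative_bounded_linear)
  have "bounded_linear (\<lambda>v::'a. (v, 0::real))"
    by (intro bounded_linear_Pair bounded_linear_ident bounded_linear_zero)
  from bounded_linear_compose[OF E'.bounded_linear this]
  have bl: "bounded_linear (\<lambda>v. E' (v, 0))" .
  have "bounded_linear (\<lambda>v. (-1/?b) * E' (v, 0))"
    by (rule bounded_linear_compose[OF bounded_linear_mult_right bl])
  then show "bounded_linear (\<lambda>v. - E' (v, 0) / ?b)" by simp
  fix e :: real assume e: "0 < e"
  obtain M where M: "M > 0" "\<And>v. norm (E' (v, 0)) \<le> norm v * M"
    using bounded_linear.pos_bounded[OF bl] by blast
  \<comment> \<open>\<open>C\<close> is a Lipschitz bound for \<open>y\<close> at \<open>x0\<close>,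
    obtained once \<open>\<eta> \<le> B / 2\<close> lets the increment of \<open>y\<close> be
    absorbed on the left. The second bound on \<open>\<eta>\<close> turns the resulting error
    \<open>\<eta> * (1 + C)\<close> into \<open>e * B\<close>.\<close>
  define C where "C = 2 * (M + B) / B"
  define \<eta> where "\<eta> = min (B / 2) (e * B / (1 + C))"
  have C: "C > 0" using M B by (auto simp: C_def)
  have \<eta>: "\<eta> > 0" "\<eta> \<le> B / 2" "\<eta> \<le> e * B / (1 + C)"
    using B C e min.cobounded1[of "B / 2" "e * B / (1 + C)"] min.cobounded2[of "B / 2" "e * B / (1 + C)"]
    unfolding \<eta>_def by simp_all
  with C have \<eta>C: "\<eta> * (1 + C) \<le> e * B"
    by (simp add: pos_le_divide_eq)
  obtain d where d: "d > 0" "\<And>z. z \<in> S \<times> I \<Longrightarrow> norm (z - (x0, y x0)) < d \<Longrightarrow>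
      norm (E z - E (x0, y x0) - E' (z - (x0, y x0))) \<le> \<eta> * norm (z - (x0, y x0))"
    using E \<eta>(1) unfolding has_derivative_within_alt by blast
  obtain d' where d': "d' > 0" "\<And>x. x \<in> S \<Longrightarrow> dist x x0 < d' \<Longrightarrow> dist (y x) (y x0) < d / 2"
    using cont d(1) unfolding continuous_within_eps_delta by (meson half_gt_zero)
  show "\<exists>d>0. \<forall>x\<in>S. norm (x - x0) < d \<longrightarrow>
      norm (y x - y x0 - - E' (x - x0, 0) / ?b) \<le> e * norm (x - x0)"
  proof (intro exI[of _ "min d' (d / 2)"] conjI ballI impI)
    fix x assume x: "x \<in> S" "norm (x - x0) < min d' (d / 2)"
    define p q where "p = norm (x - x0)" and "q = \<bar>y x - y x0\<bar>"
    have pq: "norm ((x, y x) - (x0, y x0)) \<le> p + q"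
      unfolding p_def q_def using sqrt_sum_squares_le_sum[of "norm (x - x0)" "\<bar>y x - y x0\<bar>"]
      by (simp add: norm_Pair)
    also have "\<dots> < d" using x d'(2)[of x] by (auto simp: p_def q_def dist_norm)
    finally have "norm (E (x, y x) - E (x0, y x0) - E' ((x, y x) - (x0, y x0)))
        \<le> \<eta> * norm ((x, y x) - (x0, y x0))"
      using x y by (intro d) auto
    also have "\<dots> \<le> \<eta> * (p + q)" using pq \<eta> by (intro mult_left_mono) auto
    finally have 1: "norm (E' (x - x0, y x - y x0)) \<le> \<eta> * (p + q)"
      using y x x0 by simp
    have "E' (x - x0, y x - y x0) = E' ((x - x0, 0) + (y x - y x0) *\<^sub>R (0, 1))" by simp
    also have "\<dots> = E' (x - x0, 0) + (y x - y x0) * ?b" unfolding E'.add E'.scaleR by simp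
    finally have 2: "\<bar>E' (x - x0, 0) + (y x - y x0) * ?b\<bar> \<le> \<eta> * (p + q)" using 1 by simp
    have "q * B = \<bar>(y x - y x0) * ?b\<bar>" by (simp add: q_def B_def abs_mult)
    also have "\<dots> \<le> \<eta> * (p + q) + p * M"
      using 2 M(2)[of "x - x0"] by (simp add: p_def)
    also have "\<dots> \<le> B / 2 * (p + q) + p * M"
      using \<eta>(2) by (intro add_right_mono mult_right_mono) (auto simp: p_def q_def)
    finally have "q * B \<le> p * (2 * (M + B)) - p * B" by (simp add: algebra_simps add_divide_distrib)
    also have "\<dots> \<le> p * (2 * (M + B))" using B by (simp add: p_def)
    finally have qC: "q \<le> C * p" using B by (simp add: C_def field_simps)
    have "?b * (y x - y x0 - - E' (x - x0, 0) / ?b) = E' (x - x0, 0) + (y x - y x0) * ?b"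
      using b by (simp add: field_simps)
    then have "B * norm (y x - y x0 - - E' (x - x0, 0) / ?b) = \<bar>E' (x - x0, 0) + (y x - y x0) * ?b\<bar>"
      unfolding B_def real_norm_def abs_mult[symmetric] by simp
    also have "\<dots> \<le> \<eta> * (p + q)" by (rule 2)
    also have "\<dots> \<le> \<eta> * (p + C * p)" using qC \<eta> by (intro mult_left_mono) auto
    also have "\<dots> = (\<eta> * (1 + C)) * p" by (simp add: algebra_simps)
    also have "\<dots> \<le> (e * B) * p" using \<eta>C by (intro mult_right_mono) (auto simp: p_def)
    finally have "B * norm (y x - y x0 - - E' (x - x0, 0) / ?b) \<le> B * (e * p)" by (simp add: mult_ac)
    then show "norm (y x - y x0 - - E' (x - x0, 0) / ?b) \<le> e * norm (x - x0)"
      using B unfolding p_def mult_le_cancel_left by auto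
  qed (use d d' in auto)
qed

lemma strict_mono_on_deriv_pos:
  fixes f :: "real \<Rightarrow> real"
  assumes "is_interval I" "\<And>t. t \<in> I \<Longrightarrow> \<exists>D>0. (f has_real_derivative D) (at t)"
  shows "strict_mono_on I f"
proof (rule strict_mono_onI)
  fix a b assume ab: "a \<in> I" "b \<in> I" "a < b"
  then have "x \<in> I" if "a \<le> x" "x \<le> b" for x
    using assms(1) that unfolding is_interval_1 by blast
  with assms(2) show "f a < f b"
    by (intro DERIV_pos_imp_increasing[OF ab(3)]) blast
qed

text \<open>Monotonicity in the last variable on all of \<open>I\<close> replaces a local inversion:
  the signs of \<open>E\<close> on both sides of \<open>y x0\<close> persist for nearby
  \<open>x\<close> and trap \<open>y x\<close>, whence continuity. The derivative formula contains
  \<open>y\<close> undifferentiated, so each order of smoothness yields the next.\<close>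

theorem smooth_on_implicit:
  fixes E :: "'a::euclidean_space \<times> real \<Rightarrow> real"
  assumes I: "open I" "is_interval I" and E: "smooth_on (S \<times> I) E"
    and D: "\<And>x t. x \<in> S \<Longrightarrow> t \<in> I \<Longrightarrow> \<exists>D>0. ((\<lambda>t. E (x, t)) has_real_derivative D) (at t)"
    and y: "\<And>x. x \<in> S \<Longrightarrow> y x \<in> I \<and> E (x, y x) = 0"
  shows "smooth_on S y"
proof -
  have mono: "strict_mono_on I (\<lambda>t. E (x, t))" if "x \<in> S" for x
    using D that by (intro strict_mono_on_deriv_pos I) auto
  have cont: "continuous (at x0 within S) y" if x0: "x0 \<in> S" for x0
    unfolding continuous_within
  proof -
    have ev: "((\<lambda>x. E (x, t)) \<longlongrightarrow> E (x0, t)) (at x0 within S)" if "t \<in> I" for t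
    proof -
      have "continuous_on S (\<lambda>x. E (x, t))"
        using that by (intro continuous_on_compose2[OF smooth_on_imp_continuous_on[OF E]])
          (auto intro!: continuous_intros)
      then show ?thesis using x0 by (simp add: continuous_on)
    qed
    obtain e where e: "e > 0" "ball (y x0) e \<subseteq> I"
      using I y x0 by (meson openE)
    show "(y \<longlongrightarrow> y x0) (at x0 within S)"
    proof (rule order_tendstoI)
      fix a assume "a < y x0"
      \<comment> \<open>The bound \<open>a\<close> may lie outside \<open>I\<close>; it is moved
        towards \<open>y x0\<close> to a point where \<open>E\<close> can be evaluated.\<close>
      define t where "t = max a (y x0 - e / 2)"
      have t: "t < y x0" "a \<le> t" "t \<in> I"
        using e \<open>a < y x0\<close> by (auto simp: t_def intro!: subsetD[OF e(2)] simp: dist_real_def)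
      then have "E (x0, t) < 0" using mono[OF x0] y[OF x0] by (metis strict_mono_onD)
      then have "\<forall>\<^sub>F x in at x0 within S. E (x, t) < 0"
        using ev[OF t(3)] by (simp add: order_tendstoD)
      moreover have "\<forall>\<^sub>F x in at x0 within S. x \<in> S" by (simp add: eventually_at_filter)
      ultimately show "\<forall>\<^sub>F x in at x0 within S. a < y x"
      proof eventually_elim
        case (elim x)
        then show ?case
          using mono[of x] y[of x] t strict_mono_on_less_eq[of I "\<lambda>t. E (x, t)" "y x" t] by force
      qed
    next
      fix a assume "y x0 < a"
      define t where "t = min a (y x0 + e / 2)"
      have t: "y x0 < t" "t \<le> a" "t \<in> I"
        using e \<open>y x0 < a\<close> by (auto simp: t_def intro!: subsetD[OF e(2)] simp: dist_real_def)
      then have "E (x0, t) > 0" using mono[OF x0] y[OF x0] by (metis strict_mono_onD)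
      then have "\<forall>\<^sub>F x in at x0 within S. E (x, t) > 0"
        using ev[OF t(3)] by (simp add: order_tendstoD)
      moreover have "\<forall>\<^sub>F x in at x0 within S. x \<in> S" by (simp add: eventually_at_filter)
      ultimately show "\<forall>\<^sub>F x in at x0 within S. y x < a"
      proof eventually_elim
        case (elim x)
        then show ?case
          using mono[of x] y[of x] t strict_mono_on_less_eq[of I "\<lambda>t. E (x, t)" t "y x"] by force
      qed
    qed
  qed
  have "Ck_on k S y" for k
  proof (induction k)
    case 0
    then show ?case using cont by (simp add: continuous_on_eq_continuous_within)
  next
    case (Suc k)
    have "Ck_on (Suc k) (S \<times> I) E" using E by (simp add: smooth_on_def)
    then obtain E' where E': "\<And>z. z \<in> S \<times> I \<Longrightarrow> (E has_derivative E' z) (at z within S \<times> I)"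
        "\<And>v. Ck_on k (S \<times> I) (\<lambda>z. E' z v)"
      unfolding Ck_on.simps by blast
    have b: "E' (x, y x) (0, 1) > 0" if x: "x \<in> S" for x
    proof -
      have "((\<lambda>t. (x, t)) has_derivative (\<lambda>h. (0, h))) (at (y x) within I)"
        by (auto intro!: derivative_eq_intros)
      then have "((\<lambda>t. E (x, t)) has_derivative (\<lambda>h. E' (x, y x) (0, h))) (at (y x) within I)"
        by (rule has_derivative_in_compose, intro has_derivative_subset[OF E'(1)]) (use x y in auto)
      then have "((\<lambda>t. E (x, t)) has_derivative (\<lambda>h. E' (x, y x) (0, h))) (at (y x))"
        using at_within_open[of "y x" I] I y[OF x] by simp
      moreover obtain D where "D > 0" "((\<lambda>t. E (x, t)) has_derivative (*) D) (at (y x))"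
        using D[OF x, of "y x"] y[OF x] unfolding has_field_derivative_def by auto
      ultimately have "(\<lambda>h. E' (x, y x) (0, h)) = (*) D" by (intro has_derivative_unique)
      from fun_cong[OF this, of 1] \<open>D > 0\<close> show ?thesis by simp
    qed
    show ?case unfolding Ck_on.simps
    proof (intro exI conjI ballI allI)
      fix x assume x: "x \<in> S"
      show "(y has_derivative (\<lambda>v. - E' (x, y x) (v, 0) / E' (x, y x) (0, 1))) (at x within S)"
        using b[OF x] y x by (intro has_derivative_implicit[where I=I and E=E] E'(1) cont) auto
    next
      fix v
      have *: "Ck_on k S (\<lambda>x. E' (x, y x) w)" for w
        using y by (intro Ck_on_compose[OF E'(2)] Ck_on_Pair Ck_on_id Suc) auto
      have "Ck_on k S (\<lambda>x. inverse (E' (x, y x) (0, 1)))"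
        by (rule Ck_on_compose[OF Ck_on_inverse_real *]) (use b in fastforce)
      then have "Ck_on k S (\<lambda>x. (-1) * (E' (x, y x) (v, 0) * inverse (E' (x, y x) (0, 1))))"
        by (intro Ck_on_bilinear[OF bounded_bilinear_mult] Ck_on_const *)
      then show "Ck_on k S (\<lambda>x. - E' (x, y x) (v, 0) / E' (x, y x) (0, 1))"
        by (simp add: divide_inverse)
    qed
  qed
  then show ?thesis by (simp add: smooth_on_def)
qed

section \<open>Derivative functions of curves and of one-parameter families of curves\<close>

lemma smooth_on_vector_derivative:
  fixes f :: "real \<Rightarrow> 'b::real_normed_vector"
  assumes "smooth_on UNIV f"
  obtains f1 where "smooth_on UNIV f1" "\<And>t. (f has_vector_derivative f1 t) (at t)"
proof -
  obtain f' where f': "\<And>x. (f has_derivative f' x) (at x)" "\<And>v. smooth_on UNIV (\<lambda>x. f' x v)"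
    using smooth_on_derivative[OF fat_open[OF open_UNIV] assms] by auto
  have "(f has_vector_derivative f' t 1) (at t)" for t
  proof -
    have "f' t h = h *\<^sub>R f' t 1" for h
      using linear_scale[OF has_derivative_linear[OF f'(1)], of t h 1] by simp
    with f'(1)[of t] show ?thesis unfolding has_vector_derivative_def by (metis (no_types) has_derivative_eq_rhs ext)
  qed
  with f'(2)[of 1] that show ?thesis by blast
qed

lemma smooth_on_partials:
  fixes c :: "real \<times> real \<Rightarrow> 'b::real_normed_vector"
  assumes "smooth_on ({0..1} \<times> UNIV) c"
  obtains cs ct where "smooth_on ({0..1} \<times> UNIV) cs" "smooth_on ({0..1} \<times> UNIV) ct"
    "\<And>x. fst x \<in> {0..1} \<Longrightarrow> (c has_derivative (\<lambda>v. fst v *\<^sub>R cs x + snd v *\<^sub>R ct x)) (at x within {0..1} \<times> UNIV)"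
proof -
  have "fat ({0..1::real} \<times> (UNIV :: real set))"
    by (intro fat_Times fat_Icc fat_open) auto
  from smooth_on_derivative[OF this assms] obtain f' where
    f': "\<And>x. x \<in> {0..1} \<times> UNIV \<Longrightarrow> (c has_derivative f' x) (at x within {0..1} \<times> UNIV)"
      "\<And>v. smooth_on ({0..1} \<times> UNIV) (\<lambda>x. f' x v)"
    by metis
  show thesis
  proof (rule that[OF f'(2) f'(2)])
    fix x :: "real \<times> real" assume x: "fst x \<in> {0..1}"
    then have d: "(c has_derivative f' x) (at x within {0..1} \<times> UNIV)"
      by (intro f') (auto simp: mem_Times_iff)
    then interpret bounded_linear "f' x" by (rule has_derivative_bounded_linear)
    have "f' x v = fst v *\<^sub>R f' x (1, 0) + snd v *\<^sub>R f' x (0, 1)" for v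
      by (cases v) (simp add: scaleR[symmetric] add[symmetric])
    then have "f' x = (\<lambda>v. fst v *\<^sub>R f' x (1, 0) + snd v *\<^sub>R f' x (0, 1))" by (intro ext)
    with d show "(c has_derivative (\<lambda>v. fst v *\<^sub>R f' x (1, 0) + snd v *\<^sub>R f' x (0, 1)))
        (at x within {0..1} \<times> UNIV)"
      by simp
  qed
qed

lemma partials_vector_derivative:
  fixes c :: "real \<times> real \<Rightarrow> 'b::real_normed_vector"
  assumes "\<And>x. fst x \<in> {0..1} \<Longrightarrow>
      (c has_derivative (\<lambda>v. fst v *\<^sub>R cs x + snd v *\<^sub>R ct x)) (at x within {0..1} \<times> UNIV)"
    and s: "s \<in> {0..1}"
  shows "((\<lambda>r. c (r, t)) has_vector_derivative cs (s, t)) (at s within {0..1})"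
    and "((\<lambda>t. c (s, t)) has_vector_derivative ct (s, t)) (at t)"
proof -
  have d: "(c has_derivative (\<lambda>v. fst v *\<^sub>R cs (s, t) + snd v *\<^sub>R ct (s, t))) (at (s, t) within {0..1} \<times> UNIV)"
    using assms by simp
  have "((\<lambda>r. (r, t)) has_derivative (\<lambda>h. (h, 0))) (at s within {0..1})"
    by (auto intro!: derivative_eq_intros)
  from has_derivative_in_compose[OF this has_derivative_subset[OF d]]
  show "((\<lambda>r. c (r, t)) has_vector_derivative cs (s, t)) (at s within {0..1})"
    by (auto simp: has_vector_derivative_def)
  have "((\<lambda>t. (s, t)) has_derivative (\<lambda>h. (0, h))) (at t)"
    by (auto intro!: derivative_eq_intros)
  moreover have "range (Pair s) \<subseteq> {0..1} \<times> (UNIV :: real set)" using s by auto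
  ultimately have "((\<lambda>t. c (s, t)) has_derivative (\<lambda>h. fst (0::real, h) *\<^sub>R cs (s, t) + snd (0::real, h) *\<^sub>R ct (s, t))) (at t)"
    by (rule has_derivative_in_compose[of "Pair s" _ t UNIV c, OF _ has_derivative_subset[OF d]])
  then show "((\<lambda>t. c (s, t)) has_vector_derivative ct (s, t)) (at t)"
    by (simp add: has_vector_derivative_def)
qed

text \<open>Interior symmetry of second derivatives would not reach the end points of \<open>[0,1]\<close>; here
  \<open>c(s,t)\<close> is written as the integral of \<open>ct\<close> and differentiated under the integral sign.\<close>

lemma mixed_partials:
  fixes c :: "real \<times> real \<Rightarrow> 'b::euclidean_space"
  assumes cs: "\<And>s t. s \<in> {0..1} \<Longrightarrow> ((\<lambda>r. c (r, t)) has_vector_derivative cs (s, t)) (at s within {0..1})"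
    and ct: "\<And>s t. s \<in> {0..1} \<Longrightarrow> ((\<lambda>t. c (s, t)) has_vector_derivative ct (s, t)) (at t)"
    and cts: "\<And>s t. s \<in> {0..1} \<Longrightarrow> ((\<lambda>r. ct (r, t)) has_vector_derivative cts (s, t)) (at s within {0..1})"
    and cont: "continuous_on ({0..1} \<times> UNIV) ct" "continuous_on ({0..1} \<times> UNIV) cts"
    and s: "s \<in> {0..1}"
  shows "((\<lambda>t. cs (s, t)) has_vector_derivative cts (s, t)) (at t)"
proof -
  \<comment> \<open>Any base point below \<open>t\<close> would do: \<open>t\<close> must be
    interior to \<open>{a..t+1}\<close>, so that the derivative within this interval is the full
    derivative.\<close>
  define a where "a = t - 1"
  have ct_int: "((\<lambda>v. ct (r, v)) has_integral (c (r, \<tau>) - c (r, a))) {a..\<tau>}"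
    if "r \<in> {0..1}" "a \<le> \<tau>" for r \<tau>
    using that by (intro fundamental_theorem_of_calculus) (auto intro: has_vector_derivative_at_within[OF ct])
  have cont_cts: "continuous_on {a..b} (\<lambda>v. cts (s, v))" for b
    using s by (intro continuous_on_compose2[OF cont(2)]) (auto intro!: continuous_intros)
  have *: "cs (s, \<tau>) = cs (s, a) + integral {a..\<tau>} (\<lambda>v. cts (s, v))" if \<tau>: "a \<le> \<tau>" for \<tau>
  proof -
    have "((\<lambda>r. integral (cbox a \<tau>) (\<lambda>v. ct (r, v))) has_vector_derivative
        integral (cbox a \<tau>) (\<lambda>v. cts (s, v))) (at s within {0..1})"
      using cts has_integral_integrable[OF ct_int[OF _ \<tau>]] s
      by (intro leibniz_rule_vector_derivative)
        (auto intro!: continuous_on_subset[OF cont(2)] simp: case_prod_beta')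
    moreover have "integral (cbox a \<tau>) (\<lambda>v. ct (r, v)) = c (r, \<tau>) - c (r, a)" if "r \<in> {0..1}" for r
      using ct_int[OF that \<tau>] by (simp add: integral_unique)
    ultimately have "((\<lambda>r. c (r, \<tau>) - c (r, a)) has_vector_derivative
        integral (cbox a \<tau>) (\<lambda>v. cts (s, v))) (at s within {0..1})"
      using s by (auto elim: has_vector_derivative_transform[rotated 2])
    moreover have "((\<lambda>r. c (r, \<tau>) - c (r, a)) has_vector_derivative cs (s, \<tau>) - cs (s, a)) (at s within {0..1})"
      by (intro has_vector_derivative_diff cs s)
    ultimately have "integral (cbox a \<tau>) (\<lambda>v. cts (s, v)) = cs (s, \<tau>) - cs (s, a)"
      using s by (intro vector_derivative_unique_within_closed_interval[of 0 1 s]) auto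
    then show ?thesis by simp
  qed
  have "((\<lambda>\<tau>. integral {a..\<tau>} (\<lambda>v. cts (s, v))) has_vector_derivative cts (s, t)) (at t within {a..t+1})"
    by (intro integral_has_vector_derivative[OF cont_cts]) (auto simp: a_def)
  then have "((\<lambda>\<tau>. cs (s, a) + integral {a..\<tau>} (\<lambda>v. cts (s, v))) has_vector_derivative cts (s, t)) (at t within {a..t+1})"
    using has_vector_derivative_add[OF has_vector_derivative_const] by fastforce
  then have "((\<lambda>\<tau>. cs (s, \<tau>)) has_vector_derivative cts (s, t)) (at t within {a..t+1})"
    by (rule has_vector_derivative_transform[rotated 2]) (simp add: a_def, rule *, simp)
  then show ?thesis by (subst (asm) at_within_Icc_at) (auto simp: a_def)
qed


section \<open>Billiard tables as plane curves\<close>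

lemma circ_eq_iff: "circ x = circ y \<longleftrightarrow> x - y \<in> \<int>"
  by (simp add: circle.abs_eq_iff circle_rel_def)

lemma circ_rep [simp]: "circ (rep_circle q) = q"
  by (rule Quotient_abs_rep[OF Quotient_circle])

lemma rep_circ: obtains n :: int where "rep_circle (circ t) = t + of_int n"
proof -
  have "circ (rep_circle (circ t)) = circ t" by simp
  then obtain n :: int where "rep_circle (circ t) - t = of_int n"
    unfolding circ_eq_iff by (metis Ints_cases)
  then have "rep_circle (circ t) = t + of_int n" by simp
  then show ?thesis by (rule that)
qed

lemma circ_add_int [simp]: "circ (t + of_int n) = circ t" "circ (t + 1) = circ t" "circ (t - 1) = circ t"
  by (auto simp: circ_eq_iff)

lemma circ_cases: obtains t where "q = circ t"
  by (metis circ_rep)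

lemma circ_ne_cases:
  assumes "circ T \<noteq> circ t"
  obtains T' where "circ T' = circ T" "0 < T' - t" "T' - t < 1"
proof (rule that[of "t + frac (T - t)"])
  have "T - t \<notin> \<int>" using assms by (simp add: circ_eq_iff)
  then show "0 < t + frac (T - t) - t" by (metis add_diff_cancel_left' frac_gt_0_iff)
  show "t + frac (T - t) - t < 1" by (simp add: frac_lt_1)
  have "t + frac (T - t) = T + of_int (- \<lfloor>T - t\<rfloor>)" by (simp add: frac_def)
  then show "circ (t + frac (T - t)) = circ T" by (metis circ_add_int(1))
qed

lemma circ_ne: "0 < T - t \<Longrightarrow> T - t < 1 \<Longrightarrow> circ T \<noteq> circ t"
  unfolding circ_eq_iff by (metis Ints_cases of_int_0_less_iff of_int_less_1_iff zle_add1_eq_le add_0 leD)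

text \<open>Moves compactness and suprema on the circle to the compact interval
  \<open>{0..1}\<close>.\<close>

lemma range_circle: "range h = (\<lambda>t. h (circ t)) ` {0..1}"
proof (intro equalityI subsetI)
  fix x assume "x \<in> range h"
  then obtain t where "x = h (circ t)" by (metis circ_cases imageE)
  moreover have "t = frac t + of_int \<lfloor>t\<rfloor>" by (simp add: frac_def)
  ultimately have "x = h (circ (frac t))" by (metis circ_add_int(1))
  then show "x \<in> (\<lambda>t. h (circ t)) ` {0..1}"
    using frac_ge_0[of t] frac_lt_1[of t] by (auto intro!: image_eqI[of _ _ "frac t"])
qed auto

lemma circle_deriv_circ:
  fixes f :: "circle \<Rightarrow> 'a::real_normed_vector"
  assumes "\<And>t. ((\<lambda>t. f (circ t)) has_vector_derivative f1 t) (at t)"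
  shows "circle_deriv f (circ t) = f1 t"
proof -
  obtain n where n: "rep_circle (circ t) = t + of_int n" by (rule rep_circ)
  have "((\<lambda>x. x + of_int n :: real) has_real_derivative 1) (at t)" by (auto intro!: derivative_eq_intros)
  from vector_diff_chain_at[OF this[unfolded has_real_derivative_iff_has_vector_derivative] assms]
  have "((\<lambda>t. f (circ t)) has_vector_derivative f1 (t + of_int n)) (at t)"
    by (simp add: o_def)
  then have "f1 (t + of_int n) = f1 t"
    using assms vector_derivative_unique_at by blast
  then show ?thesis
    unfolding circle_deriv_def n using vector_derivative_at[OF assms] by metis
qed

section \<open>Determinants and normals in the plane\<close>

lemma bounded_bilinear_det2: "bounded_bilinear det2"
  unfolding bilinear_conv_bounded_bilinear[symmetric] bilinear_def
  by (auto intro!: linearI simp: det2_def algebra_simps)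

interpretation det2: bounded_bilinear det2
  by (rule bounded_bilinear_det2)

lemma det2_self [simp]: "det2 a a = 0"
  by (simp add: det2_def)

lemma inner_vec2: "(a::real^2) \<bullet> b = a $ 1 * b $ 1 + a $ 2 * b $ 2"
  by (simp add: inner_vec_def sum_2)

definition rot :: "real^2 \<Rightarrow> real^2" where
  "rot a = vector [- a $ 2, a $ 1]"

lemma rot_nth [simp]: "rot a $ 1 = - a $ 2" "rot a $ 2 = a $ 1"
  by (simp_all add: rot_def)

lemma det2_eq_inner: "det2 a x = rot a \<bullet> x"
  by (simp add: det2_def inner_vec2)

text \<open>Cramer's rule.\<close>

lemma det2_independent:
  assumes "det2 a b \<noteq> 0" "det2 a x = 0" "det2 b x = 0"
  shows "x = 0"
proof -
  have "det2 a b * x $ 1 = b $ 1 * det2 a x - a $ 1 * det2 b x"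
       "det2 a b * x $ 2 = b $ 2 * det2 a x - a $ 2 * det2 b x"
    by (auto simp: det2_def algebra_simps)
  with assms show ?thesis by (simp add: vec_eq_iff forall_2)
qed

lemma inner_orth_det2:
  fixes a :: "real^2"
  assumes "a \<noteq> 0" "a \<bullet> u = 0" "a \<bullet> v = 0"
  shows "det2 u v = 0"
proof -
  have "a $ 1 * det2 u v = v $ 2 * (a \<bullet> u) - u $ 2 * (a \<bullet> v)"
    "a $ 2 * det2 u v = u $ 1 * (a \<bullet> v) - v $ 1 * (a \<bullet> u)"
    by (auto simp: det2_def inner_vec2 algebra_simps)
  with assms show ?thesis by (auto simp: vec_eq_iff forall_2)
qed

text \<open>The function \<open>det2 (c1 u) (x - c u)\<close> of \<open>u\<close> is nonnegative and
  has a minimum at \<open>t\<close>. Its derivative there is \<open>det2 (c2 t) (x - c t)\<close>,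
  since the term with \<open>c1\<close> twice vanishes; so \<open>x - c t\<close> is parallel to
  both \<open>c1 t\<close> and \<open>c2 t\<close>, which are independent.\<close>

lemma tangent_touch:
  assumes c: "\<And>t. (c has_vector_derivative c1 t) (at t)"
    and c1: "\<And>t. (c1 has_vector_derivative c2 t) (at t)"
    and det: "det2 (c1 t) (c2 t) \<noteq> 0"
    and left: "\<And>u. 0 \<le> det2 (c1 u) (x - c u)"
    and touch: "det2 (c1 t) (x - c t) = 0"
  shows "x = c t"
proof -
  have "((\<lambda>u. det2 (c1 u) (x - c u)) has_vector_derivative
      det2 (c1 t) (0 - c1 t) + det2 (c2 t) (x - c t)) (at t)"
    by (intro det2.has_vector_derivative has_vector_derivative_diff has_vector_derivative_const c c1)
  then have "((\<lambda>u. det2 (c1 u) (x - c u)) has_real_derivative det2 (c2 t) (x - c t)) (at t)"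
    by (simp add: has_real_derivative_iff_has_vector_derivative det2.minus_right)
  then have "det2 (c2 t) (x - c t) = 0"
    by (rule DERIV_local_min[of _ _ _ 1]) (use left touch in auto)
  with det touch have "x - c t = 0" by (rule det2_independent)
  then show ?thesis by simp
qed

text \<open>Describes a table by its curve alone: derivatives live on the line, and the convex body
  is replaced by the condition that every other boundary point lies strictly to the left of each
  tangent. The equivalence with \<open>billiard_tables\<close> is shown in
  \<open>table_frame_exists\<close> and \<open>table_frame_imp_billiard_table\<close>.\<close>

definition table_frame :: "(circle \<Rightarrow> real^2) \<Rightarrow> (real \<Rightarrow> real^2) \<Rightarrow> (real \<Rightarrow> real^2) \<Rightarrow> bool" where
  "table_frame \<gamma> c1 c2 \<longleftrightarrow>
     smooth_on UNIV (\<lambda>t. \<gamma> (circ t)) \<and> smooth_on UNIV c1 \<and>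
     (\<forall>t. ((\<lambda>t. \<gamma> (circ t)) has_vector_derivative c1 t) (at t)) \<and>
     (\<forall>t. (c1 has_vector_derivative c2 t) (at t)) \<and>
     (\<forall>t. norm (c1 t) = 1) \<and> (\<forall>t. 0 < det2 (c1 t) (c2 t)) \<and>
     (\<forall>t T. 0 < T - t \<longrightarrow> T - t < 1 \<longrightarrow> 0 < det2 (c1 t) (\<gamma> (circ T) - \<gamma> (circ t)))"

lemma table_frame_circle_deriv: "table_frame \<gamma> c1 c2 \<Longrightarrow> circle_deriv \<gamma> (circ t) = c1 t"
  by (rule circle_deriv_circ) (simp add: table_frame_def)

text \<open>Leftness in the weak sense belongs to the definition. It is strict because a boundary
  point on a tangent line is the point of contact, by \<open>tangent_touch\<close>, and the curve is
  injective.\<close>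

lemma table_frame_exists:
  assumes "\<gamma> \<in> billiard_tables"
  obtains c1 c2 where "table_frame \<gamma> c1 c2"
proof -
  from assms obtain K where K: "compact K" "boundary_param K \<gamma>"
    and curv: "\<And>q. 0 < det2 (circle_deriv \<gamma> q) (circle_deriv (circle_deriv \<gamma>) q)"
    unfolding billiard_tables_def by blast
  then have sm: "smooth_on UNIV (\<lambda>t. \<gamma> (circ t))" and inj: "inj \<gamma>" and ran: "range \<gamma> = frontier K"
    and nrm: "\<And>q. norm (circle_deriv \<gamma> q) = 1"
    and left: "\<And>q x. x \<in> K \<Longrightarrow> 0 \<le> det2 (circle_deriv \<gamma> q) (x - \<gamma> q)"
    unfolding boundary_param_def by auto
  obtain c1 where c1: "smooth_on UNIV c1" "\<And>t. ((\<lambda>t. \<gamma> (circ t)) has_vector_derivative c1 t) (at t)"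
    using smooth_on_vector_derivative[OF sm] by metis
  obtain c2 where c2: "smooth_on UNIV c2" "\<And>t. (c1 has_vector_derivative c2 t) (at t)"
    using smooth_on_vector_derivative[OF c1(1)] by metis
  have d1: "circle_deriv \<gamma> (circ t) = c1 t" for t
    by (rule circle_deriv_circ) (rule c1)
  have d2: "circle_deriv (circle_deriv \<gamma>) (circ t) = c2 t" for t
    by (rule circle_deriv_circ) (simp add: d1 c2)
  have c12: "0 < det2 (c1 t) (c2 t)" for t
    using curv[of "circ t"] by (simp add: d1 d2)
  have "0 < det2 (c1 t) (\<gamma> (circ T) - \<gamma> (circ t))" if "0 < T - t" "T - t < 1" for t T
  proof -
    have "\<gamma> (circ T) \<in> K"
      using ran K(1) frontier_subset_compact by blast
    then have l: "0 \<le> det2 (c1 u) (\<gamma> (circ T) - \<gamma> (circ u))" for u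
      using left[of _ "circ u"] by (simp add: d1)
    have "det2 (c1 t) (\<gamma> (circ T) - \<gamma> (circ t)) \<noteq> 0"
    proof
      assume "det2 (c1 t) (\<gamma> (circ T) - \<gamma> (circ t)) = 0"
      then have "\<gamma> (circ T) = \<gamma> (circ t)"
        using tangent_touch[OF c1(2) c2(2) _ l] c12[of t] by auto
      then have "circ T = circ t" using inj by (simp add: inj_eq)
      with circ_ne[OF that] show False by simp
    qed
    with l[of t] show ?thesis by simp
  qed
  moreover have "norm (c1 t) = 1" for t using nrm[of "circ t"] by (simp add: d1)
  ultimately show ?thesis
    using that[of c1 c2] sm c1 c2 c12 unfolding table_frame_def by blast
qed

text \<open>The body is the convex hull of the curve. It has interior points, since otherwise the
  curve lies on a line and curvature vanishes. Its frontier is the curve: a supporting line at a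
  frontier point is also the tangent at some point of the curve, and \<open>tangent_touch\<close>
  identifies the two points.\<close>

lemma table_frame_imp_billiard_table:
  assumes "table_frame \<gamma> c1 c2"
  shows "\<gamma> \<in> billiard_tables"
proof -
  let ?c = "\<lambda>t. \<gamma> (circ t)"
  from assms have sm: "smooth_on UNIV ?c"
    and c1: "\<And>t. (?c has_vector_derivative c1 t) (at t)"
    and c2: "\<And>t. (c1 has_vector_derivative c2 t) (at t)"
    and nrm: "\<And>t. norm (c1 t) = 1" and curv: "\<And>t. 0 < det2 (c1 t) (c2 t)"
    and conv: "\<And>t T. 0 < T - t \<Longrightarrow> T - t < 1 \<Longrightarrow> 0 < det2 (c1 t) (?c T - ?c t)"
    unfolding table_frame_def by auto
  have d1: "circle_deriv \<gamma> (circ t) = c1 t" for t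
    by (rule circle_deriv_circ) (rule c1)
  have d2: "circle_deriv (circle_deriv \<gamma>) (circ t) = c2 t" for t
    by (rule circle_deriv_circ) (simp add: d1 c2)
  have conv': "0 < det2 (c1 t) (?c T - ?c t)" if "circ T \<noteq> circ t" for t T
    using that conv by (metis circ_ne_cases)
  then have conv0: "0 \<le> det2 (c1 t) (?c T - ?c t)" for t T
    by (cases "circ T = circ t") (auto simp: det2.zero_right less_imp_le)
  have contc: "continuous_on UNIV ?c"
    using sm by (rule smooth_on_imp_continuous_on)
  have ran: "range \<gamma> = ?c ` {0..1}" by (rule range_circle)
  have comp: "compact (range \<gamma>)"
    unfolding ran using contc by (intro compact_continuous_image) (auto intro: continuous_on_subset)
  define K where "K = convex hull (range \<gamma>)"
  have K: "compact K" "convex K" unfolding K_def using comp by (auto intro: compact_convex_hull)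
  have inK: "\<gamma> q \<in> K" for q unfolding K_def by (simp add: hull_inc)
  have half: "b \<le> a \<bullet> x" if "x \<in> K" "\<And>t. b \<le> a \<bullet> ?c t" for a b x
  proof -
    have "range \<gamma> \<subseteq> {x. a \<bullet> x \<ge> b}" using that(2) by (metis (mono_tags) circ_cases image_subsetI mem_Collect_eq)
    then have "K \<subseteq> {x. a \<bullet> x \<ge> b}" unfolding K_def by (intro hull_minimal convex_halfspace_ge)
    with that show ?thesis by auto
  qed
  have left: "0 \<le> det2 (c1 t) (x - ?c t)" if "x \<in> K" for t x
    using half[OF that, of "rot (c1 t) \<bullet> ?c t" "rot (c1 t)"] conv0[of t]
    by (simp add: det2_eq_inner inner_diff_right)
  have int: "interior K \<noteq> {}"
  proof
    assume "interior K = {}"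
    then obtain a b where a: "a \<noteq> 0" "K \<subseteq> {x. a \<bullet> x = b}"
      using empty_interior_subset_hyperplane[OF K(2)] by metis
    then have eq: "(\<lambda>t. a \<bullet> ?c t) = (\<lambda>t. b)" using inK by auto
    have "((\<lambda>t. a \<bullet> ?c t) has_vector_derivative a \<bullet> c1 t) (at t)" for t
      using bounded_linear.has_vector_derivative[OF bounded_linear_inner_right c1] .
    then have z1: "a \<bullet> c1 t = 0" for t
      unfolding eq using vector_derivative_unique_at has_vector_derivative_const by blast
    have "((\<lambda>t. a \<bullet> c1 t) has_vector_derivative a \<bullet> c2 0) (at 0)"
      using bounded_linear.has_vector_derivative[OF bounded_linear_inner_right c2] .
    then have z2: "a \<bullet> c2 0 = 0"
      unfolding z1 using vector_derivative_unique_at has_vector_derivative_const by blast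
    from inner_orth_det2[OF a(1) z1 z2] curv[of 0] show False by simp
  qed
  have "range \<gamma> = frontier K"
  proof (intro equalityI subsetI)
    fix x assume "x \<in> range \<gamma>"
    then obtain t where x: "x = ?c t" by (metis circ_cases imageE)
    have "x \<notin> interior K"
    proof
      assume "x \<in> interior K"
      then obtain e where e: "e > 0" "ball x e \<subseteq> K" by (meson mem_interior)
      \<comment> \<open>A point at distance \<open>e / 2\<close> to the right of the tangent;
        \<open>rot (c1 t)\<close> is the left normal.\<close>
      define y where "y = x - (e / 2) *\<^sub>R rot (c1 t)"
      have n: "rot (c1 t) \<bullet> rot (c1 t) = 1"
        using nrm[of t] by (simp add: norm_eq_sqrt_inner inner_vec2 add.commute)
      then have "norm (rot (c1 t)) = 1" by (simp add: norm_eq_sqrt_inner)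
      then have "y \<in> K" using e by (intro subsetD[OF e(2)]) (auto simp: y_def dist_norm)
      from left[OF this, of t] n e(1) show False
        by (simp add: y_def x det2_eq_inner)
    qed
    then show "x \<in> frontier K" using inK x K(1) by (simp add: frontier_def compact_imp_closed)
  next
    fix x assume "x \<in> frontier K"
    then have x: "x \<in> K" "x \<notin> interior K"
      using K(1) by (auto simp: frontier_def compact_imp_closed)
    obtain a b where a: "a \<noteq> 0" "\<And>y. y \<in> interior K \<Longrightarrow> b \<le> a \<bullet> y" "a \<bullet> x \<le> b"
      using separating_hyperplane_sets[of "{x}" "interior K"] int x K(2) by auto
    have "closure (interior K) \<subseteq> {y. b \<le> a \<bullet> y}"
      using a(2) by (intro closure_minimal closed_halfspace_ge) auto
    moreover have "closure (interior K) = K"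
      using convex_closure_interior[OF K(2) int] K(1) by (simp add: compact_imp_closed)
    ultimately have ab: "b \<le> a \<bullet> y" if "y \<in> K" for y using that by auto
    \<comment> \<open>The minimum of \<open>a\<close> over the curve is also its minimum over the
      hull, so it equals the value at \<open>x\<close>. Both \<open>c1 t\<close> and
      \<open>x - \<gamma> (circ t)\<close> are then orthogonal to \<open>a\<close>, which puts
      \<open>x\<close> on the tangent at \<open>t\<close>.\<close>
    obtain t where t: "\<And>u. a \<bullet> ?c t \<le> a \<bullet> ?c u"
    proof -
      have "continuous_on (range \<gamma>) (\<lambda>y. a \<bullet> y)" by (intro continuous_intros)
      then obtain y where "y \<in> range \<gamma>" "\<And>z. z \<in> range \<gamma> \<Longrightarrow> a \<bullet> y \<le> a \<bullet> z"
        using continuous_attains_inf[OF comp] by blast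
      then show ?thesis using that by (metis circ_cases rangeE rangeI)
    qed
    have "a \<bullet> ?c t \<le> a \<bullet> x" using half[OF x(1)] t by blast
    then have z2: "a \<bullet> (x - ?c t) = 0"
      using a(3) ab[OF inK[of "circ t"]] by (simp add: inner_diff_right)
    have "((\<lambda>t. a \<bullet> ?c t) has_real_derivative a \<bullet> c1 t) (at t)"
      unfolding has_real_derivative_iff_has_vector_derivative
      using bounded_linear.has_vector_derivative[OF bounded_linear_inner_right c1] .
    then have z1: "a \<bullet> c1 t = 0"
      by (rule DERIV_local_min[of _ _ _ 1]) (use t in auto)
    have "x = ?c t"
      using tangent_touch[OF c1 c2 _ left[OF x(1)] inner_orth_det2[OF a(1) z1 z2]] curv[of t] by auto
    then show "x \<in> range \<gamma>" by simp
  qed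
  moreover have "inj \<gamma>"
  proof (rule injI)
    fix q q' assume eq: "\<gamma> q = \<gamma> q'"
    obtain t T where "q = circ t" "q' = circ T" by (metis circ_cases)
    with eq conv'[of T t] show "q = q'" by (metis det2.zero_right diff_self less_irrefl)
  qed
  moreover have "norm (circle_deriv \<gamma> q) = 1" for q
    using nrm d1 by (metis circ_cases)
  moreover have "0 \<le> det2 (circle_deriv \<gamma> q) (x - \<gamma> q)" if "x \<in> K" for q x
    using left[OF that] d1 by (metis circ_cases)
  moreover have "0 < det2 (circle_deriv \<gamma> q) (circle_deriv (circle_deriv \<gamma>) q)" for q
    using curv d1 d2 by (metis circ_cases)
  ultimately show ?thesis
    unfolding billiard_tables_def boundary_param_def using K int sm by blast
qed

text \<open>Needed so that the disc can be the starting table of a homotopy, as \<open>BM\<close>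
  demands.\<close>

lemma disc_table_in_billiard_tables: "disc_table \<in> billiard_tables"
proof (rule table_frame_imp_billiard_table)
  let ?c1 = "\<lambda>t. vector [- sin (2 * pi * t), cos (2 * pi * t)] :: real^2"
  let ?c2 = "\<lambda>t. vector [- 2 * pi * cos (2 * pi * t), - 2 * pi * sin (2 * pi * t)] :: real^2"
  have circ: "disc_table (circ t) = vector [cos (2 * pi * t) / (2 * pi), sin (2 * pi * t) / (2 * pi)]" for t
    by (simp add: disc_table.abs_eq vec_eq_iff forall_2)
  have vd: "((\<lambda>t. vector [f t, g t] :: real^2) has_vector_derivative vector [f', g']) (at t)"
    if "(f has_real_derivative f') (at t)" "(g has_real_derivative g') (at t)" for f g f' g' t
  proof -
    have "((\<lambda>t. f t *\<^sub>R axis 1 1 + g t *\<^sub>R axis 2 1 :: real^2) has_vector_derivative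
        f' *\<^sub>R axis 1 1 + g' *\<^sub>R axis 2 1) (at t)"
      using that by (auto intro!: derivative_eq_intros)
    moreover have "vector [x, y] = (x *\<^sub>R axis 1 1 + y *\<^sub>R axis 2 1 :: real^2)" for x y
      by (simp add: vec_eq_iff forall_2 axis_def)
    ultimately show ?thesis by simp
  qed
  have sm: "smooth_on UNIV (\<lambda>t::real. sin (2 * pi * t))" "smooth_on UNIV (\<lambda>t::real. cos (2 * pi * t))"
    by (intro smooth_on_sin smooth_on_cos smooth_on_mult smooth_on_const smooth_on_id)+
  have det: "det2 (?c1 t) (disc_table (circ T) - disc_table (circ t)) = (1 - cos (2 * pi * (T - t))) / (2 * pi)" for t T
  proof -
    have "det2 (?c1 t) (disc_table (circ T) - disc_table (circ t)) =
      (((sin (2 * pi * t))\<^sup>2 + (cos (2 * pi * t))\<^sup>2) -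
       (cos (2 * pi * T) * cos (2 * pi * t) + sin (2 * pi * T) * sin (2 * pi * t))) / (2 * pi)"
    proof -
      have "(- a) * (B / k - a / k) - b * (A / k - b / k) = ((a\<^sup>2 + b\<^sup>2) - (A * b + B * a)) / k"
        if "k \<noteq> 0" for a b A B k :: real
        using that by (simp add: field_simps power2_eq_square)
      from this[of "2 * pi"] show ?thesis
        unfolding circ det2_def by (simp del: sin_cos_squared_add)
    qed
    also have "\<dots> = (1 - cos (2 * pi * T - 2 * pi * t)) / (2 * pi)"
      by (simp add: cos_diff)
    finally show ?thesis by (simp add: right_diff_distrib)
  qed
  show "table_frame disc_table ?c1 ?c2"
    unfolding table_frame_def
  proof (intro conjI allI impI)
    show "smooth_on UNIV (\<lambda>t. disc_table (circ t))"
      unfolding circ divide_inverse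
      by (rule smooth_on_vec2; simp only: vector_2; intro smooth_on_mult smooth_on_const sm)
    show "smooth_on UNIV ?c1"
      by (rule smooth_on_vec2; simp only: vector_2; intro smooth_on_minus sm)
    show "((\<lambda>t. disc_table (circ t)) has_vector_derivative ?c1 t) (at t)" for t
      unfolding circ by (rule vd) (auto intro!: derivative_eq_intros)
    show "(?c1 has_vector_derivative ?c2 t) (at t)" for t
      by (rule vd) (auto intro!: derivative_eq_intros)
    show "norm (?c1 t) = 1" for t
      by (simp add: norm_eq_sqrt_inner inner_vec2 power2_eq_square[symmetric])
    have "det2 (?c1 t) (?c2 t) = 2 * pi * ((sin (2 * pi * t))\<^sup>2 + (cos (2 * pi * t))\<^sup>2)" for t
      by (simp only: det2_def vector_2) algebra
    then show "0 < det2 (?c1 t) (?c2 t)" for t by simp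
    fix t T :: real assume tT: "0 < T - t" "T - t < 1"
    have "cos (2 * pi * (T - t)) < 1"
    proof -
      have "cos (2 * pi * (T - t)) \<noteq> 1"
      proof
        assume "cos (2 * pi * (T - t)) = 1"
        then obtain n :: int where "2 * pi * (T - t) = of_int n * 2 * pi"
          by (auto simp: cos_one_2pi_int)
        then have "T - t = of_int n" by simp
        with tT have "0 < n" "n < 1" by simp_all
        then show False by simp
      qed
      then show ?thesis by (simp add: less_le)
    qed
    then show "0 < det2 (?c1 t) (disc_table (circ T) - disc_table (circ t))"
      unfolding det by simp
  qed
qed

section \<open>The space of billiard tables is connected\<close>

lemma shift_int:
  fixes f :: "real \<Rightarrow> real" and n :: int
  assumes "\<And>x. f (x + a) = f x + b"
  shows "f (x + of_int n * a) = f x + of_int n * b"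
proof (induction n rule: int_induct[where k = 0])
  case (step1 i)
  then show ?case using assms[of "x + of_int i * a"] by (simp add: algebra_simps)
next
  case (step2 i)
  then show ?case using assms[of "x + of_int (i - 1) * a"] by (simp add: algebra_simps)
qed auto

text \<open>Quasi-periodicity with \<open>b > 0\<close> makes each \<open>f s\<close> unbounded in
  both directions, hence onto; the inverse depends smoothly on the parameter by
  \<open>smooth_on_implicit\<close>. It is applied to the tangent angle and to the interpolated arc
  length.\<close>

lemma monotone_family_inverse:
  fixes f :: "'a::euclidean_space \<Rightarrow> real \<Rightarrow> real"
  assumes deriv: "\<And>s x. s \<in> S \<Longrightarrow> \<exists>D>0. (f s has_real_derivative D) (at x)"
    and smooth: "smooth_on (S \<times> UNIV) (\<lambda>z. f (fst z) (snd z))"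
    and per: "\<And>s x. s \<in> S \<Longrightarrow> f s (x + a) = f s x + b" and "b > 0"
  obtains g where "smooth_on (S \<times> UNIV) (\<lambda>z. g (fst z) (snd z))"
    "\<And>s y. s \<in> S \<Longrightarrow> f s (g s y) = y" "\<And>s. s \<in> S \<Longrightarrow> strict_mono (f s)"
proof -
  have mono: "strict_mono (f s)" if "s \<in> S" for s
    using strict_mono_on_deriv_pos[of UNIV "f s"] deriv[OF that] by (auto simp: is_interval_univ)
  have "\<exists>x. f s x = y" if s: "s \<in> S" for s y
  proof -
    obtain n :: nat where n: "\<bar>y - f s 0\<bar> < of_nat n * b"
      using \<open>b > 0\<close> reals_Archimedean3 by blast
    define m where "m = int n"
    have f1: "f s (of_int m * a) = f s 0 + of_int m * b"
      using shift_int[of "f s" a b 0 m] per[OF s] by simp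
    have f2: "f s (of_int (- m) * a) = f s 0 - of_int m * b"
      using shift_int[of "f s" a b 0 "- m"] per[OF s] by simp
    have lt: "f s (of_int (- m) * a) < y" "y < f s (of_int m * a)"
      using n unfolding f1 f2 by (auto simp: m_def)
    then have "of_int (- m) * a \<le> of_int m * a"
      using mono[OF s] by (meson less_trans strict_mono_less less_imp_le)
    moreover have "continuous_on {of_int (- m) * a..of_int m * a} (f s)"
      using deriv[OF s] by (meson DERIV_isCont continuous_at_imp_continuous_on)
    ultimately show ?thesis using IVT'[of "f s"] lt by (meson less_imp_le)
  qed
  then obtain g where g: "\<And>s y. s \<in> S \<Longrightarrow> f s (g s y) = y" by metis
  have "smooth_on (S \<times> UNIV) (\<lambda>z. g (fst z) (snd z))"
  proof (rule smooth_on_implicit[where I = UNIV and E = "\<lambda>w. f (fst (fst w)) (snd w) - snd (fst w)"])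
    show "smooth_on ((S \<times> UNIV) \<times> UNIV) (\<lambda>w. f (fst (fst w)) (snd w) - snd (fst w))"
    proof (intro smooth_on_diff)
      have "smooth_on ((S \<times> UNIV) \<times> UNIV) (\<lambda>w :: ('a \<times> real) \<times> real. (fst (fst w), snd w))"
        by (intro smooth_on_Pair smooth_on_fst smooth_on_snd smooth_on_id)
      from smooth_on_compose[OF smooth this]
      show "smooth_on ((S \<times> UNIV) \<times> UNIV) (\<lambda>w :: ('a \<times> real) \<times> real. f (fst (fst w)) (snd w))" by auto
    qed (intro smooth_on_fst smooth_on_snd smooth_on_id)
    fix x :: "'a \<times> real" and t :: real assume "x \<in> S \<times> UNIV"
    then obtain D where "D > 0" "(f (fst x) has_real_derivative D) (at t)" using deriv[of "fst x" t] by auto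
    then show "\<exists>D>0. ((\<lambda>t. f (fst (fst (x, t))) (snd (x, t)) - snd (fst (x, t))) has_real_derivative D) (at t)"
      by (auto intro!: exI[of _ D] derivative_eq_intros)
  qed (use g in auto)
  with g mono that show ?thesis by blast
qed

section \<open>Tangent angle and parametrization by the tangent direction\<close>

definition uvec :: "real \<Rightarrow> real^2" where
  "uvec x = vector [cos x, sin x]"

lemma uvec_nth [simp]: "uvec x $ 1 = cos x" "uvec x $ 2 = sin x"
  by (simp_all add: uvec_def)

lemma norm_uvec [simp]: "norm (uvec x) = 1"
  by (simp add: norm_eq_sqrt_inner inner_vec2 power2_eq_square[symmetric])

lemma uvec_has_vector_derivative:
  assumes "(f has_real_derivative f') (at t)"
  shows "((\<lambda>t. uvec (f t)) has_vector_derivative f' *\<^sub>R rot (uvec (f t))) (at t)"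
proof -
  have uvec: "uvec x = cos x *\<^sub>R axis 1 1 + sin x *\<^sub>R axis 2 1" for x
    by (simp add: vec_eq_iff forall_2 axis_def)
  have "f' *\<^sub>R rot (uvec x) = (- (sin x * f')) *\<^sub>R axis 1 1 + (cos x * f') *\<^sub>R axis 2 1" for x
    by (simp add: vec_eq_iff forall_2 axis_def)
  then show ?thesis
    unfolding uvec using assms by (auto intro!: derivative_eq_intros)
qed

lemma smooth_on_uvec: "smooth_on S f \<Longrightarrow> smooth_on S (\<lambda>x. uvec (f x))"
  by (rule smooth_on_vec2) (simp_all add: smooth_on_cos smooth_on_sin)

lemma uvec_eq_imp:
  assumes "uvec x = uvec y" obtains n :: int where "x = y + 2 * pi * of_int n"
proof -
  have "sin x = sin y" "cos x = cos y" using assms uvec_nth by metis+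
  then have "\<exists>n::int. x = y + 2 * pi * n" using sin_cos_eq_iff[of x y] by simp
  with that show ?thesis by blast
qed

lemma uvec_add_2pi [simp]: "uvec (x + 2 * pi) = uvec x"
  by (simp add: uvec_def)

lemma unit_vector_derivative_eq_rot:
  fixes a b :: "real^2"
  assumes "norm a = 1" "a \<bullet> b = 0"
  shows "b = det2 a b *\<^sub>R rot a"
proof -
  have aa: "a $ 1 * a $ 1 + a $ 2 * a $ 2 = 1"
    using assms(1) by (simp add: norm_eq_sqrt_inner inner_vec2)
  have "b $ 1 = det2 a b * (- a $ 2) + (a \<bullet> b) * a $ 1 + b $ 1 * (1 - (a $ 1 * a $ 1 + a $ 2 * a $ 2))"
    "b $ 2 = det2 a b * a $ 1 + (a \<bullet> b) * a $ 2 + b $ 2 * (1 - (a $ 1 * a $ 1 + a $ 2 * a $ 2))"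
    by (simp_all add: det2_def inner_vec2 algebra_simps)
  with aa assms(2) show ?thesis by (simp add: vec_eq_iff forall_2)
qed

text \<open>The angle is an antiderivative of the curvature with the correct initial value. The unit
  vectors \<open>c1 t\<close> and \<open>uvec (\<theta> t)\<close> turn at the same rate, so their
  inner product keeps its initial value 1 and they coincide. Periodicity of \<open>c1\<close> alone
  gives a full number of turns.\<close>

lemma table_frame_angle:
  assumes fr: "table_frame \<gamma> c1 c2"
  obtains \<theta> where "smooth_on UNIV \<theta>"
    "\<And>t. (\<theta> has_real_derivative det2 (c1 t) (c2 t)) (at t)"
    "\<And>t. c1 t = uvec (\<theta> t)" "\<And>t. \<theta> (t + 1) = \<theta> t + 2 * pi"
proof -
  from fr have sm1: "smooth_on UNIV c1"
    and c1: "\<And>t. ((\<lambda>t. \<gamma> (circ t)) has_vector_derivative c1 t) (at t)"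
    and c2: "\<And>t. (c1 has_vector_derivative c2 t) (at t)"
    and nrm: "\<And>t. norm (c1 t) = 1" and curv: "\<And>t. 0 < det2 (c1 t) (c2 t)"
    and conv: "\<And>t T. 0 < T - t \<Longrightarrow> T - t < 1 \<Longrightarrow> 0 < det2 (c1 t) (\<gamma> (circ T) - \<gamma> (circ t))"
    unfolding table_frame_def by auto
  obtain c2' where c2': "smooth_on UNIV c2'" "\<And>t. (c1 has_vector_derivative c2' t) (at t)"
    using smooth_on_vector_derivative[OF sm1] by metis
  have "c2' = c2" using vector_derivative_unique_at[OF c2 c2'(2)] by auto
  then have sm\<kappa>: "smooth_on UNIV (\<lambda>t. det2 (c1 t) (c2 t))"
    using c2' sm1 by (auto intro: smooth_on_bilinear[OF bounded_bilinear_det2])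
  have "\<exists>F. \<forall>x::real. - \<infinity> < ereal x \<longrightarrow> ereal x < \<infinity> \<longrightarrow>
      (F has_vector_derivative det2 (c1 x) (c2 x)) (at x)"
    using continuous_on_interior[OF smooth_on_imp_continuous_on[OF sm\<kappa>]]
    by (intro einterval_antiderivative) auto
  then obtain F where F: "\<And>x. (F has_real_derivative det2 (c1 x) (c2 x)) (at x)"
    by (auto simp: has_real_derivative_iff_has_vector_derivative)
  have "(c1 0 $ 1)\<^sup>2 + (c1 0 $ 2)\<^sup>2 = 1"
    using nrm[of 0] by (simp add: norm_eq_sqrt_inner inner_vec2 power2_eq_square)
  then obtain a where a: "c1 0 = uvec a"
    by (rule sincos_total_2pi) (auto simp: vec_eq_iff forall_2)
  define \<theta> where "\<theta> = (\<lambda>t. a + (F t - F 0))"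
  have \<theta>: "(\<theta> has_real_derivative det2 (c1 t) (c2 t)) (at t)" for t
    unfolding \<theta>_def by (auto intro!: derivative_eq_intros F)
  have c1sq: "c1 t \<bullet> c1 t = 1" for t using nrm[of t] by (simp add: norm_eq_sqrt_inner)
  have c2rot: "c2 t = det2 (c1 t) (c2 t) *\<^sub>R rot (c1 t)" for t
  proof -
    have "((\<lambda>t. c1 t \<bullet> c1 t) has_vector_derivative c1 t \<bullet> c2 t + c2 t \<bullet> c1 t) (at t)"
      by (rule bounded_bilinear.has_vector_derivative[OF bounded_bilinear_inner c2 c2])
    moreover have "((\<lambda>t. c1 t \<bullet> c1 t) has_vector_derivative 0) (at t)"
      unfolding c1sq by simp
    ultimately have "c1 t \<bullet> c2 t + c2 t \<bullet> c1 t = 0" by (rule vector_derivative_unique_at)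
    then show ?thesis using unit_vector_derivative_eq_rot[OF nrm] by (simp add: inner_commute)
  qed
  have "c1 t \<bullet> uvec (\<theta> t) = c1 0 \<bullet> uvec (\<theta> 0)" for t
  proof -
    have "((\<lambda>t. c1 t \<bullet> uvec (\<theta> t)) has_vector_derivative
        c1 t \<bullet> (det2 (c1 t) (c2 t) *\<^sub>R rot (uvec (\<theta> t))) + c2 t \<bullet> uvec (\<theta> t)) (at t)" for t
      by (rule bounded_bilinear.has_vector_derivative[OF bounded_bilinear_inner c2 uvec_has_vector_derivative[OF \<theta>]])
    moreover have "c1 t \<bullet> (det2 (c1 t) (c2 t) *\<^sub>R rot (uvec (\<theta> t))) + c2 t \<bullet> uvec (\<theta> t) = 0" for t
      by (subst (2) c2rot) (simp add: inner_vec2 algebra_simps)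
    ultimately show ?thesis
      by (intro DERIV_isconst_all) (simp add: has_real_derivative_iff_has_vector_derivative)
  qed
  also have "c1 0 \<bullet> uvec (\<theta> 0) = 1"
    by (simp add: \<theta>_def a[symmetric] c1sq)
  finally have inner1: "c1 t \<bullet> uvec (\<theta> t) = 1" for t .
  have c1\<theta>: "c1 t = uvec (\<theta> t)" for t
  proof -
    have "uvec x \<bullet> uvec x = 1" for x using norm_uvec[of x] by (simp add: norm_eq_sqrt_inner)
    then have "(c1 t - uvec (\<theta> t)) \<bullet> (c1 t - uvec (\<theta> t)) = 0"
      using inner1[of t] c1sq[of t] by (simp add: inner_diff inner_commute)
    then show ?thesis by simp
  qed
  have sm\<theta>: "smooth_on UNIV \<theta>" by (rule smooth_on_realI[OF \<theta> sm\<kappa>])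
  have mono: "strict_mono \<theta>"
    using strict_mono_on_deriv_pos[of UNIV \<theta>] \<theta> curv by (auto simp: is_interval_univ)
  have per: "\<theta> (t + 1) = \<theta> t + 2 * pi" for t
  proof -
    have "c1 (t + 1) = c1 t"
      using table_frame_circle_deriv[OF fr, of "t + 1"] table_frame_circle_deriv[OF fr, of t] by simp
    then have "uvec (\<theta> (t + 1)) = uvec (\<theta> t)" by (simp add: c1\<theta>)
    then obtain n :: int where n: "\<theta> (t + 1) = \<theta> t + 2 * pi * of_int n"
      by (rule uvec_eq_imp)
    have "\<theta> t < \<theta> (t + 1)" using mono by (simp add: strict_mono_less)
    then have n0: "n > 0" using n by (simp add: zero_less_mult_iff)
    text \<open>If the tangent turned more than once, two distinct points would have the same oriented
      tangent direction, each lying strictly to the left of the tangent at the other one.\<close>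
    have "\<not> 1 < n"
    proof
      assume "1 < n"
      then have "2 * pi * 1 < 2 * pi * of_int n" by (intro mult_strict_left_mono) auto
      then have lt: "\<theta> t < \<theta> t + 2 * pi" "\<theta> t + 2 * pi < \<theta> (t + 1)" using n by auto
      have "continuous_on {t..t+1} \<theta>"
        using smooth_on_imp_continuous_on[OF sm\<theta>] by (rule continuous_on_subset) auto
      then obtain T where T: "t \<le> T" "T \<le> t + 1" "\<theta> T = \<theta> t + 2 * pi"
        using IVT'[of \<theta> t "\<theta> t + 2 * pi" "t + 1"] lt by auto
      with lt have "T \<noteq> t" "T \<noteq> t + 1" by auto
      with T have T': "t < T" "T < t + 1" by auto
      have "c1 T = c1 t" by (simp add: c1\<theta> T)
      moreover have "0 < det2 (c1 t) (\<gamma> (circ T) - \<gamma> (circ t))"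
        using T' by (intro conv) auto
      moreover have "0 < det2 (c1 T) (\<gamma> (circ (t + 1)) - \<gamma> (circ T))"
        using T' by (intro conv) auto
      ultimately show False by (simp add: det2.diff_right)
    qed
    with n0 have "n = 1" by simp
    with n show ?thesis by simp
  qed
  show thesis by (rule that[OF sm\<theta> \<theta> c1\<theta> per])
qed

text \<open>\<open>\<tau>\<close> inverts the tangent angle, and \<open>\<tau>' x\<close> is the
  radius of curvature at the point whose tangent direction is \<open>uvec x\<close>.\<close>

lemma tangent_angle_param:
  assumes "\<gamma> \<in> billiard_tables"
  obtains \<tau> \<tau>' where "smooth_on UNIV \<tau>" "\<And>x. (\<tau> has_real_derivative \<tau>' x) (at x)" "\<And>x. 0 < \<tau>' x"
    "\<And>x. \<tau> (x + 2 * pi) = \<tau> x + 1"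
    "\<And>x. ((\<lambda>x. \<gamma> (circ (\<tau> x))) has_vector_derivative \<tau>' x *\<^sub>R uvec x) (at x)"
    "\<And>x X. x < X \<Longrightarrow> X < x + 2 * pi \<Longrightarrow> 0 < det2 (uvec x) (\<gamma> (circ (\<tau> X)) - \<gamma> (circ (\<tau> x)))"
proof -
  obtain c1 c2 where fr: "table_frame \<gamma> c1 c2" using table_frame_exists[OF assms] .
  from fr have c1: "\<And>t. ((\<lambda>t. \<gamma> (circ t)) has_vector_derivative c1 t) (at t)"
    and curv: "\<And>t. 0 < det2 (c1 t) (c2 t)"
    and conv: "\<And>t T. 0 < T - t \<Longrightarrow> T - t < 1 \<Longrightarrow> 0 < det2 (c1 t) (\<gamma> (circ T) - \<gamma> (circ t))"
    unfolding table_frame_def by auto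
  obtain \<theta> where sm: "smooth_on UNIV \<theta>"
    and \<theta>: "\<And>t. (\<theta> has_real_derivative det2 (c1 t) (c2 t)) (at t)"
    and c1\<theta>: "\<And>t. c1 t = uvec (\<theta> t)" and per: "\<And>t. \<theta> (t + 1) = \<theta> t + 2 * pi"
    using table_frame_angle[OF fr] by metis
  \<comment> \<open>A single function is treated as a family over the parameter set consisting of
    0.\<close>
  have sm0: "smooth_on ({0::real} \<times> UNIV) (\<lambda>z. \<theta> (snd z))"
    by (rule smooth_on_compose[OF sm]) (auto intro: smooth_on_snd smooth_on_id)
  obtain g where g: "smooth_on ({0::real} \<times> UNIV) (\<lambda>z. g (fst z) (snd z))"
    "\<And>y. \<theta> (g 0 y) = y" and mono: "strict_mono \<theta>"
  proof (rule monotone_family_inverse[where f = "\<lambda>_. \<theta>" and a = 1 and b = "2 * pi", OF _ sm0])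
    show "\<exists>D>0. (\<theta> has_real_derivative D) (at x)" for x using \<theta> curv by blast
    show "\<theta> (x + 1) = \<theta> x + 2 * pi" for x by (rule per)
  qed (auto intro: that)
  define \<tau> where "\<tau> = g 0"
  have \<theta>\<tau>: "\<theta> (\<tau> y) = y" for y by (simp add: \<tau>_def g)
  have "smooth_on UNIV (\<lambda>y::real. (0::real, y))"
    by (intro smooth_on_Pair smooth_on_const smooth_on_id)
  from smooth_on_compose[OF g(1) this] have sm\<tau>: "smooth_on UNIV \<tau>" by (simp add: \<tau>_def)
  obtain \<tau>' where \<tau>': "\<And>x. (\<tau> has_vector_derivative \<tau>' x) (at x)"
    using smooth_on_vector_derivative[OF sm\<tau>] by metis
  then have d\<tau>: "(\<tau> has_real_derivative \<tau>' x) (at x)" for x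
    by (simp add: has_real_derivative_iff_has_vector_derivative)
  have pos: "0 < \<tau>' x" for x
  proof -
    have "((\<lambda>x. \<theta> (\<tau> x)) has_real_derivative det2 (c1 (\<tau> x)) (c2 (\<tau> x)) * \<tau>' x) (at x)"
      by (rule DERIV_chain2[OF \<theta> d\<tau>])
    then have "det2 (c1 (\<tau> x)) (c2 (\<tau> x)) * \<tau>' x = 1"
      unfolding \<theta>\<tau> using DERIV_unique DERIV_ident by blast
    then show ?thesis using curv[of "\<tau> x"] by (metis zero_less_mult_pos zero_less_one)
  qed
  have "\<theta> (\<tau> (x + 2 * pi)) = \<theta> (\<tau> x + 1)" for x by (simp add: per \<theta>\<tau>)
  then have per\<tau>: "\<tau> (x + 2 * pi) = \<tau> x + 1" for x using mono by (simp add: strict_mono_eq)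
  have mono\<tau>: "\<tau> x < \<tau> y" if "x < y" for x y
    using that mono \<theta>\<tau> by (metis strict_mono_less)
  have "((\<lambda>x. \<gamma> (circ (\<tau> x))) has_vector_derivative \<tau>' x *\<^sub>R uvec x) (at x)" for x
    using vector_diff_chain_at[OF \<tau>' c1, of x] by (simp add: o_def c1\<theta> \<theta>\<tau>)
  moreover have "0 < det2 (uvec x) (\<gamma> (circ (\<tau> X)) - \<gamma> (circ (\<tau> x)))" if "x < X" "X < x + 2 * pi" for x X
    using conv[of "\<tau> X" "\<tau> x"] mono\<tau>[OF that(1)] mono\<tau>[OF that(2)] by (simp add: c1\<theta> \<theta>\<tau> per\<tau>)
  ultimately show thesis using that[OF sm\<tau> d\<tau> pos per\<tau>] by blast
qed

text \<open>The Minkowski interpolation of the two tables, parametrized by the direction \<open>x\<close> of the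
  tangent, is \<open>(1 - s) \<alpha> + s \<beta>\<close>; its arc length, measured from the image of the marked points,
  interpolates linearly as well.\<close>

theorem table_homotopy_exists:
  assumes \<alpha>: "\<alpha> \<in> billiard_tables" and \<beta>: "\<beta> \<in> billiard_tables"
  obtains \<Gamma> where "table_homotopy \<Gamma> \<alpha> \<beta>"
proof -
  obtain \<tau>0 \<tau>0' where 0: "smooth_on UNIV \<tau>0" "\<And>x. (\<tau>0 has_real_derivative \<tau>0' x) (at x)" "\<And>x. 0 < \<tau>0' x"
    "\<And>x. \<tau>0 (x + 2 * pi) = \<tau>0 x + 1"
    "\<And>x. ((\<lambda>x. \<alpha> (circ (\<tau>0 x))) has_vector_derivative \<tau>0' x *\<^sub>R uvec x) (at x)"
    "\<And>x X. x < X \<Longrightarrow> X < x + 2 * pi \<Longrightarrow> 0 < det2 (uvec x) (\<alpha> (circ (\<tau>0 X)) - \<alpha> (circ (\<tau>0 x)))"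
    by (rule tangent_angle_param[OF \<alpha>], rule that) (assumption | blast)+
  obtain \<tau>1 \<tau>1' where 1: "smooth_on UNIV \<tau>1" "\<And>x. (\<tau>1 has_real_derivative \<tau>1' x) (at x)" "\<And>x. 0 < \<tau>1' x"
    "\<And>x. \<tau>1 (x + 2 * pi) = \<tau>1 x + 1"
    "\<And>x. ((\<lambda>x. \<beta> (circ (\<tau>1 x))) has_vector_derivative \<tau>1' x *\<^sub>R uvec x) (at x)"
    "\<And>x X. x < X \<Longrightarrow> X < x + 2 * pi \<Longrightarrow> 0 < det2 (uvec x) (\<beta> (circ (\<tau>1 X)) - \<beta> (circ (\<tau>1 x)))"
    by (rule tangent_angle_param[OF \<beta>], rule that) (assumption | blast)+
  let ?S = "{0..1::real}"
  \<comment> \<open>For equal \<open>x\<close> both tables move along the same vector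
    \<open>uvec x\<close>, so speeds add without cancellation: \<open>C s\<close> has speed
    \<open>L' s\<close>, \<open>L s\<close> is its arc length, and the perimeter stays 1.\<close>
  define L where "L s x = (1 - s) * \<tau>0 x + s * \<tau>1 x" for s x
  define L' where "L' s x = (1 - s) * \<tau>0' x + s * \<tau>1' x" for s x
  define C where "C s x = (1 - s) *\<^sub>R \<alpha> (circ (\<tau>0 x)) + s *\<^sub>R \<beta> (circ (\<tau>1 x))" for s x
  have mix: "0 < (1 - s) * a + s * b" if "s \<in> ?S" "0 < a" "0 < b" for s a b :: real
    using that by (cases "s = 0") (auto intro!: add_nonneg_pos)
  have dL: "(L s has_real_derivative L' s x) (at x)" for s x
    unfolding L_def L'_def by (auto intro!: derivative_eq_intros 0(2) 1(2))
  have L'pos: "0 < L' s x" if "s \<in> ?S" for s x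
    unfolding L'_def using that by (intro mix 0 1)
  have perL: "L s (x + 2 * pi) = L s x + 1" for s x
    unfolding L_def 0(4) 1(4) by (simp add: algebra_simps)
  have comp: "smooth_on (?S \<times> UNIV) (\<lambda>z :: real \<times> real. f (snd z))" if "smooth_on UNIV f"
    for f :: "real \<Rightarrow> 'b::real_normed_vector"
    by (rule smooth_on_compose[OF that]) (auto intro: smooth_on_snd smooth_on_id)
  have smL: "smooth_on (?S \<times> UNIV) (\<lambda>z. L (fst z) (snd z))"
    unfolding L_def
    by (intro smooth_on_add smooth_on_mult smooth_on_diff smooth_on_const smooth_on_fst smooth_on_id comp 0 1)
  obtain g where smg: "smooth_on (?S \<times> UNIV) (\<lambda>z. g (fst z) (snd z))"
    and Lg: "\<And>s y. s \<in> ?S \<Longrightarrow> L s (g s y) = y" and mono: "\<And>s. s \<in> ?S \<Longrightarrow> strict_mono (L s)"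
  proof (rule monotone_family_inverse[OF _ smL])
    show "\<exists>D>0. (L s has_real_derivative D) (at x)" if "s \<in> ?S" for s x
      using dL L'pos[OF that] by blast
    show "L s (x + 2 * pi) = L s x + 1" for s x by (rule perL)
  qed (auto intro: that)
  have gL: "g s (L s x) = x" if "s \<in> ?S" for s x
    using strict_mono_eq[OF mono[OF that]] Lg[OF that] by blast
  have perg: "g s (t + of_int n) = g s t + of_int n * (2 * pi)" if "s \<in> ?S" for s t n
    using shift_int[of "L s" "2 * pi" 1 "g s t" n, OF perL] Lg[OF that] gL[OF that]
    by (metis mult.right_neutral)
  have monog: "g s x < g s y" if "s \<in> ?S" "x < y" for s x y
    using that mono[OF that(1)] Lg by (metis strict_mono_less)
  have perC: "C s (x + of_int n * (2 * pi)) = C s x" for s x n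
    using shift_int[of \<tau>0 "2 * pi" 1 x n, OF 0(4)] shift_int[of \<tau>1 "2 * pi" 1 x n, OF 1(4)]
    by (simp add: C_def)
  define \<Gamma> where "\<Gamma> s q = C s (g s (rep_circle q))" for s q
  have \<Gamma>: "\<Gamma> s (circ t) = C s (g s t)" if "s \<in> ?S" for s t
    by (rule rep_circ[of t]) (simp add: \<Gamma>_def perg[OF that] perC)
  have sm\<alpha>: "smooth_on UNIV (\<lambda>t. \<gamma> (circ t))" if "\<gamma> \<in> billiard_tables" for \<gamma>
    using that table_frame_exists unfolding table_frame_def by metis
  have smC: "smooth_on (?S \<times> UNIV) (\<lambda>z. C (fst z) (snd z))"
    unfolding C_def
    by (intro smooth_on_add smooth_on_scaleR smooth_on_diff smooth_on_const smooth_on_fst smooth_on_id comp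
        smooth_on_compose[OF sm\<alpha>[OF \<alpha>] 0(1)] smooth_on_compose[OF sm\<alpha>[OF \<beta>] 1(1)]) auto
  have sm: "smooth_on (?S \<times> UNIV) (\<lambda>z. C (fst z) (g (fst z) (snd z)))"
    using smooth_on_compose[OF smC smooth_on_Pair[OF smooth_on_fst[OF smooth_on_id] smg]] by auto
  have fr: "\<exists>c1 c2. table_frame (\<Gamma> s) c1 c2" if s: "s \<in> ?S" for s
  proof -
    have slice: "smooth_on UNIV (\<lambda>t. f (s, t))" if "smooth_on (?S \<times> UNIV) f"
      for f :: "real \<times> real \<Rightarrow> 'b::real_normed_vector"
      using s by (intro smooth_on_compose[OF that]) (auto intro: smooth_on_Pair smooth_on_const smooth_on_id)
    have smgs: "smooth_on UNIV (g s)" using slice[OF smg] by simp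
    obtain g' where g': "\<And>t. (g s has_vector_derivative g' t) (at t)"
      using smooth_on_vector_derivative[OF smgs] by metis
    then have dg: "(g s has_real_derivative g' t) (at t)" for t
      by (simp add: has_real_derivative_iff_has_vector_derivative)
    have L'g': "L' s (g s t) * g' t = 1" for t
    proof -
      have "((\<lambda>t. L s (g s t)) has_real_derivative L' s (g s t) * g' t) (at t)"
        by (rule DERIV_chain2[OF dL dg])
      then show ?thesis unfolding Lg[OF s] using DERIV_unique DERIV_ident by blast
    qed
    have g'pos: "0 < g' t" for t
      using L'g'[of t] L'pos[OF s, of "g s t"] by (metis zero_less_mult_pos zero_less_one)
    have dC: "(C s has_vector_derivative L' s x *\<^sub>R uvec x) (at x)" for x
    proof -
      have "(C s has_vector_derivative (1 - s) *\<^sub>R (\<tau>0' x *\<^sub>R uvec x) + s *\<^sub>R (\<tau>1' x *\<^sub>R uvec x)) (at x)"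
        unfolding C_def
        by (intro has_vector_derivative_add bounded_linear.has_vector_derivative[OF bounded_linear_scaleR_right] 0 1)
      then show ?thesis by (simp add: L'_def scaleR_left.add)
    qed
    have "table_frame (\<Gamma> s) (\<lambda>t. uvec (g s t)) (\<lambda>t. g' t *\<^sub>R rot (uvec (g s t)))"
      unfolding table_frame_def
    proof (intro conjI allI impI)
      show "smooth_on UNIV (\<lambda>t. \<Gamma> s (circ t))" using slice[OF sm] by (simp add: \<Gamma>[OF s])
      show "smooth_on UNIV (\<lambda>t. uvec (g s t))" by (rule smooth_on_uvec[OF smgs])
      show "((\<lambda>t. \<Gamma> s (circ t)) has_vector_derivative uvec (g s t)) (at t)" for t
        using vector_diff_chain_at[OF g' dC, of t] L'g'[of t]
        by (simp add: o_def \<Gamma>[OF s] mult.commute)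
      show "((\<lambda>t. uvec (g s t)) has_vector_derivative g' t *\<^sub>R rot (uvec (g s t))) (at t)" for t
        by (rule uvec_has_vector_derivative[OF dg])
      show "norm (uvec (g s t)) = 1" for t by simp
      show "0 < det2 (uvec (g s t)) (g' t *\<^sub>R rot (uvec (g s t)))" for t
        using g'pos[of t] unfolding det2.scaleR_right by (simp add: det2_def)
      fix t T :: real assume "0 < T - t" "T - t < 1"
      then have lt: "g s t < g s T" "g s T < g s t + 2 * pi"
        using monog[OF s, of t T] monog[OF s, of T "t + 1"] perg[OF s, of t 1] by auto
      \<comment> \<open>Both tables have tangent direction \<open>uvec (g s t)\<close> at the
        corresponding points, so the determinant is affine in \<open>s\<close> and strict leftness
        is inherited from the two ends.\<close>
      have "det2 (uvec (g s t)) (\<Gamma> s (circ T) - \<Gamma> s (circ t)) =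
        (1 - s) * det2 (uvec (g s t)) (\<alpha> (circ (\<tau>0 (g s T))) - \<alpha> (circ (\<tau>0 (g s t)))) +
        s * det2 (uvec (g s t)) (\<beta> (circ (\<tau>1 (g s T))) - \<beta> (circ (\<tau>1 (g s t))))"
        by (simp add: \<Gamma>[OF s] C_def det2.add_right det2.diff_right det2.scaleR_right right_diff_distrib)
      also have "\<dots> > 0" using lt by (intro mix s 0 1)
      finally show "0 < det2 (uvec (g s t)) (\<Gamma> s (circ T) - \<Gamma> s (circ t))" .
    qed
    then show ?thesis by blast
  qed
  have "table_homotopy \<Gamma> \<alpha> \<beta>"
    unfolding table_homotopy_def
  proof (intro conjI ballI)
    show "smooth_on (?S \<times> UNIV) (\<lambda>(s, t). \<Gamma> s (circ t))"
      by (rule smooth_on_cong[OF sm]) (auto simp: \<Gamma>)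
    show "\<Gamma> s \<in> billiard_tables" if "s \<in> ?S" for s
      using fr[OF that] table_frame_imp_billiard_table by blast
    \<comment> \<open>\<open>L 0\<close> is \<open>\<tau>0\<close>, so \<open>g 0\<close> undoes the
      parametrization exactly and the marked point of \<open>\<alpha>\<close> is recovered.\<close>
    show "\<Gamma> 0 = \<alpha>"
    proof
      fix q
      have "\<tau>0 (g 0 (rep_circle q)) = rep_circle q" using Lg[of 0] by (simp add: L_def)
      then show "\<Gamma> 0 q = \<alpha> q" by (simp add: \<Gamma>_def C_def)
    qed
    show "\<Gamma> 1 = \<beta>"
    proof
      fix q
      have "\<tau>1 (g 1 (rep_circle q)) = rep_circle q" using Lg[of 1] by (simp add: L_def)
      then show "\<Gamma> 1 q = \<beta> q" by (simp add: \<Gamma>_def C_def)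
    qed
  qed
  then show thesis by (rule that)
qed

section \<open>From isotopies of the strip to Hamiltonian paths of the annulus\<close>

lemma continuous_on_circ: "continuous_on UNIV circ"
  by (auto simp: continuous_on_open_vimage open_circle_def)

lemma open_circ_image: "open U \<Longrightarrow> open (circ ` U)"
proof -
  assume U: "open U"
  have "circ -` (circ ` U) = (\<Union>n::int. (\<lambda>x. of_int n + x) ` U)"
  proof (intro equalityI subsetI)
    fix x assume "x \<in> circ -` (circ ` U)"
    then obtain y where y: "y \<in> U" "x - y \<in> \<int>" by (auto simp: circ_eq_iff)
    then obtain n :: int where "x = of_int n + y" by (auto elim!: Ints_cases simp: algebra_simps)
    with y show "x \<in> (\<Union>n::int. (\<lambda>x. of_int n + x) ` U)" by auto
  next
    fix x assume "x \<in> (\<Union>n::int. (\<lambda>x. of_int n + x) ` U)"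
    then obtain n :: int and y where "y \<in> U" "x = y + of_int n" by (auto simp: add.commute)
    then show "x \<in> circ -` (circ ` U)" by auto
  qed
  then show ?thesis using U by (auto simp: open_circle_def open_translation)
qed

lemma continuous_on_cov: "continuous_on UNIV cov"
  unfolding cov_def
  by (intro continuous_on_Pair continuous_on_compose2[OF continuous_on_circ] continuous_intros) auto

lemma cov_add_int [simp]: "cov (q + of_int n, p) = cov (q, p)"
  by (simp add: cov_def)

definition lft :: "circle \<times> real \<Rightarrow> real \<times> real" where
  "lft c = (rep_circle (fst c), snd c)"

lemma cov_lft [simp]: "cov (lft c) = c"
  by (simp add: cov_def lft_def)

lemma lft_cov: obtains n :: int where "lft (cov (q, p)) = (q + of_int n, p)"
  by (rule rep_circ[of q]) (auto simp: cov_def lft_def)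

lemma cov_in_annulus [simp]: "cov z \<in> annulus \<longleftrightarrow> z \<in> strip"
  by (cases z) (auto simp: cov_def annulus_def strip_def)

lemma lft_in_strip [simp]: "lft c \<in> strip \<longleftrightarrow> c \<in> annulus"
  by (metis cov_in_annulus cov_lft)

lemma strip_iff [simp]: "(q, p) \<in> strip \<longleftrightarrow> \<bar>p\<bar> < 1"
  by (auto simp: strip_def)

lemma open_strip: "open strip"
  unfolding strip_def by (intro open_Times) auto

text \<open>The covering is an open map, so an open set that witnesses continuity upstairs has an
  open image downstairs. The domain is saturated, since membership depends on \<open>s\<close> and
  \<open>p\<close> only; hence the image cuts out the right set.\<close>

lemma continuous_on_descend:
  fixes f :: "real \<times> (circle \<times> real) \<Rightarrow> 'b::topological_space"
  assumes "continuous_on ({0..1} \<times> (UNIV \<times> {-1..1})) (\<lambda>x. f (fst x, cov (snd x)))"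
  shows "continuous_on ({0..1} \<times> closed_annulus) f"
  unfolding continuous_on_open_invariant
proof (intro allI impI)
  fix B :: "'b set" assume "open B"
  with assms obtain A where A: "open A"
    "A \<inter> ({0..1} \<times> (UNIV \<times> {-1..1})) = (\<lambda>x. f (fst x, cov (snd x))) -` B \<inter> ({0..1} \<times> (UNIV \<times> {-1..1}))"
    unfolding continuous_on_open_invariant by blast
  let ?\<pi> = "\<lambda>x :: real \<times> (real \<times> real). (fst x, cov (snd x))"
  show "\<exists>A. open A \<and> A \<inter> ({0..1} \<times> closed_annulus) = f -` B \<inter> ({0..1} \<times> closed_annulus)"
  proof (intro exI conjI)
    show "open (?\<pi> ` A)"
      unfolding open_subopen[of "?\<pi> ` A"]
    proof
      fix y assume "y \<in> ?\<pi> ` A"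
      then obtain s q p where x: "(s, (q, p)) \<in> A" "y = (s, (circ q, p))" by (auto simp: cov_def)
      obtain U W where UW: "open U" "open W" "(s, (q, p)) \<in> U \<times> W" "U \<times> W \<subseteq> A"
        using open_prod_elim[OF A(1) x(1)] by metis
      then obtain Y Z where YZ: "open Y" "open Z" "(q, p) \<in> Y \<times> Z" "Y \<times> Z \<subseteq> W"
        using open_prod_elim[OF UW(2), of "(q, p)"] by auto
      have "U \<times> (circ ` Y \<times> Z) \<subseteq> ?\<pi> ` A"
      proof
        fix w assume "w \<in> U \<times> (circ ` Y \<times> Z)"
        then obtain s' q' p' where "w = ?\<pi> (s', (q', p'))" "s' \<in> U" "q' \<in> Y" "p' \<in> Z"
          by (auto simp: cov_def)
        with UW YZ show "w \<in> ?\<pi> ` A" by blast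
      qed
      moreover have "open (U \<times> (circ ` Y \<times> Z))"
        using UW YZ by (intro open_Times open_circ_image) auto
      ultimately show "\<exists>T. open T \<and> y \<in> T \<and> T \<subseteq> ?\<pi> ` A"
        using x UW YZ by (intro exI[of _ "U \<times> (circ ` Y \<times> Z)"]) auto
    qed
    show "?\<pi> ` A \<inter> ({0..1} \<times> closed_annulus) = f -` B \<inter> ({0..1} \<times> closed_annulus)"
    proof (intro equalityI subsetI)
      fix y assume y: "y \<in> ?\<pi> ` A \<inter> ({0..1} \<times> closed_annulus)"
      then obtain x where x: "x \<in> A" "y = ?\<pi> x" by auto
      with y have "x \<in> A \<inter> ({0..1} \<times> (UNIV \<times> {-1..1}))"
        by (auto simp: closed_annulus_def cov_def mem_Times_iff)
      with A(2) have "f y \<in> B" using x by auto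
      with y show "y \<in> f -` B \<inter> ({0..1} \<times> closed_annulus)" by auto
    next
      fix y assume y: "y \<in> f -` B \<inter> ({0..1} \<times> closed_annulus)"
      let ?x = "(fst y, lft (snd y))"
      have "?\<pi> ?x = y" by simp
      have "?x \<in> {0..1} \<times> (UNIV \<times> {-1..1})"
        using y by (auto simp: closed_annulus_def lft_def)
      then have "?x \<in> A \<inter> ({0..1} \<times> (UNIV \<times> {-1..1}))"
        unfolding A(2) using y \<open>?\<pi> ?x = y\<close> by simp
      then have "?x \<in> A" by blast
      with \<open>?\<pi> ?x = y\<close> y show "y \<in> ?\<pi> ` A \<inter> ({0..1} \<times> closed_annulus)" by force
    qed
  qed
qed

text \<open>Points of \<open>S\<close> keep away from the closed set \<open>T\<close>, so only the
  limits at points of \<open>T\<close> along \<open>S\<close> have to be supplied. Here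
  \<open>T\<close> will be the two boundary lines of the strip.\<close>

lemma continuous_on_glue:
  fixes f :: "'a::metric_space \<Rightarrow> 'b::topological_space"
  assumes "continuous_on S f" "continuous_on T g" "closed T" "S \<inter> T = {}"
    and lim: "\<And>x. x \<in> T \<Longrightarrow> (f \<longlongrightarrow> g x) (at x within S)"
  shows "continuous_on (S \<union> T) (\<lambda>x. if x \<in> S then f x else g x)"
  unfolding continuous_on_def
proof
  let ?h = "\<lambda>x. if x \<in> S then f x else g x"
  have evS: "\<forall>\<^sub>F y in at x within S. f y = ?h y" for x
    by (simp add: eventually_at_filter)
  have evT: "\<forall>\<^sub>F y in at x within T. g y = ?h y" for x
    unfolding eventually_at_filter using assms(4) by (intro always_eventually) auto
  fix x assume "x \<in> S \<union> T"
  then show "(?h \<longlongrightarrow> ?h x) (at x within S \<union> T)"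
  proof
    assume x: "x \<in> S"
    then have "x \<notin> T" using assms(4) by auto
    then have bot: "at x within T = bot"
      using assms(3) by (metis closed_limpt trivial_limit_within)
    have "(f \<longlongrightarrow> f x) (at x within S)" using assms(1) x by (simp add: continuous_on_def)
    then have "(?h \<longlongrightarrow> f x) (at x within S)" using evS by (rule Lim_transform_eventually)
    then show ?thesis using x bot by (simp add: at_within_union)
  next
    assume x: "x \<in> T"
    then have "x \<notin> S" using assms(4) by auto
    have "(g \<longlongrightarrow> g x) (at x within T)" using assms(2) x by (simp add: continuous_on_def)
    then have "(?h \<longlongrightarrow> g x) (at x within T)" using evT by (rule Lim_transform_eventually)
    moreover have "(?h \<longlongrightarrow> g x) (at x within S)" using lim[OF x] evS by (rule Lim_transform_eventually)
    ultimately show ?thesis using \<open>x \<notin> S\<close> by (auto intro: Lim_Un)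
  qed
qed

lemma derivative_left_inverse:
  assumes "open S" "z \<in> S" "(f has_derivative D) (at z)" "(g has_derivative D') (at (f z))"
    and "\<And>z. z \<in> S \<Longrightarrow> g (f z) = z"
  shows "D' (D v) = v"
proof -
  have "((\<lambda>z. g (f z)) has_derivative (\<lambda>v. D' (D v))) (at z)"
    by (rule has_derivative_compose[OF assms(3,4)])
  then have "((\<lambda>z. z) has_derivative (\<lambda>v. D' (D v))) (at z)"
    by (rule has_derivative_transform_within_open[OF _ assms(1,2)]) (rule assms(5))
  then have "(\<lambda>v. D' (D v)) = (\<lambda>v. v)" by (rule has_derivative_unique) (rule has_derivative_ident)
  then show ?thesis by metis
qed

abbreviation cylinder :: "(real \<times> (real \<times> real)) set" where
  "cylinder \<equiv> {0..1} \<times> strip"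

abbreviation near :: "real \<Rightarrow> real \<Rightarrow> real \<Rightarrow> (real \<times> (real \<times> real)) filter" where
  "near s q p \<equiv> at (s, (q, p)) within cylinder"

text \<open>A Hamiltonian path lifted to the strip: the isotopy \<open>F\<close>, its inverse
  \<open>G\<close>, the velocity \<open>V\<close> of the particle that starts at \<open>z\<close>,
  and the Hamiltonian \<open>H\<close>. In \<open>dH\<close> the velocity at \<open>y\<close> is
  that of the particle arriving at \<open>y\<close>, hence the \<open>G\<close>. The integer in
  \<open>F_boundary\<close> allows the lift to approach different translates on the two boundary
  lines.\<close>

locale strip_isotopy =
  fixes F G V :: "real \<times> (real \<times> real) \<Rightarrow> real \<times> real" and H :: "real \<times> (real \<times> real) \<Rightarrow> real"
  assumes F_smooth: "smooth_on cylinder F" and G_smooth: "smooth_on cylinder G" and H_smooth: "smooth_on cylinder H"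
    and F_strip: "\<And>s z. s \<in> {0..1} \<Longrightarrow> z \<in> strip \<Longrightarrow> F (s, z) \<in> strip"
    and G_strip: "\<And>s z. s \<in> {0..1} \<Longrightarrow> z \<in> strip \<Longrightarrow> G (s, z) \<in> strip"
    and FG: "\<And>s z. s \<in> {0..1} \<Longrightarrow> z \<in> strip \<Longrightarrow> F (s, G (s, z)) = z"
    and GF: "\<And>s z. s \<in> {0..1} \<Longrightarrow> z \<in> strip \<Longrightarrow> G (s, F (s, z)) = z"
    and F_shift: "\<And>s q p. s \<in> {0..1} \<Longrightarrow> \<bar>p\<bar> < 1 \<Longrightarrow> F (s, (q + 1, p)) = F (s, (q, p)) + (1, 0)"
    and H_shift: "\<And>s q p. s \<in> {0..1} \<Longrightarrow> \<bar>p\<bar> < 1 \<Longrightarrow> H (s, (q + 1, p)) = H (s, (q, p))"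
    and F_symplectic: "\<And>s z D v w. s \<in> {0..1} \<Longrightarrow> z \<in> strip \<Longrightarrow>
      ((\<lambda>z. F (s, z)) has_derivative D) (at z) \<Longrightarrow> omega (D v) (D w) = omega v w"
    and F_boundary: "\<And>s q p. s \<in> {0..1} \<Longrightarrow> \<bar>p\<bar> = 1 \<Longrightarrow>
      \<exists>n::int. (F \<longlongrightarrow> (q + of_int n, p)) (near s q p)"
    and H_boundary: "\<And>s q p. s \<in> {0..1} \<Longrightarrow> \<bar>p\<bar> = 1 \<Longrightarrow> (H \<longlongrightarrow> 0) (near s q p)"
    and V: "\<And>s z. s \<in> {0..1} \<Longrightarrow> z \<in> strip \<Longrightarrow>
      ((\<lambda>r. F (r, z)) has_vector_derivative V (s, z)) (at s within {0..1})"
    and dH: "\<And>s y. s \<in> {0..1} \<Longrightarrow> y \<in> strip \<Longrightarrow>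
      ((\<lambda>y. H (s, y)) has_derivative (\<lambda>w. - omega (V (s, G (s, y))) w)) (at y)"
begin

definition flow :: "real \<Rightarrow> circle \<times> real \<Rightarrow> circle \<times> real" where
  "flow s = (\<lambda>c\<in>annulus. cov (F (s, lft c)))"

definition ham :: "real \<Rightarrow> circle \<times> real \<Rightarrow> real" where
  "ham s c = H (s, lft c)"

section \<open>Descent of the lifted data to the annulus\<close>

lemma F_shift_int:
  assumes "s \<in> {0..1}" "\<bar>p\<bar> < 1"
  shows "F (s, (q + of_int n, p)) = F (s, (q, p)) + (of_int n, 0)"
proof (induction n rule: int_induct[where k = 0])
  case (step1 i)
  then show ?case using F_shift[OF assms, of "q + of_int i"] by (simp add: algebra_simps)
next
  case (step2 i)
  have "F (s, (q + of_int i, p)) = F (s, (q + of_int (i - 1), p)) + (1, 0)"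
    using F_shift[OF assms, of "q + of_int (i - 1)"] by (simp add: algebra_simps)
  then have "F (s, (q + of_int (i - 1), p)) = F (s, (q, p)) + (of_int i, 0) - (1, 0)"
    using step2 by (simp add: algebra_simps)
  then show ?case by simp
qed (simp add: zero_prod_def[symmetric])

lemma H_shift_int:
  assumes "s \<in> {0..1}" "\<bar>p\<bar> < 1"
  shows "H (s, (q + of_int n, p)) = H (s, (q, p))"
proof (induction n rule: int_induct[where k = 0])
  case (step1 i)
  then show ?case using H_shift[OF assms, of "q + of_int i"] by (simp add: algebra_simps)
next
  case (step2 i)
  then show ?case using H_shift[OF assms, of "q + of_int (i - 1)"] by (simp add: algebra_simps)
qed simp

lemma G_shift_int:
  assumes "s \<in> {0..1}" "\<bar>p\<bar> < 1"
  shows "G (s, (q + of_int n, p)) = G (s, (q, p)) + (of_int n, 0)"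
proof -
  obtain a b where ab: "G (s, (q, p)) = (a, b)" by fastforce
  then have b: "\<bar>b\<bar> < 1" using G_strip[of s "(q, p)"] assms by simp
  have "F (s, (a + of_int n, b)) = (q + of_int n, p)"
    using F_shift_int[OF assms(1) b] FG[of s "(q, p)"] ab assms by simp
  then have "G (s, (q + of_int n, p)) = (a + of_int n, b)"
    using GF[of s "(a + of_int n, b)"] assms b by simp
  then show ?thesis by (simp add: ab)
qed

lemma V_shift_int:
  assumes "s \<in> {0..1}" "\<bar>p\<bar> < 1"
  shows "V (s, (q + of_int n, p)) = V (s, (q, p))"
proof -
  have "((\<lambda>r. F (r, (q, p)) + (of_int n, 0)) has_vector_derivative V (s, (q, p)) + 0) (at s within {0..1})"
    using assms by (intro has_vector_derivative_add V has_vector_derivative_const) auto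
  then have "((\<lambda>r. F (r, (q + of_int n, p))) has_vector_derivative V (s, (q, p))) (at s within {0..1})"
    using assms by (auto intro: has_vector_derivative_transform[rotated 2] simp: F_shift_int)
  moreover have "((\<lambda>r. F (r, (q + of_int n, p))) has_vector_derivative V (s, (q + of_int n, p))) (at s within {0..1})"
    using assms by (intro V) auto
  ultimately show ?thesis
    using assms(1) by (intro vector_derivative_unique_within_closed_interval[of 0 1 s]) auto
qed

lemma flow_cov:
  assumes "s \<in> {0..1}" "z \<in> strip"
  shows "flow s (cov z) = cov (F (s, z))"
proof (cases z)
  case (Pair q p)
  obtain n where "lft (cov (q, p)) = (q + of_int n, p)" by (rule lft_cov)
  with assms Pair show ?thesis
    by (cases "F (s, (q, p))") (simp add: flow_def F_shift_int)
qed

lemma ham_cov: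
  assumes "s \<in> {0..1}" "z \<in> strip"
  shows "ham s (cov z) = H (s, z)"
proof (cases z)
  case (Pair q p)
  obtain n where "lft (cov (q, p)) = (q + of_int n, p)" by (rule lft_cov)
  with assms Pair show ?thesis by (simp add: ham_def H_shift_int)
qed

lemma flow_bij:
  assumes s: "s \<in> {0..1}"
  shows "bij_betw (flow s) annulus annulus"
proof (rule bij_betwI)
  show "flow s \<in> annulus \<rightarrow> annulus" using F_strip[OF s] by (auto simp: flow_def)
  show "(\<lambda>c. cov (G (s, lft c))) \<in> annulus \<rightarrow> annulus" using G_strip[OF s] by auto
  fix c assume c: "c \<in> annulus"
  show "flow s (cov (G (s, lft c))) = c"
    using c by (simp add: flow_cov[OF s G_strip[OF s]] FG[OF s])
  \<comment> \<open>Projecting and choosing a representative again may change the lifted image by an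
    integer \<open>n\<close>; equivariance of \<open>G\<close> turns it into a translation, which
    \<open>cov\<close> removes.\<close>
  obtain q p where qp: "F (s, lft c) = (q, p)" by fastforce
  then have p: "\<bar>p\<bar> < 1" using F_strip[OF s, of "lft c"] c by simp
  obtain n where n: "lft (cov (q, p)) = (q + of_int n, p)" by (rule lft_cov)
  have "G (s, (q + of_int n, p)) = lft c + (of_int n, 0)"
    using GF[OF s, of "lft c"] c qp by (simp add: G_shift_int[OF s p])
  then have "cov (G (s, (q + of_int n, p))) = c"
    by (metis cov_add_int cov_lft add_Pair add.right_neutral prod.collapse)
  then show "cov (G (s, lft (flow s c))) = c"
    using c by (simp add: flow_def qp n)
qed

lemma flow_inv:
  assumes s: "s \<in> {0..1}" and z: "z \<in> strip"
  shows "inv_into annulus (flow s) (cov z) = cov (G (s, z))"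
proof (rule inv_into_f_eq)
  show "inj_on (flow s) annulus" using flow_bij[OF s] by (rule bij_betw_imp_inj_on)
  show "cov (G (s, z)) \<in> annulus" using G_strip[OF s z] by simp
  show "flow s (cov (G (s, z))) = cov z" using flow_cov[OF s G_strip[OF s z]] FG[OF s z] by simp
qed

lemma smooth_slice:
  fixes f :: "real \<times> (real \<times> real) \<Rightarrow> 'b::real_normed_vector"
  assumes "smooth_on cylinder f" "s \<in> {0..1}"
  shows "smooth_on strip (\<lambda>z. f (s, z))"
  by (rule smooth_on_compose[OF assms(1)])
    (use assms(2) in \<open>auto intro: smooth_on_Pair smooth_on_const smooth_on_id\<close>)

lemma differentiable_slice:
  fixes f :: "real \<times> (real \<times> real) \<Rightarrow> 'b::real_normed_vector"
  assumes "smooth_on cylinder f" "s \<in> {0..1}" "z \<in> strip"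
  obtains D where "((\<lambda>z. f (s, z)) has_derivative D) (at z)"
  using smooth_on_derivative[OF fat_open[OF open_strip] smooth_slice[OF assms(1,2)]] assms(3)
  by (metis at_within_open open_strip)

lemma flow_symplectomorphism:
  assumes s: "s \<in> {0..1}"
  shows "symplectomorphism (flow s)"
  unfolding symplectomorphism_def
proof (intro conjI)
  show "flow s \<in> extensional annulus" by (simp add: flow_def)
  show "bij_betw (flow s) annulus annulus" by (rule flow_bij[OF s])
  have "smooth_lift strip (\<lambda>z. flow s (cov z)) (\<lambda>z. F (s, z))"
    unfolding smooth_lift_def using smooth_slice[OF F_smooth s] flow_cov[OF s] by simp
  moreover have "omega (frechet_derivative (\<lambda>z. F (s, z)) (at z) v) (frechet_derivative (\<lambda>z. F (s, z)) (at z) w)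
      = omega v w" if "z \<in> strip" for z v w
  proof (rule F_symplectic[OF s that])
    obtain D where "((\<lambda>z. F (s, z)) has_derivative D) (at z)"
      using differentiable_slice[OF F_smooth s \<open>z \<in> strip\<close>] .
    then show "((\<lambda>z. F (s, z)) has_derivative frechet_derivative (\<lambda>z. F (s, z)) (at z)) (at z)"
      using frechet_derivative_works by (auto simp: differentiable_def)
  qed
  ultimately show "\<exists>F. smooth_lift strip (\<lambda>z. flow s (cov z)) F \<and>
        (\<forall>z\<in>strip. \<forall>v w.
           omega (frechet_derivative F (at z) v) (frechet_derivative F (at z) w) = omega v w)"
    by blast
  have "smooth_lift strip (\<lambda>z. inv_into annulus (flow s) (cov z)) (\<lambda>z. G (s, z))"
    unfolding smooth_lift_def using smooth_slice[OF G_smooth s] flow_inv[OF s] by simp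
  then show "\<exists>G. smooth_lift strip (\<lambda>z. inv_into annulus (flow s) (cov z)) G" by blast
qed

text \<open>Glueing on the closed strip followed by descent. The limits are those of maps already
  projected by \<open>cov\<close>, where the integer ambiguity of a lift has disappeared.\<close>

lemma continuous_on_extend:
  fixes f :: "real \<times> (circle \<times> real) \<Rightarrow> 'b::topological_space"
  assumes cont: "continuous_on cylinder (\<lambda>x. f (fst x, cov (snd x)))"
    and contg: "continuous_on ({0..1::real} \<times> (UNIV \<times> {-1, 1})) (\<lambda>x. g (cov (snd x)))"
    and lim: "\<And>s q p. s \<in> {0..1} \<Longrightarrow> \<bar>p\<bar> = 1 \<Longrightarrow>
      ((\<lambda>x. f (fst x, cov (snd x))) \<longlongrightarrow> g (cov (q, p))) (near s q p)"
  shows "continuous_on ({0..1} \<times> closed_annulus) (\<lambda>(s, c). if c \<in> annulus then f (s, c) else g c)"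
proof (rule continuous_on_descend)
  let ?T = "{0..1::real} \<times> ((UNIV :: real set) \<times> {-1, 1::real})"
  have glued: "continuous_on (cylinder \<union> ?T) (\<lambda>x. if x \<in> cylinder then f (fst x, cov (snd x)) else g (cov (snd x)))"
  proof (rule continuous_on_glue[OF cont contg])
    show "closed ?T" by (intro closed_Times) auto
    show "cylinder \<inter> ?T = {}" by (auto simp: strip_def)
    fix x assume "x \<in> ?T"
    then show "((\<lambda>x. f (fst x, cov (snd x))) \<longlongrightarrow> g (cov (snd x))) (at x within cylinder)"
      using lim by (cases x) auto
  qed
  have un: "cylinder \<union> ?T = {0..1} \<times> (UNIV \<times> {-1..1})"
    by (auto simp: strip_def)
  have "(if x \<in> cylinder then f (fst x, cov (snd x)) else g (cov (snd x))) =
      (case (fst x, cov (snd x)) of (s, c) \<Rightarrow> if c \<in> annulus then f (s, c) else g c)"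
    if "x \<in> {0..1} \<times> (UNIV \<times> {-1..1})" for x
    using that by (auto simp: mem_Times_iff)
  then show "continuous_on ({0..1} \<times> (UNIV \<times> {-1..1}))
      (\<lambda>x. case (fst x, cov (snd x)) of (s, c) \<Rightarrow> if c \<in> annulus then f (s, c) else g c)"
    by (rule continuous_on_eq[OF glued[unfolded un]])
qed

theorem hamiltonian_path_with_flow: "hamiltonian_path_with flow ham"
  unfolding hamiltonian_path_with_def
proof (intro conjI ballI)
  show "symplectomorphism (flow s)" if "s \<in> {0..1}" for s
    by (rule flow_symplectomorphism[OF that])
  show "continuous_on ({0..1} \<times> closed_annulus) (\<lambda>(s, z). if z \<in> annulus then flow s z else z)"
  proof -
    have eq: "flow (fst x) (cov (snd x)) = cov (F x)" if "x \<in> cylinder" for x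
      using that flow_cov[of "fst x" "snd x"] by (simp add: mem_Times_iff)
    have "continuous_on cylinder (\<lambda>x. cov (F x))"
      by (rule continuous_on_compose2[OF continuous_on_cov smooth_on_imp_continuous_on[OF F_smooth]]) auto
    then have 1: "continuous_on cylinder (\<lambda>x. flow (fst x) (cov (snd x)))"
      using eq by (simp cong: continuous_on_cong)
    have 2: "continuous_on ({0..1::real} \<times> (UNIV \<times> {-1, 1})) (\<lambda>x. cov (snd x))"
      by (intro continuous_on_compose2[OF continuous_on_cov] continuous_intros) auto
    have 3: "((\<lambda>x. flow (fst x) (cov (snd x))) \<longlongrightarrow> cov (q, p)) (near s q p)"
      if sp: "s \<in> {0..1}" "\<bar>p\<bar> = 1" for s q p
    proof -
      obtain n :: int where "(F \<longlongrightarrow> (q + of_int n, p)) (near s q p)"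
        using F_boundary[OF sp] by blast
      then have "((\<lambda>x. cov (F x)) \<longlongrightarrow> cov (q + of_int n, p)) (near s q p)"
        by (rule continuous_on_tendsto_compose[OF continuous_on_cov]) auto
      moreover have "\<forall>\<^sub>F x in near s q p. cov (F x) = flow (fst x) (cov (snd x))"
        using eq by (auto simp: eventually_at_filter)
      ultimately show ?thesis by (simp add: Lim_transform_eventually)
    qed
    show ?thesis
      using continuous_on_extend[of "\<lambda>x. flow (fst x) (snd x)" "\<lambda>c. c"] 1 2 3
      by (simp only: fst_conv snd_conv)
  qed
  have Heq: "ham (fst x) (cov (snd x)) = H x" if "x \<in> cylinder" for x
    using that ham_cov[of "fst x" "snd x"] by (simp add: mem_Times_iff)
  show "smooth_on cylinder (\<lambda>(s, z). ham s (cov z))"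
    by (rule smooth_on_cong[OF H_smooth]) (use Heq in auto)
  show "continuous_on ({0..1} \<times> closed_annulus) (\<lambda>(s, z). if z \<in> annulus then ham s z else 0)"
  proof -
    have 1: "continuous_on cylinder (\<lambda>x. ham (fst x) (cov (snd x)))"
      using smooth_on_imp_continuous_on[OF H_smooth] Heq by (simp cong: continuous_on_cong)
    have 3: "((\<lambda>x. ham (fst x) (cov (snd x))) \<longlongrightarrow> 0) (near s q p)"
      if sp: "s \<in> {0..1}" "\<bar>p\<bar> = 1" for s q p
    proof -
      have "\<forall>\<^sub>F x in near s q p. H x = ham (fst x) (cov (snd x))"
        using Heq by (auto simp: eventually_at_filter)
      with H_boundary[OF sp] show ?thesis by (rule Lim_transform_eventually)
    qed
    show ?thesis
      by (rule continuous_on_extend[of "\<lambda>x. ham (fst x) (snd x)" "\<lambda>_. 0",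
            unfolded fst_conv snd_conv, OF 1 continuous_on_const 3])
  qed
  \<comment> \<open>The velocity field at a place is the velocity of the particle that is there at
    time \<open>s\<close>; \<open>G\<close> finds its initial position.\<close>
  let ?X = "\<lambda>s c. V (s, G (s, lft c))"
  have X_cov: "?X s (cov y) = V (s, G (s, y))" if s: "s \<in> {0..1}" and y: "y \<in> strip" for s y
  proof (cases y)
    case (Pair q p)
    obtain n where n: "lft (cov (q, p)) = (q + of_int n, p)" by (rule lft_cov)
    obtain a b where ab: "G (s, (q, p)) = (a, b)" by fastforce
    then have "\<bar>b\<bar> < 1" using G_strip[OF s y] Pair by simp
    then show ?thesis using s y Pair n ab by (simp add: G_shift_int V_shift_int)
  qed
  show "\<exists>F X. smooth_lift cylinder (\<lambda>(s, z). flow s (cov z)) F \<and>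
        (\<forall>s\<in>{0..1}. \<forall>z\<in>strip.
           ((\<lambda>r. F (r, z)) has_vector_derivative X s (flow s (cov z))) (at s within {0..1})) \<and>
        (\<forall>s\<in>{0..1}. \<forall>z\<in>strip.
           ((\<lambda>y. ham s (cov y)) has_derivative (\<lambda>w. - omega (X s (cov z)) w)) (at z))"
  proof (intro exI[of _ F] exI[of _ ?X] conjI ballI)
    show "smooth_lift cylinder (\<lambda>(s, z). flow s (cov z)) F"
      unfolding smooth_lift_def using F_smooth flow_cov by auto
    fix s :: real and z assume s: "s \<in> {0..1}" and z: "z \<in> strip"
    show "((\<lambda>r. F (r, z)) has_vector_derivative ?X s (flow s (cov z))) (at s within {0..1})"
      using V[OF s z] by (simp add: flow_cov[OF s z] X_cov[OF s F_strip[OF s z]] GF[OF s z])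
    show "((\<lambda>y. ham s (cov y)) has_derivative (\<lambda>w. - omega (?X s (cov z)) w)) (at z)"
      unfolding X_cov[OF s z]
      by (rule has_derivative_transform_within_open[OF dH[OF s z] open_strip z]) (simp add: ham_cov[OF s])
  qed
qed

end

text \<open>Composing on the left with the inverse of the time-0 map makes the path start at the
  identity. That inverse is symplectic, so it carries the velocity field to one whose Hamiltonian is
  the old one composed with \<open>F (0, _)\<close>. Boundary values of the new path use those of
  \<open>G\<close> at time 0.\<close>

lemma strip_isotopy_relative:
  assumes "strip_isotopy F G V H"
    and Gb: "\<And>q p. \<bar>p\<bar> = 1 \<Longrightarrow> \<exists>m::int. ((\<lambda>z. G (0, z)) \<longlongrightarrow> (q + of_int m, p)) (at (q, p) within strip)"
  obtains V' where "strip_isotopy (\<lambda>x. G (0, F x)) (\<lambda>x. G (fst x, F (0, snd x))) V'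
    (\<lambda>x. H (fst x, F (0, snd x)))"
proof -
  interpret strip_isotopy F G V H by fact
  have zero: "(0::real) \<in> {0..1}" by simp
  define DF where "DF z = (SOME D. ((\<lambda>z. F (0, z)) has_derivative D) (at z))" for z
  define DG where "DG z = (SOME D. ((\<lambda>z. G (0, z)) has_derivative D) (at z))" for z
  have DF: "((\<lambda>z. F (0, z)) has_derivative DF z) (at z)" if "z \<in> strip" for z
    unfolding DF_def by (rule differentiable_slice[OF F_smooth zero that]) (rule someI[where P = "\<lambda>D. (_ has_derivative D) _"])
  have DG: "((\<lambda>z. G (0, z)) has_derivative DG z) (at z)" if "z \<in> strip" for z
    unfolding DG_def by (rule differentiable_slice[OF G_smooth zero that]) (rule someI[where P = "\<lambda>D. (_ has_derivative D) _"])
  have DGDF: "DG (F (0, z)) (DF z v) = v" if z: "z \<in> strip" for z v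
    by (rule derivative_left_inverse[OF open_strip z DF[OF z] DG[OF F_strip[OF zero z]] GF[OF zero]])
  have DFDG: "DF (G (0, z)) (DG z v) = v" if z: "z \<in> strip" for z v
    by (rule derivative_left_inverse[OF open_strip z DG[OF z] DF[OF G_strip[OF zero z]] FG[OF zero]])
  have G_sym: "omega (DG z v) (DG z w) = omega v w" if z: "z \<in> strip" for z v w
    using F_symplectic[OF zero G_strip[OF zero z] DF[OF G_strip[OF zero z]], of "DG z v" "DG z w"]
    by (simp add: DFDG[OF z])
  have F0: "smooth_on cylinder (\<lambda>x. F (0, snd x))"
    by (rule smooth_on_compose[OF smooth_slice[OF F_smooth zero]]) (auto intro: smooth_on_snd smooth_on_id)
  have sF0: "smooth_on cylinder (\<lambda>x. (fst x, F (0, snd x)))"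
    by (intro smooth_on_Pair smooth_on_fst smooth_on_id F0)
  have in_dom: "(fst x, F (0, snd x)) \<in> cylinder" if "x \<in> cylinder" for x
    using that F_strip[OF zero] by (auto simp: mem_Times_iff)
  have F_in: "F x \<in> strip" if "x \<in> cylinder" for x
    using that F_strip by (cases x) auto
  have ev_dom: "\<forall>\<^sub>F x in at y within cylinder. x \<in> cylinder" for y by (simp add: eventually_at_filter)
  have "strip_isotopy (\<lambda>x. G (0, F x)) (\<lambda>x. G (fst x, F (0, snd x)))
    (\<lambda>x. DG (F x) (V x)) (\<lambda>x. H (fst x, F (0, snd x)))"
  proof
    show "smooth_on cylinder (\<lambda>x. G (0, F x))"
      by (rule smooth_on_compose[OF smooth_slice[OF G_smooth zero] F_smooth F_in])
    show "smooth_on cylinder (\<lambda>x. G (fst x, F (0, snd x)))"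
      by (rule smooth_on_compose[OF G_smooth sF0 in_dom])
    show "smooth_on cylinder (\<lambda>x. H (fst x, F (0, snd x)))"
      by (rule smooth_on_compose[OF H_smooth sF0 in_dom])
    fix s :: real assume s: "s \<in> {0..1}"
    show "G (0, F (s, z)) \<in> strip" if "z \<in> strip" for z
      by (intro G_strip F_strip s zero that)
    show "G (fst (s, z), F (0, snd (s, z))) \<in> strip" if "z \<in> strip" for z
      using that by (auto intro!: G_strip F_strip s)
    show "G (0, F (s, G (fst (s, z), F (0, snd (s, z))))) = z" if "z \<in> strip" for z
      using that s by (simp add: FG GF F_strip)
    show "G (fst (s, G (0, F (s, z))), F (0, snd (s, G (0, F (s, z))))) = z" if "z \<in> strip" for z
      using that s by (simp add: FG GF F_strip)
    show "G (0, F (s, (q + 1, p))) = G (0, F (s, (q, p))) + (1, 0)" if p: "\<bar>p\<bar> < 1" for q p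
    proof -
      obtain a b where ab: "F (s, (q, p)) = (a, b)" by fastforce
      then have "\<bar>b\<bar> < 1" using F_strip[OF s, of "(q, p)"] p by simp
      then show ?thesis using F_shift[OF s p] G_shift_int[OF zero, of b a 1] ab by simp
    qed
    show "H (fst (s, (q + 1, p)), F (0, snd (s, (q + 1, p)))) = H (fst (s, (q, p)), F (0, snd (s, (q, p))))"
      if p: "\<bar>p\<bar> < 1" for q p
    proof -
      obtain a b where ab: "F (0, (q, p)) = (a, b)" by fastforce
      then have "\<bar>b\<bar> < 1" using F_strip[OF zero, of "(q, p)"] p by simp
      then show ?thesis using F_shift[OF zero p] H_shift[OF s, of b a] ab by simp
    qed
    show "omega (D v) (D w) = omega v w"
      if z: "z \<in> strip" and D: "((\<lambda>z. G (0, F (s, z))) has_derivative D) (at z)" for z D v w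
    proof -
      obtain D1 where D1: "((\<lambda>z. F (s, z)) has_derivative D1) (at z)"
        using differentiable_slice[OF F_smooth s z] .
      have "((\<lambda>z. G (0, F (s, z))) has_derivative (\<lambda>v. DG (F (s, z)) (D1 v))) (at z)"
        by (rule has_derivative_compose[OF D1 DG[OF F_strip[OF s z]]])
      then have "D = (\<lambda>v. DG (F (s, z)) (D1 v))" by (rule has_derivative_unique[OF D])
      then show ?thesis using G_sym[OF F_strip[OF s z]] F_symplectic[OF s z D1] by simp
    qed
    show "\<exists>n::int. ((\<lambda>x. G (0, F x)) \<longlongrightarrow> (q + of_int n, p)) (near s q p)"
      if p: "\<bar>p\<bar> = 1" for q p
    proof -
      obtain n :: int where n: "(F \<longlongrightarrow> (q + of_int n, p)) (near s q p)"
        using F_boundary[OF s p] by blast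
      \<comment> \<open>The two integer shifts add up. Since \<open>F x\<close> stays in the open
        strip, it never equals the limit point, and the limit of \<open>G\<close> within the strip
        can be composed with that of \<open>F\<close>.\<close>
      obtain m :: int where m: "((\<lambda>z. G (0, z)) \<longlongrightarrow> (q + of_int n + of_int m, p)) (at (q + of_int n, p) within strip)"
        using Gb[OF p] by blast
      have "\<forall>\<^sub>F x in near s q p. F x \<in> strip \<and> F x \<noteq> (q + of_int n, p)"
        using ev_dom by eventually_elim (metis F_in p strip_iff less_irrefl)
      with n have "filterlim F (at (q + of_int n, p) within strip) (near s q p)"
        by (simp add: filterlim_at)
      from filterlim_compose[OF m this] show ?thesis
        by (intro exI[of _ "n + m"]) (simp add: add.assoc)
    qed
    show "((\<lambda>x. H (fst x, F (0, snd x))) \<longlongrightarrow> 0) (near s q p)"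
      if p: "\<bar>p\<bar> = 1" for q p
    proof -
      obtain n :: int where n: "(F \<longlongrightarrow> (q + of_int n, p)) (near 0 q p)"
        using F_boundary[OF zero p] by blast
      have "((\<lambda>x. (0::real, snd x)) \<longlongrightarrow> (0, (q, p))) (near s q p)"
        by (auto intro!: tendsto_eq_intros)
      moreover have "\<forall>\<^sub>F x in near s q p. (0::real, snd x) \<in> cylinder \<and> (0, snd x) \<noteq> (0, (q, p))"
        using ev_dom by eventually_elim (use p in auto)
      ultimately have "filterlim (\<lambda>x. (0::real, snd x)) (near 0 q p) (near s q p)"
        by (simp add: filterlim_at)
      from filterlim_compose[OF n this]
      have "((\<lambda>x. F (0, snd x)) \<longlongrightarrow> (q + of_int n, p)) (near s q p)" .
      then have "((\<lambda>x. (fst x, F (0, snd x))) \<longlongrightarrow> (s, (q + of_int n, p))) (near s q p)"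
        by (auto intro!: tendsto_eq_intros)
      moreover have "\<forall>\<^sub>F x in near s q p. (fst x, F (0, snd x)) \<in> cylinder \<and>
          (fst x, F (0, snd x)) \<noteq> (s, (q + of_int n, p))"
        using ev_dom by eventually_elim (metis in_dom p mem_Sigma_iff strip_iff less_irrefl)
      ultimately have "filterlim (\<lambda>x. (fst x, F (0, snd x))) (near s (q + of_int n) p) (near s q p)"
        by (simp add: filterlim_at)
      from filterlim_compose[OF H_boundary[OF s p] this] show ?thesis .
    qed
    show "((\<lambda>r. G (0, F (r, z))) has_vector_derivative DG (F (s, z)) (V (s, z))) (at s within {0..1})"
      if z: "z \<in> strip" for z
    proof -
      have "((\<lambda>r. F (r, z)) has_derivative (\<lambda>h. h *\<^sub>R V (s, z))) (at s within {0..1})"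
        using V[OF s z] by (simp add: has_vector_derivative_def)
      from has_derivative_compose[OF this DG[OF F_strip[OF s z]]]
      show ?thesis
        using has_derivative_linear[OF DG[OF F_strip[OF s z]]]
        by (simp add: has_vector_derivative_def linear_scale)
    qed
    show "((\<lambda>y. H (fst (s, y), F (0, snd (s, y)))) has_derivative
        (\<lambda>w. - omega (DG (F (s, G (fst (s, y), F (0, snd (s, y))))) (V (s, G (fst (s, y), F (0, snd (s, y)))))) w)) (at y)"
      if y: "y \<in> strip" for y
    proof -
      have Fy: "F (0, y) \<in> strip" by (rule F_strip[OF zero y])
      have "((\<lambda>y. H (s, F (0, y))) has_derivative (\<lambda>w. - omega (V (s, G (s, F (0, y)))) (DF y w))) (at y)"
        by (rule has_derivative_compose[OF DF[OF y] dH[OF s Fy]])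
      \<comment> \<open>Applying the symplectic map \<open>DG\<close> to both slots cancels
        \<open>DF\<close> in the second one.\<close>
      moreover have "omega (V (s, G (s, F (0, y)))) (DF y w) = omega (DG (F (0, y)) (V (s, G (s, F (0, y))))) w" for w
        using G_sym[OF Fy, of _ "DF y w"] by (simp add: DGDF[OF y])
      ultimately show ?thesis by (simp add: FG[OF s Fy])
    qed
  qed
  then show thesis by (rule that)
qed

text \<open>The time-1 map is the time-0 map after the end point of the relative path; this relative
  end point is the right factor required by \<open>BM\<close>.\<close>

lemma strip_isotopy_endpoint_Ham:
  assumes iso: "strip_isotopy F G V H"
    and Gb: "\<And>q p. \<bar>p\<bar> = 1 \<Longrightarrow> \<exists>m::int. ((\<lambda>z. G (0, z)) \<longlongrightarrow> (q + of_int m, p)) (at (q, p) within strip)"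
  obtains \<phi> where "\<phi> \<in> Ham" "strip_isotopy.flow F 1 = compose annulus (strip_isotopy.flow F 0) \<phi>"
proof -
  interpret strip_isotopy F G V H by fact
  obtain V' where "strip_isotopy (\<lambda>x. G (0, F x)) (\<lambda>x. G (fst x, F (0, snd x))) V'
      (\<lambda>x. H (fst x, F (0, snd x)))"
    using strip_isotopy_relative[OF iso Gb] .
  then interpret R: strip_isotopy "\<lambda>x. G (0, F x)" "\<lambda>x. G (fst x, F (0, snd x))" V'
      "\<lambda>x. H (fst x, F (0, snd x))" .
  have "R.flow 0 = (\<lambda>z\<in>annulus. z)"
    unfolding R.flow_def by (rule restrict_ext) (simp add: GF)
  then have "R.flow 1 \<in> Ham"
    unfolding Ham_def hamiltonian_path_def using R.hamiltonian_path_with_flow by blast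
  moreover have "flow 1 = compose annulus (flow 0) (R.flow 1)"
    unfolding compose_def flow_def[of 1]
  proof (rule restrict_ext)
    fix c assume c: "c \<in> annulus"
    then show "cov (F (1, lft c)) = flow 0 (R.flow 1 c)"
      using R.flow_def by (simp add: flow_cov G_strip F_strip FG)
  qed
  ultimately show thesis by (rule that)
qed

section \<open>The generating function of the billiard ball map\<close>

text \<open>Removing the components along \<open>u\<close> from two plane vectors leaves the product
  of their normal components. Second derivatives of the chord length thus become products of two
  determinants whose signs convexity decides.\<close>

lemma unit_vector_inner_det2:
  fixes u a b :: "real^2"
  assumes "norm u = 1"
  shows "a \<bullet> b - (u \<bullet> a) * (u \<bullet> b) = det2 u a * det2 u b"
proof -
  have uu: "u $ 1 * u $ 1 + u $ 2 * u $ 2 = 1"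
    using assms by (simp add: norm_eq_sqrt_inner inner_vec2)
  have "det2 u a * det2 u b + (u \<bullet> a) * (u \<bullet> b) = (u $ 1 * u $ 1 + u $ 2 * u $ 2) * (a \<bullet> b)"
    by (simp add: det2_def inner_vec2 algebra_simps)
  with uu show ?thesis by simp
qed

text \<open>Points \<open>(s, (q, Q))\<close> with \<open>0 < Q - q < 1\<close> represent the oriented chords of the \<open>s\<close>-th table.\<close>

definition chords :: "(real \<times> (real \<times> real)) set" where
  "chords = {x. fst x \<in> {0..1} \<and> 0 < snd (snd x) - fst (snd x) \<and> snd (snd x) - fst (snd x) < 1}"

lemma chords_iff [simp]: "(s, (q, Q)) \<in> chords \<longleftrightarrow> s \<in> {0..1} \<and> 0 < Q - q \<and> Q - q < 1"
  by (simp add: chords_def)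

text \<open>The family of tables on the universal cover of the circle, with letters \<open>s\<close>
  and \<open>t\<close> naming partial derivatives. The same \<open>cst\<close> occurs in
  \<open>dcs\<close> and in \<open>dct\<close>: this encodes the symmetry of mixed derivatives up to
  the end points of \<open>{0..1}\<close>.\<close>

locale billiard_curves =
  fixes c cs ct css cst ctt :: "real \<times> real \<Rightarrow> real^2"
  assumes c_smooth: "smooth_on ({0..1} \<times> UNIV) c" and cs_smooth: "smooth_on ({0..1} \<times> UNIV) cs"
    and ct_smooth: "smooth_on ({0..1} \<times> UNIV) ct"
    and dc: "\<And>x. fst x \<in> {0..1} \<Longrightarrow>
      (c has_derivative (\<lambda>v. fst v *\<^sub>R cs x + snd v *\<^sub>R ct x)) (at x within {0..1} \<times> UNIV)"
    and dcs: "\<And>x. fst x \<in> {0..1} \<Longrightarrow>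
      (cs has_derivative (\<lambda>v. fst v *\<^sub>R css x + snd v *\<^sub>R cst x)) (at x within {0..1} \<times> UNIV)"
    and dct: "\<And>x. fst x \<in> {0..1} \<Longrightarrow>
      (ct has_derivative (\<lambda>v. fst v *\<^sub>R cst x + snd v *\<^sub>R ctt x)) (at x within {0..1} \<times> UNIV)"
    and c_per: "\<And>s t. c (s, t + 1) = c (s, t)"
    and norm_ct: "\<And>s t. s \<in> {0..1} \<Longrightarrow> norm (ct (s, t)) = 1"
    and convex: "\<And>s t T. s \<in> {0..1} \<Longrightarrow> 0 < T - t \<Longrightarrow> T - t < 1 \<Longrightarrow>
      0 < det2 (ct (s, t)) (c (s, T) - c (s, t))"
begin

section \<open>The chord length and its first two derivatives\<close>

definition chord :: "real \<times> (real \<times> real) \<Rightarrow> real^2" where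
  "chord x = c (fst x, snd (snd x)) - c (fst x, fst (snd x))"

definition u :: "real \<times> (real \<times> real) \<Rightarrow> real^2" where
  "u x = inverse (norm (chord x)) *\<^sub>R chord x"

text \<open>The momentum \<open>p\<close> at the start of a chord, as a function of its two ends;
  \<open>g\<close> below is the momentum \<open>P\<close> at its end.\<close>

definition f :: "real \<times> (real \<times> real) \<Rightarrow> real" where
  "f x = u x \<bullet> ct (fst x, fst (snd x))"

definition g :: "real \<times> (real \<times> real) \<Rightarrow> real" where
  "g x = u x \<bullet> ct (fst x, snd (snd x))"

text \<open>Minus the \<open>s\<close>-derivative of the chord length with both parameters held
  fixed: the Hamiltonian expressed on chords.\<close>

definition K :: "real \<times> (real \<times> real) \<Rightarrow> real" where
  "K x = - (u x \<bullet> (cs (fst x, snd (snd x)) - cs (fst x, fst (snd x))))"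

lemma c_t: "s \<in> {0..1} \<Longrightarrow> ((\<lambda>t. c (s, t)) has_vector_derivative ct (s, t)) (at t)"
  and c_s: "s \<in> {0..1} \<Longrightarrow> ((\<lambda>r. c (r, t)) has_vector_derivative cs (s, t)) (at s within {0..1})"
  using partials_vector_derivative[OF dc] by auto

lemma ct_per: assumes s: "s \<in> {0..1}" shows "ct (s, t + 1) = ct (s, t)"
proof -
  have "((\<lambda>t. t + 1 :: real) has_vector_derivative 1) (at t)"
    by (auto intro!: derivative_eq_intros)
  from vector_diff_chain_at[OF this c_t[OF s]]
  have "((\<lambda>t. c (s, t)) has_vector_derivative ct (s, t + 1)) (at t)"
    by (simp add: o_def c_per)
  then show ?thesis using vector_derivative_unique_at c_t[OF s] by blast
qed

lemma cs_per: assumes s: "s \<in> {0..1}" shows "cs (s, t + 1) = cs (s, t)"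
  using c_s[OF s, of "t + 1"] c_s[OF s, of t] s unfolding c_per
  by (intro vector_derivative_unique_within_closed_interval[of 0 1 s "\<lambda>r. c (r, t)"]) auto

lemma chord_nz: "x \<in> chords \<Longrightarrow> chord x \<noteq> 0"
  using convex[of "fst x" "snd (snd x)" "fst (snd x)"]
  by (auto simp: chord_def chords_def det2.zero_right)

lemma norm_u: "x \<in> chords \<Longrightarrow> norm (u x) = 1"
  by (simp add: u_def chord_nz)

lemma chord_smooth: "smooth_on chords chord"
  unfolding chord_def
  by (intro smooth_on_diff smooth_on_compose[OF c_smooth] smooth_on_Pair smooth_on_fst smooth_on_snd smooth_on_id)
    (auto simp: chords_def)

lemma u_smooth: "smooth_on chords u"
  unfolding u_def
  by (intro smooth_on_scaleR smooth_on_inverse smooth_on_norm chord_smooth) (auto simp: chord_nz)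

lemma f_smooth: "smooth_on chords f"
  unfolding f_def
  by (intro smooth_on_inner u_smooth smooth_on_compose[OF ct_smooth] smooth_on_Pair smooth_on_fst smooth_on_snd smooth_on_id)
    (auto simp: chords_def)

lemma g_smooth: "smooth_on chords g"
  unfolding g_def
  by (intro smooth_on_inner u_smooth smooth_on_compose[OF ct_smooth] smooth_on_Pair smooth_on_fst smooth_on_snd smooth_on_id)
    (auto simp: chords_def)

lemma K_smooth: "smooth_on chords K"
  unfolding K_def
  by (intro smooth_on_minus smooth_on_inner u_smooth smooth_on_diff smooth_on_compose[OF cs_smooth]
      smooth_on_Pair smooth_on_fst smooth_on_snd smooth_on_id) (auto simp: chords_def)

text \<open>The Hessian of the Euclidean norm at \<open>chord x\<close>. Its symmetry is what
  cancels the terms in \<open>generating_two_form\<close>.\<close>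

definition A :: "real \<times> (real \<times> real) \<Rightarrow> real^2 \<Rightarrow> real^2 \<Rightarrow> real" where
  "A x a b = inverse (norm (chord x)) * (a \<bullet> b - (u x \<bullet> a) * (u x \<bullet> b))"

lemma A_commute: "A x a b = A x b a"
  by (simp add: A_def inner_commute mult.commute)

text \<open>One chain rule for both ends of a chord: \<open>\<pi>\<close> is the projection to
  \<open>q\<close> or to \<open>Q\<close>.\<close>

lemma has_derivative_along:
  fixes k :: "real \<times> real \<Rightarrow> real^2" and \<pi> :: "real \<times> real \<Rightarrow> real"
  assumes "\<And>x. fst x \<in> {0..1} \<Longrightarrow>
      (k has_derivative (\<lambda>v. fst v *\<^sub>R ks x + snd v *\<^sub>R kt x)) (at x within {0..1} \<times> UNIV)"
    and \<pi>: "bounded_linear \<pi>" and x: "x \<in> chords"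
  shows "((\<lambda>x. k (fst x, \<pi> (snd x))) has_derivative
      (\<lambda>v. fst v *\<^sub>R ks (fst x, \<pi> (snd x)) + \<pi> (snd v) *\<^sub>R kt (fst x, \<pi> (snd x)))) (at x within chords)"
proof -
  let ?h = "\<lambda>x :: real \<times> (real \<times> real). (fst x, \<pi> (snd x))"
  have "(?h has_derivative ?h) (at x within chords)"
    by (intro has_derivative_Pair has_derivative_fst has_derivative_ident
        bounded_linear.has_derivative[OF \<pi>] has_derivative_snd)
  moreover have "(k has_derivative (\<lambda>v. fst v *\<^sub>R ks (?h x) + snd v *\<^sub>R kt (?h x))) (at (?h x) within ?h ` chords)"
    by (rule has_derivative_subset[OF assms(1)]) (use x in \<open>auto simp: chords_def\<close>)
  ultimately have "((\<lambda>x. k (?h x)) has_derivative (\<lambda>v. fst (?h v) *\<^sub>R ks (?h x) + snd (?h v) *\<^sub>R kt (?h x))) (at x within chords)"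
    by (rule has_derivative_in_compose)
  then show ?thesis by simp
qed

lemmas has_derivative_at_start = has_derivative_along[OF _ bounded_linear_fst]
lemmas has_derivative_at_end = has_derivative_along[OF _ bounded_linear_snd]

definition dchord :: "real \<times> (real \<times> real) \<Rightarrow> real \<times> (real \<times> real) \<Rightarrow> real^2" where
  "dchord x v = fst v *\<^sub>R (cs (fst x, snd (snd x)) - cs (fst x, fst (snd x)))
     + snd (snd v) *\<^sub>R ct (fst x, snd (snd x)) - fst (snd v) *\<^sub>R ct (fst x, fst (snd x))"

lemma chord_has_derivative:
  assumes "x \<in> chords"
  shows "(chord has_derivative dchord x) (at x within chords)"
proof -
  have "(chord has_derivative (\<lambda>v. (fst v *\<^sub>R cs (fst x, snd (snd x)) + snd (snd v) *\<^sub>R ct (fst x, snd (snd x)))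
      - (fst v *\<^sub>R cs (fst x, fst (snd x)) + fst (snd v) *\<^sub>R ct (fst x, fst (snd x))))) (at x within chords)"
    unfolding chord_def
    by (intro has_derivative_diff has_derivative_at_end[OF dc] has_derivative_at_start[OF dc] assms)
  then show ?thesis
    by (rule has_derivative_eq_rhs) (auto simp: dchord_def fun_eq_iff algebra_simps)
qed

lemma u_inner_has_derivative:
  assumes x: "x \<in> chords" and b: "(b has_derivative b') (at x within chords)"
  shows "((\<lambda>x. u x \<bullet> b x) has_derivative (\<lambda>v. A x (dchord x v) (b x) + u x \<bullet> b' v)) (at x within chords)"
proof -
  let ?n = "norm (chord x)"
  have nz: "?n \<noteq> 0" using chord_nz[OF x] by simp
  have "((\<lambda>x. norm (chord x)) has_derivative (\<lambda>v. sgn (chord x) \<bullet> dchord x v)) (at x within chords)"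
    using has_derivative_compose[OF chord_has_derivative[OF x] has_derivative_norm[OF chord_nz[OF x]]]
    by (simp add: inner_commute)
  moreover have "sgn (chord x) = u x" by (simp add: sgn_div_norm u_def)
  ultimately have n: "((\<lambda>x. norm (chord x)) has_derivative (\<lambda>v. u x \<bullet> dchord x v)) (at x within chords)"
    by simp
  have "((\<lambda>x. u x \<bullet> b x) has_derivative
      (\<lambda>v. u x \<bullet> b' v + (inverse ?n *\<^sub>R dchord x v + (- (inverse ?n * (u x \<bullet> dchord x v) * inverse ?n)) *\<^sub>R chord x) \<bullet> b x))
      (at x within chords)"
    unfolding u_def[of "_ :: real \<times> (real \<times> real)"]
    by (rule has_derivative_inner[OF has_derivative_scaleR[OF Deriv.has_derivative_inverse[OF nz n[unfolded u_def]] chord_has_derivative[OF x]] b])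
  moreover have "(inverse ?n *\<^sub>R dchord x v + (- (inverse ?n * (u x \<bullet> dchord x v) * inverse ?n)) *\<^sub>R chord x) \<bullet> b x
      = A x (dchord x v) (b x)" for v
  proof -
    have "(inverse ?n *\<^sub>R chord x) \<bullet> b x = u x \<bullet> b x" by (simp add: u_def)
    then have "inverse ?n * (chord x \<bullet> b x) = u x \<bullet> b x" by simp
    then show ?thesis by (simp add: A_def inner_add_left inner_diff_left algebra_simps)
  qed
  ultimately show ?thesis by (simp add: add.commute)
qed

lemma A_dchord: "A x (dchord x v) b =
    fst v * A x (cs (fst x, snd (snd x)) - cs (fst x, fst (snd x))) b
    + snd (snd v) * A x (ct (fst x, snd (snd x))) b - fst (snd v) * A x (ct (fst x, fst (snd x))) b"
  unfolding A_def dchord_def by (simp add: inner_simps algebra_simps)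

definition df :: "real \<times> (real \<times> real) \<Rightarrow> real \<times> (real \<times> real) \<Rightarrow> real" where
  "df x v = A x (dchord x v) (ct (fst x, fst (snd x)))
     + u x \<bullet> (fst v *\<^sub>R cst (fst x, fst (snd x)) + fst (snd v) *\<^sub>R ctt (fst x, fst (snd x)))"

definition dg :: "real \<times> (real \<times> real) \<Rightarrow> real \<times> (real \<times> real) \<Rightarrow> real" where
  "dg x v = A x (dchord x v) (ct (fst x, snd (snd x)))
     + u x \<bullet> (fst v *\<^sub>R cst (fst x, snd (snd x)) + snd (snd v) *\<^sub>R ctt (fst x, snd (snd x)))"

definition dK :: "real \<times> (real \<times> real) \<Rightarrow> real \<times> (real \<times> real) \<Rightarrow> real" where
  "dK x v = - (A x (dchord x v) (cs (fst x, snd (snd x)) - cs (fst x, fst (snd x)))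
     + u x \<bullet> ((fst v *\<^sub>R css (fst x, snd (snd x)) + snd (snd v) *\<^sub>R cst (fst x, snd (snd x)))
        - (fst v *\<^sub>R css (fst x, fst (snd x)) + fst (snd v) *\<^sub>R cst (fst x, fst (snd x)))))"

lemma f_has_derivative: "x \<in> chords \<Longrightarrow> (f has_derivative df x) (at x within chords)"
  unfolding f_def df_def by (intro u_inner_has_derivative has_derivative_at_start[OF dct])

lemma g_has_derivative: "x \<in> chords \<Longrightarrow> (g has_derivative dg x) (at x within chords)"
  unfolding g_def dg_def by (intro u_inner_has_derivative has_derivative_at_end[OF dct])

lemma K_has_derivative: "x \<in> chords \<Longrightarrow> (K has_derivative dK x) (at x within chords)"
  unfolding K_def dK_def
  by (intro has_derivative_minus u_inner_has_derivative has_derivative_diff has_derivative_at_end[OF dcs]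
      has_derivative_at_start[OF dcs])

text \<open>With \<open>h\<close> the length of the chord, \<open>dh = g dQ - f dq - K ds\<close>; this is \<open>ddh = 0\<close>.\<close>

lemma generating_two_form:
  "dg x v * snd (snd w) - snd (snd v) * dg x w - (df x v * fst (snd w) - fst (snd v) * df x w)
    = dK x v * fst w - fst v * dK x w"
proof -
  have comm: "A x (ct (fst x, snd (snd x))) (ct (fst x, fst (snd x)))
      = A x (ct (fst x, fst (snd x))) (ct (fst x, snd (snd x)))"
    "A x (ct (fst x, snd (snd x))) (cs (fst x, snd (snd x)) - cs (fst x, fst (snd x)))
      = A x (cs (fst x, snd (snd x)) - cs (fst x, fst (snd x))) (ct (fst x, snd (snd x)))"
    "A x (ct (fst x, fst (snd x))) (cs (fst x, snd (snd x)) - cs (fst x, fst (snd x)))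
      = A x (cs (fst x, snd (snd x)) - cs (fst x, fst (snd x))) (ct (fst x, fst (snd x)))"
    by (rule A_commute)+
  show ?thesis
    unfolding df_def dg_def dK_def A_dchord comm by (simp add: inner_simps algebra_simps)
qed

lemma det_start: "x \<in> chords \<Longrightarrow> det2 (u x) (ct (fst x, fst (snd x))) < 0"
proof -
  assume x: "x \<in> chords"
  then have "0 < det2 (ct (fst x, fst (snd x))) (chord x)"
    unfolding chord_def using convex by (auto simp: chords_def)
  moreover have "det2 (u x) (ct (fst x, fst (snd x))) = - (inverse (norm (chord x)) * det2 (ct (fst x, fst (snd x))) (chord x))"
    by (simp add: u_def det2_def algebra_simps)
  ultimately show ?thesis using chord_nz[OF x] by simp
qed

lemma det_end: "x \<in> chords \<Longrightarrow> 0 < det2 (u x) (ct (fst x, snd (snd x)))"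
proof -
  assume x: "x \<in> chords"
  \<comment> \<open>Seen from \<open>Q\<close>, the other end lies ahead at parameter
    \<open>q + 1\<close>, at distance less than 1, so \<open>convex\<close> applies in this
    order.\<close>
  then have "0 < det2 (ct (fst x, snd (snd x))) (c (fst x, fst (snd x) + 1) - c (fst x, snd (snd x)))"
    by (intro convex) (auto simp: chords_def)
  then have "0 < det2 (ct (fst x, snd (snd x))) (- chord x)"
    by (simp add: chord_def c_per)
  moreover have "det2 (u x) (ct (fst x, snd (snd x))) = inverse (norm (chord x)) * det2 (ct (fst x, snd (snd x))) (- chord x)"
    by (simp add: u_def det2_def algebra_simps)
  ultimately show ?thesis using chord_nz[OF x] by simp
qed

lemma abs_inner_less_1:
  assumes x: "x \<in> chords" and b: "norm b = 1" and d: "det2 (u x) b \<noteq> 0"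
  shows "\<bar>u x \<bullet> b\<bar> < 1"
proof -
  have "b \<bullet> b = 1" using b by (simp add: norm_eq_sqrt_inner)
  then have "1 - (u x \<bullet> b)\<^sup>2 = (det2 (u x) b)\<^sup>2"
    using unit_vector_inner_det2[OF norm_u[OF x], of b b] by (simp add: power2_eq_square)
  then have "(u x \<bullet> b)\<^sup>2 < 1" using d by (metis diff_gt_0_iff_gt zero_less_power2)
  then show ?thesis by (simp add: abs_square_less_1)
qed

lemma abs_f: "x \<in> chords \<Longrightarrow> \<bar>f x\<bar> < 1" and abs_g: "x \<in> chords \<Longrightarrow> \<bar>g x\<bar> < 1"
  unfolding f_def g_def using det_start[of x] det_end[of x] norm_ct
  by (auto intro!: abs_inner_less_1 simp: chords_def)

text \<open>The twist condition: the derivative is \<open>A\<close> on the two tangents, that is the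
  product of \<open>det_start\<close> and \<open>det_end\<close> divided by the chord length, and
  these have opposite signs.\<close>

lemma f_deriv_end:
  assumes s: "s \<in> {0..1}" and r: "0 < r" "r < 1"
  shows "\<exists>D<0. ((\<lambda>r. f (s, (q, q + r))) has_real_derivative D) (at r)"
proof (intro exI conjI)
  let ?x = "(s, (q, q + r))"
  have x: "?x \<in> chords" using s r by simp
  have "df ?x (0, (0, 1)) = A ?x (ct (s, q + r)) (ct (s, q))"
    by (simp add: df_def A_dchord)
  also have "\<dots> = inverse (norm (chord ?x)) * (det2 (u ?x) (ct (s, q + r)) * det2 (u ?x) (ct (s, q)))"
    unfolding A_def unit_vector_inner_det2[OF norm_u[OF x]] ..
  also have "\<dots> < 0"
    using det_start[OF x] det_end[OF x] chord_nz[OF x] by (simp add: mult_pos_neg)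
  finally show "df ?x (0, (0, 1)) < 0" .
  have "((\<lambda>r. (s, (q, q + r))) has_derivative (\<lambda>h. (0, (0, h)))) (at r within {0<..<1})"
    by (auto intro!: derivative_eq_intros)
  moreover have "(f has_derivative df ?x) (at ?x within (\<lambda>r. (s, (q, q + r))) ` {0<..<1})"
    by (rule has_derivative_subset[OF f_has_derivative[OF x]]) (use s in auto)
  ultimately have "((\<lambda>r. f (s, (q, q + r))) has_derivative (\<lambda>h. df ?x (0, (0, h)))) (at r within {0<..<1})"
    by (rule has_derivative_in_compose)
  then have "((\<lambda>r. f (s, (q, q + r))) has_derivative (\<lambda>h. df ?x (0, (0, h)))) (at r)"
    using r at_within_open[of r "{0<..<1}"] by simp
  moreover have "(\<lambda>h. df ?x (0, (0, h))) = (*) (df ?x (0, (0, 1)))"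
    by (auto simp: df_def A_dchord mult.commute)
  ultimately show "((\<lambda>r. f (s, (q, q + r))) has_real_derivative df ?x (0, (0, 1))) (at r)"
    by (simp add: has_field_derivative_def)
qed

section \<open>Solving for the end point of a chord with given initial momentum\<close>

lemma f_strict_anti:
  assumes "s \<in> {0..1}" "0 < a" "a < b" "b < 1"
  shows "f (s, (q, q + b)) < f (s, (q, q + a))"
proof (rule DERIV_neg_imp_decreasing[OF assms(3)])
  fix x assume "a \<le> x" "x \<le> b"
  then show "\<exists>y. ((\<lambda>r. f (s, (q, q + r))) has_real_derivative y) (at x) \<and> y < 0"
    using f_deriv_end[OF assms(1), of x q] assms by auto
qed

text \<open>Dividing by \<open>h\<close> before normalizing gives the same limit from both sides.
  Positive \<open>h\<close> describes short chords with \<open>Q\<close> near \<open>q\<close>,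
  negative \<open>h\<close> those with \<open>Q\<close> near \<open>q + 1\<close>.\<close>

lemma direction_limit:
  assumes s: "s \<in> {0..1}"
  shows "((\<lambda>h. sgn (inverse h *\<^sub>R (c (s, q + h) - c (s, q))) \<bullet> ct (s, q)) \<longlongrightarrow> 1) (at 0)"
proof -
  have "((\<lambda>h. inverse h *\<^sub>R (c (s, q + h) - c (s, q))) \<longlongrightarrow> ct (s, q)) (at 0)"
  proof -
    have "((\<lambda>h. norm (c (s, q + h) - c (s, q) - h *\<^sub>R ct (s, q)) / norm h) \<longlongrightarrow> 0) (at 0)"
      using c_t[OF s, of q] unfolding has_vector_derivative_def has_derivative_at by simp
    moreover have "norm (c (s, q + h) - c (s, q) - h *\<^sub>R ct (s, q)) / norm h =
        norm (inverse h *\<^sub>R (c (s, q + h) - c (s, q)) - ct (s, q))" if "h \<noteq> 0" for h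
    proof -
      have "inverse h *\<^sub>R (c (s, q + h) - c (s, q)) - ct (s, q) =
          inverse h *\<^sub>R (c (s, q + h) - c (s, q) - h *\<^sub>R ct (s, q))"
        using that by (simp add: scaleR_diff_right)
      then show ?thesis by (simp add: divide_inverse mult.commute abs_inverse)
    qed
    then have "\<forall>\<^sub>F h in at 0. norm (c (s, q + h) - c (s, q) - h *\<^sub>R ct (s, q)) / norm h =
        norm (inverse h *\<^sub>R (c (s, q + h) - c (s, q)) - ct (s, q))"
      by (simp add: eventually_at_filter)
    ultimately have "((\<lambda>h. norm (inverse h *\<^sub>R (c (s, q + h) - c (s, q)) - ct (s, q))) \<longlongrightarrow> 0) (at 0)"
      by (rule Lim_transform_eventually)
    then show ?thesis by (rule LIM_zero_cancel[OF tendsto_norm_zero_cancel])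
  qed
  moreover have "ct (s, q) \<noteq> 0" using norm_ct[OF s, of q] by auto
  ultimately have "((\<lambda>h. sgn (inverse h *\<^sub>R (c (s, q + h) - c (s, q))) \<bullet> ct (s, q)) \<longlongrightarrow> sgn (ct (s, q)) \<bullet> ct (s, q)) (at 0)"
    by (intro tendsto_intros)
  moreover have "sgn (ct (s, q)) \<bullet> ct (s, q) = 1"
    using norm_ct[OF s, of q] by (simp add: sgn_div_norm norm_eq_sqrt_inner)
  ultimately show ?thesis by simp
qed

lemma u_eq_sgn: "u x = sgn (chord x)"
  by (simp add: u_def sgn_div_norm)

lemma f_limits:
  assumes s: "s \<in> {0..1}" and p: "\<bar>p\<bar> < 1"
  shows "\<exists>r. 0 < r \<and> r < 1 \<and> p < f (s, (q, q + r))" "\<exists>r. 0 < r \<and> r < 1 \<and> f (s, (q, q + r)) < p"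
proof -
  have "\<forall>\<^sub>F h in at 0. p < sgn (inverse h *\<^sub>R (c (s, q + h) - c (s, q))) \<bullet> ct (s, q)"
    "\<forall>\<^sub>F h in at 0. - p < sgn (inverse h *\<^sub>R (c (s, q + h) - c (s, q))) \<bullet> ct (s, q)"
    using direction_limit[OF s, of q] p by (auto intro: order_tendstoD)
  then obtain d d' where d: "d > 0" "\<And>h. h \<noteq> 0 \<Longrightarrow> \<bar>h\<bar> < d \<Longrightarrow> p < sgn (inverse h *\<^sub>R (c (s, q + h) - c (s, q))) \<bullet> ct (s, q)"
    and d': "d' > 0" "\<And>h. h \<noteq> 0 \<Longrightarrow> \<bar>h\<bar> < d' \<Longrightarrow> - p < sgn (inverse h *\<^sub>R (c (s, q + h) - c (s, q))) \<bullet> ct (s, q)"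
    unfolding eventually_at by (auto simp: dist_real_def)
  define r where "r = min (d / 2) (1 / 2)"
  have r: "0 < r" "r < 1" "r < d" using d(1) by (auto simp: r_def)
  have "f (s, (q, q + r)) = sgn (inverse r *\<^sub>R (c (s, q + r) - c (s, q))) \<bullet> ct (s, q)"
    using r by (simp add: f_def u_eq_sgn chord_def sgn_scaleR)
  then show "\<exists>r. 0 < r \<and> r < 1 \<and> p < f (s, (q, q + r))"
    using r d(2)[of r] by (intro exI[of _ r]) simp
  \<comment> \<open>The end point \<open>q + 1 + h\<close> lies just behind \<open>q\<close> on the
    curve. As \<open>h\<close> is negative, its sign reverses the normalized direction, and
    \<open>f\<close> comes close to \<open>-1\<close>.\<close>
  define h where "h = - min (d' / 2) (1 / 2)"
  have h: "h < 0" "- 1 < h" "- h < d'" using d'(1) by (auto simp: h_def)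
  have "c (s, q + (1 + h)) = c (s, q + h)" using c_per[of s "q + h"] by (simp add: algebra_simps)
  then have "f (s, (q, q + (1 + h))) = - (sgn (inverse h *\<^sub>R (c (s, q + h) - c (s, q))) \<bullet> ct (s, q))"
    using h by (simp add: f_def u_eq_sgn chord_def sgn_scaleR)
  then show "\<exists>r. 0 < r \<and> r < 1 \<and> f (s, (q, q + r)) < p"
    using h d'(2)[of h] by (intro exI[of _ "1 + h"]) simp
qed

text \<open>The difference \<open>Q - q\<close> is used in place of \<open>Q\<close>: it ranges in
  the fixed interval between 0 and 1, as \<open>smooth_on_implicit\<close> requires, and is periodic
  in \<open>q\<close>.\<close>

definition gap :: "real \<times> (real \<times> real) \<Rightarrow> real" where
  "gap x = (THE r. 0 < r \<and> r < 1 \<and> f (fst x, (fst (snd x), fst (snd x) + r)) = snd (snd x))"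

lemma gap_unique:
  assumes "s \<in> {0..1}" "0 < r" "r < 1" "f (s, (q, q + r)) = p"
  shows "gap (s, (q, p)) = r"
  unfolding gap_def
proof (rule the_equality)
  fix r' assume "0 < r' \<and> r' < 1 \<and> f (fst (s, (q, p)), (fst (snd (s, (q, p))), fst (snd (s, (q, p))) + r')) = snd (snd (s, (q, p)))"
  then show "r' = r"
    using f_strict_anti[OF assms(1), of r r' q] f_strict_anti[OF assms(1), of r' r q] assms
    by (cases r r' rule: linorder_cases) auto
qed (use assms in auto)

lemma gap:
  assumes s: "s \<in> {0..1}" and p: "\<bar>p\<bar> < 1"
  shows "0 < gap (s, (q, p))" "gap (s, (q, p)) < 1" "f (s, (q, q + gap (s, (q, p)))) = p"
proof -
  obtain a where a: "0 < a" "a < 1" "p < f (s, (q, q + a))" using f_limits[OF s p] by blast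
  obtain b where b: "0 < b" "b < 1" "f (s, (q, q + b)) < p" using f_limits[OF s p] by blast
  have "a < b" using f_strict_anti[OF s, of b a q] a b by (cases a b rule: linorder_cases) auto
  moreover have "continuous_on {a..b} (\<lambda>r. f (s, (q, q + r)))"
    using a b s by (intro continuous_on_compose2[OF smooth_on_imp_continuous_on[OF f_smooth]] continuous_intros) auto
  ultimately obtain r where r: "a \<le> r" "r \<le> b" "f (s, (q, q + r)) = p"
    using IVT2'[of "\<lambda>r. f (s, (q, q + r))" b p a] a b by auto
  then have "gap (s, (q, p)) = r" using a b by (intro gap_unique s) auto
  with r a b show "0 < gap (s, (q, p))" "gap (s, (q, p)) < 1" "f (s, (q, q + gap (s, (q, p)))) = p"
    by auto
qed

text \<open>The equation is written as \<open>p - f = 0\<close>, because \<open>f\<close> decreases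
  in the gap and \<open>smooth_on_implicit\<close> expects an increasing function.\<close>

lemma gap_smooth: "smooth_on cylinder gap"
proof (rule smooth_on_implicit[where I = "{0<..<1}"
      and E = "\<lambda>w. snd (snd (fst w)) - f (fst (fst w), (fst (snd (fst w)), fst (snd (fst w)) + snd w))"])
  show "smooth_on (cylinder \<times> {0<..<1})
      (\<lambda>w. snd (snd (fst w)) - f (fst (fst w), (fst (snd (fst w)), fst (snd (fst w)) + snd w)))"
    by (intro smooth_on_diff smooth_on_compose[OF f_smooth] smooth_on_Pair smooth_on_add smooth_on_fst smooth_on_snd smooth_on_id)
      auto
  fix x :: "real \<times> (real \<times> real)" and t :: real
  assume x: "x \<in> cylinder"
  obtain s q p where sqp: "x = (s, (q, p))" by (metis prod.collapse)
  with x have s: "s \<in> {0..1}" and p: "\<bar>p\<bar> < 1" by auto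
  show "gap x \<in> {0<..<1} \<and> snd (snd (fst (x, gap x))) -
      f (fst (fst (x, gap x)), (fst (snd (fst (x, gap x))), fst (snd (fst (x, gap x))) + snd (x, gap x))) = 0"
    using gap[OF s p] by (simp add: sqp)
  assume t: "t \<in> {0<..<1}"
  obtain D where "D < 0" "((\<lambda>r. f (s, (q, q + r))) has_real_derivative D) (at t)"
    using f_deriv_end[OF s, of t q] t by auto
  then show "\<exists>D>0. ((\<lambda>t. snd (snd (fst (x, t))) -
      f (fst (fst (x, t)), (fst (snd (fst (x, t))), fst (snd (fst (x, t))) + snd (x, t)))) has_real_derivative D) (at t)"
    by (intro exI[of _ "- D"]) (auto simp: sqp intro!: derivative_eq_intros)
qed (auto simp: is_interval_oo)

end

lemma fat_cylinder: "fat cylinder"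
  by (intro fat_Times fat_Icc fat_open open_strip)

lemma omega_simp [simp]: "omega (a, b) (a', b') = b * a' - a * b'" "omega 0 w = 0"
  by (simp_all add: omega_def)

text \<open>Transfers boundary limits of \<open>F\<close> to \<open>G\<close> and \<open>H\<close>,
  which evaluate \<open>F\<close> at the reflected momentum.\<close>

lemma filterlim_reflect:
  assumes "\<bar>p\<bar> = 1"
  shows "filterlim (\<lambda>x. (fst x, (fst (snd x), - snd (snd x)))) (near s q (- p))
    (near s q p)"
proof -
  have "((\<lambda>x. (fst x, (fst (snd x), - snd (snd x)))) \<longlongrightarrow> (s, (q, - p))) (near s q p)"
    by (auto intro!: tendsto_eq_intros)
  moreover have "\<forall>\<^sub>F x in near s q p.
      (fst x, (fst (snd x), - snd (snd x))) \<in> cylinder \<and> (fst x, (fst (snd x), - snd (snd x))) \<noteq> (s, (q, - p))"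
    unfolding eventually_at_filter by (intro always_eventually) (use assms in auto)
  ultimately show ?thesis by (simp add: filterlim_at)
qed

context billiard_curves
begin

definition Q :: "real \<times> (real \<times> real) \<Rightarrow> real" where
  "Q x = fst (snd x) + gap x"

definition \<Phi> :: "real \<times> (real \<times> real) \<Rightarrow> real \<times> (real \<times> real)" where
  "\<Phi> x = (fst x, (fst (snd x), Q x))"

definition F :: "real \<times> (real \<times> real) \<Rightarrow> real \<times> real" where
  "F x = (Q x, g (\<Phi> x))"

text \<open>Reversing the direction of the trajectory inverts the billiard ball map.\<close>

definition G :: "real \<times> (real \<times> real) \<Rightarrow> real \<times> real" where
  "G x = (let y = F (fst x, (fst (snd x), - snd (snd x))) in (fst y - 1, - snd y))"

text \<open>The point is regarded as the end of its chord, whose start is the first coordinate of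
  \<open>G x\<close>; so \<open>H\<close> composed with the billiard map is \<open>K\<close> on the
  outgoing chord.\<close>

definition H :: "real \<times> (real \<times> real) \<Rightarrow> real" where
  "H x = K (fst x, (fst (G x), fst (snd x)))"

section \<open>The lifted billiard ball map and its inverse\<close>

lemma \<Phi>_in: "x \<in> cylinder \<Longrightarrow> \<Phi> x \<in> chords"
  using gap(1,2) by (cases x) (auto simp: \<Phi>_def Q_def)

lemma f_\<Phi>: "x \<in> cylinder \<Longrightarrow> f (\<Phi> x) = snd (snd x)"
  using gap(3) by (cases x) (auto simp: \<Phi>_def Q_def)

lemma F_eqI:
  assumes "s \<in> {0..1}" "0 < Q' - q" "Q' - q < 1" "f (s, (q, Q')) = p"
  shows "F (s, (q, p)) = (Q', g (s, (q, Q')))"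
  using gap_unique[of s "Q' - q" q p] assms by (simp add: F_def \<Phi>_def Q_def)

lemma u_reverse: "u (s, (Q', q + 1)) = - u (s, (q, Q'))"
proof -
  have "chord (s, (Q', q + 1)) = - chord (s, (q, Q'))" by (simp add: chord_def c_per)
  then show ?thesis by (simp add: u_def)
qed

lemma f_reverse: "f (s, (Q', q + 1)) = - g (s, (q, Q'))"
  by (simp add: f_def g_def u_reverse)

lemma g_reverse: "s \<in> {0..1} \<Longrightarrow> g (s, (Q', q + 1)) = - f (s, (q, Q'))"
  by (simp add: f_def g_def u_reverse ct_per)

lemma u_shift: "u (s, (q + 1, Q' + 1)) = u (s, (q, Q'))"
  by (simp add: u_def chord_def c_per)

lemma fgK_shift:
  assumes "s \<in> {0..1}"
  shows "f (s, (q + 1, Q' + 1)) = f (s, (q, Q'))" "g (s, (q + 1, Q' + 1)) = g (s, (q, Q'))"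
    "K (s, (q + 1, Q' + 1)) = K (s, (q, Q'))"
  using assms by (simp_all add: f_def g_def K_def u_shift ct_per cs_per)

lemma F_strip: assumes "s \<in> {0..1}" "z \<in> strip" shows "F (s, z) \<in> strip"
  using abs_g[OF \<Phi>_in, of "(s, z)"] assms by (simp add: F_def)

lemma G_eq: "G (s, (q, p)) = (fst (F (s, (q, - p))) - 1, - snd (F (s, (q, - p))))"
  by (simp add: G_def Let_def)

lemma G_strip: assumes "s \<in> {0..1}" "z \<in> strip" shows "G (s, z) \<in> strip"
proof -
  obtain q p where z: "z = (q, p)" by fastforce
  then have "F (s, (q, - p)) \<in> strip" using assms by (intro F_strip) auto
  then show ?thesis by (cases "F (s, (q, - p))") (simp add: z G_eq)
qed

lemma GF: assumes s: "s \<in> {0..1}" and z: "z \<in> strip" shows "G (s, F (s, z)) = z"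
proof -
  obtain q p where qp: "z = (q, p)" by fastforce
  let ?Q = "Q (s, z)"
  have ch: "(s, (q, ?Q)) \<in> chords" and fp: "f (s, (q, ?Q)) = p"
    using \<Phi>_in[of "(s, z)"] f_\<Phi>[of "(s, z)"] s z by (auto simp: \<Phi>_def qp)
  have "F (s, z) = (?Q, g (s, (q, ?Q)))" by (simp add: F_def \<Phi>_def qp)
  \<comment> \<open>The reversed chord starts at \<open>Q\<close>, so its end has the representative
    \<open>q + 1\<close> in the admissible range. This explains the subtraction of 1 in
    \<open>G\<close>.\<close>
  moreover have "F (s, (?Q, - g (s, (q, ?Q)))) = (q + 1, g (s, (?Q, q + 1)))"
    using ch by (intro F_eqI s) (auto simp: f_reverse)
  ultimately show ?thesis using fp by (simp add: G_eq g_reverse[OF s] qp)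
qed

lemma FG: assumes s: "s \<in> {0..1}" and z: "z \<in> strip" shows "F (s, G (s, z)) = z"
proof -
  obtain q p where qp: "z = (q, p)" by fastforce
  let ?Q = "Q (s, (q, - p))"
  have ch: "(s, (q, ?Q)) \<in> chords" and fp: "f (s, (q, ?Q)) = - p"
    using \<Phi>_in[of "(s, (q, - p))"] f_\<Phi>[of "(s, (q, - p))"] s z by (auto simp: \<Phi>_def qp)
  have "G (s, z) = (?Q - 1, - g (s, (q, ?Q)))" by (simp add: G_eq F_def \<Phi>_def qp)
  moreover have "F (s, (?Q - 1, - g (s, (q, ?Q)))) = (q, g (s, (?Q - 1, q)))"
    using ch g_reverse[OF s, of q "?Q - 1"] by (intro F_eqI s) auto
  moreover have "g (s, (?Q - 1, q)) = p"
    using f_reverse[of s q "?Q - 1"] fp by simp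
  ultimately show ?thesis by (simp add: qp)
qed

lemma gap_shift: assumes "s \<in> {0..1}" "\<bar>p\<bar> < 1" shows "gap (s, (q + 1, p)) = gap (s, (q, p))"
proof (rule gap_unique)
  show "f (s, (q + 1, q + 1 + gap (s, (q, p)))) = p"
    using fgK_shift(1)[OF assms(1), of q "q + gap (s, (q, p))"] gap(3)[OF assms, of q]
    by (simp add: algebra_simps)
qed (use gap assms in auto)

lemma F_shift: assumes "s \<in> {0..1}" "\<bar>p\<bar> < 1" shows "F (s, (q + 1, p)) = F (s, (q, p)) + (1, 0)"
proof -
  have "Q (s, (q + 1, p)) = Q (s, (q, p)) + 1" by (simp add: Q_def gap_shift[OF assms])
  then show ?thesis by (simp add: F_def \<Phi>_def fgK_shift[OF assms(1)])
qed

lemma H_shift: assumes "s \<in> {0..1}" "\<bar>p\<bar> < 1" shows "H (s, (q + 1, p)) = H (s, (q, p))"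
proof -
  have "fst (G (s, (q + 1, p))) = fst (G (s, (q, p))) + 1"
    using F_shift[of s "- p" q] assms by (simp add: G_eq)
  then show ?thesis by (simp add: H_def fgK_shift[OF assms(1)])
qed

lemma Q_smooth: "smooth_on cylinder Q"
  unfolding Q_def by (intro smooth_on_add gap_smooth smooth_on_fst smooth_on_snd smooth_on_id)

lemma \<Phi>_smooth: "smooth_on cylinder \<Phi>"
  unfolding \<Phi>_def by (intro smooth_on_Pair Q_smooth smooth_on_fst smooth_on_snd smooth_on_id)

lemma F_smooth: "smooth_on cylinder F"
  unfolding F_def by (intro smooth_on_Pair Q_smooth smooth_on_compose[OF g_smooth \<Phi>_smooth] \<Phi>_in)

lemma G_smooth: "smooth_on cylinder G"
proof -
  have "smooth_on cylinder (\<lambda>x. F (fst x, (fst (snd x), - snd (snd x))))"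
    by (rule smooth_on_compose[OF F_smooth])
      (auto intro!: smooth_on_Pair smooth_on_minus smooth_on_fst smooth_on_snd smooth_on_id)
  then show ?thesis
    unfolding G_def Let_def by (intro smooth_on_Pair smooth_on_diff smooth_on_minus smooth_on_const smooth_on_fst smooth_on_snd)
qed

lemma chord_G: assumes "x \<in> cylinder" shows "(fst x, (fst (G x), fst (snd x))) \<in> chords"
proof -
  obtain s q p where x: "x = (s, (q, p))" by (metis prod.collapse)
  then show ?thesis using gap(1,2)[of s "- p" q] assms by (auto simp: G_eq F_def Q_def)
qed

lemma H_smooth: "smooth_on cylinder H"
  unfolding H_def
  by (rule smooth_on_compose[OF K_smooth _ chord_G])
    (intro smooth_on_Pair G_smooth smooth_on_fst smooth_on_snd smooth_on_id)

section \<open>Symplecticity and Hamilton's equation\<close>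

definition DQ :: "real \<times> (real \<times> real) \<Rightarrow> real \<times> (real \<times> real) \<Rightarrow> real" where
  "DQ x = (SOME D. (Q has_derivative D) (at x within cylinder))"

definition D\<Phi> :: "real \<times> (real \<times> real) \<Rightarrow> real \<times> (real \<times> real) \<Rightarrow> real \<times> (real \<times> real)" where
  "D\<Phi> x v = (fst v, (fst (snd v), DQ x v))"

definition DF :: "real \<times> (real \<times> real) \<Rightarrow> real \<times> (real \<times> real) \<Rightarrow> real \<times> real" where
  "DF x v = (DQ x v, dg (\<Phi> x) (D\<Phi> x v))"

definition V :: "real \<times> (real \<times> real) \<Rightarrow> real \<times> real" where
  "V x = DF x (1, 0)"

lemma Q_has_derivative: assumes "x \<in> cylinder" shows "(Q has_derivative DQ x) (at x within cylinder)"
proof -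
  obtain D where "\<And>x. x \<in> cylinder \<Longrightarrow> (Q has_derivative D x) (at x within cylinder)"
    using smooth_on_derivative[OF fat_cylinder Q_smooth] by metis
  with assms show ?thesis
    unfolding DQ_def using someI[of "\<lambda>D. (Q has_derivative D) (at x within cylinder)"] by blast
qed

lemma \<Phi>_has_derivative: assumes "x \<in> cylinder" shows "(\<Phi> has_derivative D\<Phi> x) (at x within cylinder)"
  unfolding \<Phi>_def D\<Phi>_def
  by (intro has_derivative_Pair has_derivative_fst has_derivative_snd has_derivative_ident Q_has_derivative assms)

lemma has_derivative_\<Phi>_compose:
  assumes x: "x \<in> cylinder" and k: "\<And>y. y \<in> chords \<Longrightarrow> (k has_derivative k' y) (at y within chords)"
  shows "((\<lambda>x. k (\<Phi> x)) has_derivative (\<lambda>v. k' (\<Phi> x) (D\<Phi> x v))) (at x within cylinder)"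
  by (rule has_derivative_in_compose[OF \<Phi>_has_derivative[OF x] has_derivative_subset[OF k]])
    (use \<Phi>_in x in auto)

lemma F_has_derivative: "x \<in> cylinder \<Longrightarrow> (F has_derivative DF x) (at x within cylinder)"
  unfolding F_def DF_def
  by (intro has_derivative_Pair Q_has_derivative has_derivative_\<Phi>_compose g_has_derivative)

lemma df_D\<Phi>: assumes x: "x \<in> cylinder" shows "df (\<Phi> x) (D\<Phi> x v) = snd (snd v)"
proof -
  have "((\<lambda>x. f (\<Phi> x)) has_derivative (\<lambda>v. df (\<Phi> x) (D\<Phi> x v))) (at x within cylinder)"
    by (rule has_derivative_\<Phi>_compose[OF x f_has_derivative])
  then have "((\<lambda>x. snd (snd x)) has_derivative (\<lambda>v. df (\<Phi> x) (D\<Phi> x v))) (at x within cylinder)"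
    by (rule has_derivative_transform[rotated 2]) (auto simp: x f_\<Phi>)
  moreover have "((\<lambda>x :: real \<times> (real \<times> real). snd (snd x)) has_derivative (\<lambda>v. snd (snd v))) (at x within cylinder)"
    by (intro has_derivative_snd has_derivative_ident)
  ultimately have "(\<lambda>v. df (\<Phi> x) (D\<Phi> x v)) = (\<lambda>v. snd (snd v))"
    by (rule fat_derivative_unique[OF fat_cylinder x])
  then show ?thesis by metis
qed

text \<open>\<open>generating_two_form\<close> pulled back by \<open>\<Phi>\<close>; there
  \<open>f\<close> becomes the coordinate \<open>p\<close>, so \<open>df\<close> becomes
  \<open>dp\<close>. Two vectors without time component give symplecticity, and a pure time vector
  with a spatial one gives Hamilton's equation.\<close>

lemma omega_DF:
  assumes x: "x \<in> cylinder"
  shows "omega (DF x v) (DF x w) = omega (snd v) (snd w)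
    + dK (\<Phi> x) (D\<Phi> x v) * fst w - fst v * dK (\<Phi> x) (D\<Phi> x w)"
  using generating_two_form[of "\<Phi> x" "D\<Phi> x v" "D\<Phi> x w"]
  by (simp add: df_D\<Phi>[OF x] DF_def omega_def) (simp add: D\<Phi>_def)

lemma has_derivative_slice:
  fixes k :: "real \<times> (real \<times> real) \<Rightarrow> 'b::real_normed_vector"
  assumes k: "(k has_derivative k') (at (s, z) within cylinder)" and s: "s \<in> {0..1}" and z: "z \<in> strip"
  shows "((\<lambda>z. k (s, z)) has_derivative (\<lambda>w. k' (0, w))) (at z)"
proof -
  have "((\<lambda>z. (s, z)) has_derivative (\<lambda>w. (0, w))) (at z within strip)"
    by (auto intro!: derivative_eq_intros)
  moreover have "(k has_derivative k') (at (s, z) within (\<lambda>z. (s, z)) ` strip)"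
    by (rule has_derivative_subset[OF k]) (use s in auto)
  ultimately have "((\<lambda>z. k (s, z)) has_derivative (\<lambda>w. k' (0, w))) (at z within strip)"
    by (rule has_derivative_in_compose)
  then show ?thesis using at_within_open[OF z open_strip] by simp
qed

lemma F_slice: "s \<in> {0..1} \<Longrightarrow> z \<in> strip \<Longrightarrow> ((\<lambda>z. F (s, z)) has_derivative (\<lambda>w. DF (s, z) (0, w))) (at z)"
  by (intro has_derivative_slice F_has_derivative) auto

lemma F_symplectic:
  assumes s: "s \<in> {0..1}" and z: "z \<in> strip" and D: "((\<lambda>z. F (s, z)) has_derivative D) (at z)"
  shows "omega (D v) (D w) = omega v w"
proof -
  have "D = (\<lambda>w. DF (s, z) (0, w))" by (rule has_derivative_unique[OF D F_slice[OF s z]])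
  then show ?thesis using omega_DF[of "(s, z)" "(0, v)" "(0, w)"] s z by simp
qed

lemma F_has_vector_derivative:
  assumes s: "s \<in> {0..1}" and z: "z \<in> strip"
  shows "((\<lambda>r. F (r, z)) has_vector_derivative V (s, z)) (at s within {0..1})"
proof -
  have x: "(s, z) \<in> cylinder" using s z by simp
  have "((\<lambda>r. (r, z)) has_derivative (\<lambda>h. (h, 0))) (at s within {0..1})"
    by (auto intro!: derivative_eq_intros)
  moreover have "(F has_derivative DF (s, z)) (at (s, z) within (\<lambda>r. (r, z)) ` {0..1})"
    by (rule has_derivative_subset[OF F_has_derivative[OF x]]) (use z in auto)
  ultimately have "((\<lambda>r. F (r, z)) has_derivative (\<lambda>h. DF (s, z) (h, 0))) (at s within {0..1})"
    by (rule has_derivative_in_compose)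
  moreover have "(\<lambda>h. DF (s, z) (h, 0)) = (\<lambda>h. h *\<^sub>R V (s, z))"
  proof
    show "DF (s, z) (h, 0) = h *\<^sub>R V (s, z)" for h
      unfolding V_def
      using linear_scale[OF has_derivative_linear[OF F_has_derivative[OF x]], of h "(1, 0)"] by simp
  qed
  ultimately show ?thesis unfolding has_vector_derivative_def by simp
qed

text \<open>\<open>H\<close> equals \<open>K\<close> composed with \<open>\<Phi>\<close> and
  \<open>G\<close>, and the derivative of \<open>G\<close> is inverse to that of \<open>F\<close>;
  \<open>omega_DF\<close> on the time direction and such a spatial vector then gives the claim with
  its sign.\<close>

lemma H_has_derivative:
  assumes s: "s \<in> {0..1}" and y: "y \<in> strip"
  shows "((\<lambda>y. H (s, y)) has_derivative (\<lambda>w. - omega (V (s, G (s, y))) w)) (at y)"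
proof -
  let ?z = "G (s, y)"
  have z: "?z \<in> strip" by (rule G_strip[OF s y])
  have x: "(s, ?z) \<in> cylinder" using s z by simp
  have "smooth_on strip (\<lambda>z. G (s, z))"
    by (rule smooth_on_compose[OF G_smooth]) (use s in \<open>auto intro: smooth_on_Pair smooth_on_const smooth_on_id\<close>)
  then obtain DG where "\<And>y. y \<in> strip \<Longrightarrow> ((\<lambda>z. G (s, z)) has_derivative DG y) (at y within strip)"
    using smooth_on_derivative[OF fat_open[OF open_strip]] by metis
  then have DG: "((\<lambda>z. G (s, z)) has_derivative DG y) (at y)"
    using at_within_open[OF y open_strip] y by metis
  have DFDG: "DF (s, ?z) (0, DG y w) = w" for w
    by (rule derivative_left_inverse[OF open_strip y DG F_slice[OF s z] FG[OF s]])
  have "((\<lambda>z. K (\<Phi> (s, z))) has_derivative (\<lambda>w. dK (\<Phi> (s, ?z)) (D\<Phi> (s, ?z) (0, w)))) (at ?z)"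
    by (rule has_derivative_slice[OF has_derivative_\<Phi>_compose[OF x K_has_derivative] s z])
  from has_derivative_compose[OF DG this]
  have "((\<lambda>y. K (\<Phi> (s, G (s, y)))) has_derivative (\<lambda>w. dK (\<Phi> (s, ?z)) (D\<Phi> (s, ?z) (0, DG y w)))) (at y)" .
  moreover have "K (\<Phi> (s, G (s, y))) = H (s, y)" if "y \<in> strip" for y
  proof -
    have "Q (s, G (s, y)) = fst y" using FG[OF s that] by (simp add: F_def prod_eq_iff)
    then show ?thesis by (simp add: H_def \<Phi>_def)
  qed
  ultimately have "((\<lambda>y. H (s, y)) has_derivative (\<lambda>w. dK (\<Phi> (s, ?z)) (D\<Phi> (s, ?z) (0, DG y w)))) (at y)"
    by (rule has_derivative_transform_within_open[OF _ open_strip y])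
  moreover have "dK (\<Phi> (s, ?z)) (D\<Phi> (s, ?z) (0, DG y w)) = - omega (V (s, ?z)) w" for w
    using omega_DF[OF x, of "(1, 0)" "(0, DG y w)"] by (simp add: DFDG V_def)
  ultimately show ?thesis by simp
qed

section \<open>Limits at the boundary circles\<close>

lemma f_at_fixed_gap:
  assumes s: "s \<in> {0..1}" and e: "0 < e" "e < 1"
  shows "((\<lambda>x. f (fst x, (fst (snd x), fst (snd x) + e))) \<longlongrightarrow> f (s, (q, q + e))) (near s q p)"
proof -
  have "continuous_on ({0..1} \<times> UNIV) (\<lambda>x :: real \<times> (real \<times> real). f (fst x, (fst (snd x), fst (snd x) + e)))"
    by (intro continuous_on_compose2[OF smooth_on_imp_continuous_on[OF f_smooth]] continuous_intros)
      (use e in auto)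
  then have "((\<lambda>x. f (fst x, (fst (snd x), fst (snd x) + e))) \<longlongrightarrow> f (s, (q, q + e))) (at (s, (q, p)) within {0..1} \<times> UNIV)"
    using s by (auto simp: continuous_on_def)
  then show ?thesis by (rule tendsto_within_subset) auto
qed

text \<open>A chord with a fixed gap has momentum bounded away from 1, uniformly near the limit
  point. Once \<open>p\<close> exceeds that bound, strict monotonicity of \<open>f\<close> forces a
  smaller gap.\<close>

lemma gap_boundary_top:
  assumes s: "s \<in> {0..1}"
  shows "(gap \<longlongrightarrow> 0) (near s q 1)"
proof (rule order_tendstoI)
  have ev: "\<forall>\<^sub>F x in near s q 1. x \<in> cylinder" by (simp add: eventually_at_filter)
  fix a :: real assume "a < 0"
  with ev show "\<forall>\<^sub>F x in near s q 1. a < gap x"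
    by (auto elim!: eventually_mono dest!: gap(1) intro: less_trans)
next
  have ev: "\<forall>\<^sub>F x in near s q 1. x \<in> cylinder" by (simp add: eventually_at_filter)
  fix a :: real assume "0 < a"
  define e where "e = min a (1/2)"
  have e: "0 < e" "e < 1" "e \<le> a" using \<open>0 < a\<close> by (auto simp: e_def)
  have "f (s, (q, q + e)) < 1" using abs_f[of "(s, (q, q + e))"] s e by auto
  \<comment> \<open>A level between the momentum at gap \<open>e\<close> and the limit 1: nearby,
    \<open>f\<close> at gap \<open>e\<close> stays below it while \<open>p\<close> rises above
    it.\<close>
  then obtain m where m: "f (s, (q, q + e)) < m" "m < 1" using dense by blast
  have "\<forall>\<^sub>F x in near s q 1. f (fst x, (fst (snd x), fst (snd x) + e)) < m"
    using f_at_fixed_gap[OF s e(1,2)] m(1) by (rule order_tendstoD)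
  moreover have "\<forall>\<^sub>F x in near s q 1. m < snd (snd x)"
  proof (rule order_tendstoD)
    show "((\<lambda>x :: real \<times> (real \<times> real). snd (snd x)) \<longlongrightarrow> 1) (near s q 1)"
      by (auto intro!: tendsto_eq_intros)
  qed (rule m(2))
  ultimately show "\<forall>\<^sub>F x in near s q 1. gap x < a" using ev
  proof eventually_elim
    case (elim x)
    obtain s' q' p' where x: "x = (s', (q', p'))" by (metis prod.collapse)
    then have s': "s' \<in> {0..1}" "\<bar>p'\<bar> < 1" using elim by auto
    have "gap x < e"
    proof (rule ccontr)
      assume "\<not> gap x < e"
      then have "f (s', (q', q' + gap x)) \<le> f (s', (q', q' + e))"
        using f_strict_anti[OF s'(1), of e "gap x" q'] e gap(2)[OF s', of q'] x by (cases "gap x = e") auto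
      then show False using elim gap(3)[OF s', of q'] x by simp
    qed
    with e show ?case by simp
  qed
qed

lemma gap_boundary_bottom:
  assumes s: "s \<in> {0..1}"
  shows "(gap \<longlongrightarrow> 1) (near s q (- 1))"
proof (rule order_tendstoI)
  have ev: "\<forall>\<^sub>F x in near s q (- 1). x \<in> cylinder" by (simp add: eventually_at_filter)
  fix a :: real assume "1 < a"
  with ev show "\<forall>\<^sub>F x in near s q (- 1). gap x < a"
    by (auto elim!: eventually_mono dest!: gap(2) intro: less_trans)
next
  have ev: "\<forall>\<^sub>F x in near s q (- 1). x \<in> cylinder" by (simp add: eventually_at_filter)
  fix a :: real assume "a < 1"
  define e where "e = max a (1/2)"
  have e: "0 < e" "e < 1" "a \<le> e" using \<open>a < 1\<close> by (auto simp: e_def)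
  have "- 1 < f (s, (q, q + e))" using abs_f[of "(s, (q, q + e))"] s e by auto
  then obtain m where m: "- 1 < m" "m < f (s, (q, q + e))" using dense by blast
  have "\<forall>\<^sub>F x in near s q (- 1). m < f (fst x, (fst (snd x), fst (snd x) + e))"
    using f_at_fixed_gap[OF s e(1,2)] m(2) by (rule order_tendstoD)
  moreover have "\<forall>\<^sub>F x in near s q (- 1). snd (snd x) < m"
  proof (rule order_tendstoD)
    show "((\<lambda>x :: real \<times> (real \<times> real). snd (snd x)) \<longlongrightarrow> - 1) (near s q (- 1))"
      by (auto intro!: tendsto_eq_intros)
  qed (rule m(1))
  ultimately show "\<forall>\<^sub>F x in near s q (- 1). a < gap x" using ev
  proof eventually_elim
    case (elim x)
    obtain s' q' p' where x: "x = (s', (q', p'))" by (metis prod.collapse)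
    then have s': "s' \<in> {0..1}" "\<bar>p'\<bar> < 1" using elim by auto
    have "e < gap x"
    proof (rule ccontr)
      assume "\<not> e < gap x"
      then have "f (s', (q', q' + e)) \<le> f (s', (q', q' + gap x))"
        using f_strict_anti[OF s'(1), of "gap x" e q'] e gap(1)[OF s', of q'] x by (cases "gap x = e") auto
      then show False using elim gap(3)[OF s', of q'] x by simp
    qed
    with e show ?case by simp
  qed
qed

lemma gap_boundary:
  assumes s: "s \<in> {0..1}" and p: "\<bar>p\<bar> = 1"
  obtains n :: int where "(gap \<longlongrightarrow> of_int n) (near s q p)" "n \<in> {0, 1}"
proof (cases "p = 1")
  case True
  with gap_boundary_top[OF s] that[of 0] show ?thesis by simp
next
  case False
  with p have "p = - 1" by auto
  with gap_boundary_bottom[OF s] that[of 1] show ?thesis by simp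
qed

text \<open>Both ends of the chord tend to the same point of the circle. Used with the tangent
  \<open>ct\<close> for the map and with the velocity \<open>cs\<close> for the Hamiltonian.\<close>

lemma periodic_boundary:
  fixes k :: "real \<times> real \<Rightarrow> real^2"
  assumes k: "continuous_on ({0..1} \<times> UNIV) k" and per: "\<And>t. k (s, t + 1) = k (s, t)"
    and s: "s \<in> {0..1}" and p: "\<bar>p\<bar> = 1"
  shows "((\<lambda>x. k (fst x, Q x) - k (fst x, fst (snd x))) \<longlongrightarrow> 0) (near s q p)"
proof -
  obtain n :: int where n: "(gap \<longlongrightarrow> of_int n) (near s q p)" "n \<in> {0, 1}"
    using gap_boundary[OF s p] .
  have ev: "\<forall>\<^sub>F x in near s q p. (fst x, h x) \<in> {0..1} \<times> UNIV"
    for h :: "real \<times> (real \<times> real) \<Rightarrow> real"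
    unfolding eventually_at_filter by (intro always_eventually) auto
  have "((\<lambda>x. (fst x, Q x)) \<longlongrightarrow> (s, q + of_int n)) (near s q p)"
    unfolding Q_def by (auto intro!: tendsto_eq_intros n)
  then have "((\<lambda>x. k (fst x, Q x)) \<longlongrightarrow> k (s, q + of_int n)) (near s q p)"
    by (rule continuous_on_tendsto_compose[OF k]) (use s ev in auto)
  moreover have "((\<lambda>x :: real \<times> (real \<times> real). (fst x, fst (snd x))) \<longlongrightarrow> (s, q)) (near s q p)"
    by (auto intro!: tendsto_eq_intros)
  then have "((\<lambda>x. k (fst x, fst (snd x))) \<longlongrightarrow> k (s, q)) (near s q p)"
    by (rule continuous_on_tendsto_compose[OF k]) (use s ev in auto)
  ultimately have "((\<lambda>x. k (fst x, Q x) - k (fst x, fst (snd x))) \<longlongrightarrow> k (s, q + of_int n) - k (s, q)) (near s q p)"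
    by (rule tendsto_diff)
  moreover have "k (s, q + of_int n) = k (s, q)" using n(2) per by auto
  ultimately show ?thesis by simp
qed

text \<open>The two momenta are inner products of tangents with the same unit vector, so their
  difference is bounded by the difference of the tangents at the two ends; no limit of the chord
  direction enters.\<close>

lemma F_boundary:
  assumes s: "s \<in> {0..1}" and p: "\<bar>p\<bar> = 1"
  shows "\<exists>n::int. (F \<longlongrightarrow> (q + of_int n, p)) (near s q p)"
proof -
  obtain n :: int where n: "(gap \<longlongrightarrow> of_int n) (near s q p)"
    using gap_boundary[OF s p] by metis
  have Q: "(Q \<longlongrightarrow> q + of_int n) (near s q p)"
    unfolding Q_def by (auto intro!: tendsto_eq_intros n)
  have ct0: "((\<lambda>x. ct (fst x, Q x) - ct (fst x, fst (snd x))) \<longlongrightarrow> 0) (near s q p)"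
    using s p by (intro periodic_boundary smooth_on_imp_continuous_on[OF ct_smooth] ct_per) auto
  have "\<forall>\<^sub>F x in near s q p. norm (g (\<Phi> x) - snd (snd x)) \<le> norm (ct (fst x, Q x) - ct (fst x, fst (snd x))) * 1"
  proof -
    have "norm (g (\<Phi> x) - snd (snd x)) \<le> norm (ct (fst x, Q x) - ct (fst x, fst (snd x))) * 1" if x: "x \<in> cylinder" for x
    proof -
      have "g (\<Phi> x) - snd (snd x) = g (\<Phi> x) - f (\<Phi> x)" by (simp add: f_\<Phi>[OF x])
      also have "\<dots> = u (\<Phi> x) \<bullet> (ct (fst x, Q x) - ct (fst x, fst (snd x)))"
        by (simp add: g_def f_def inner_diff_right \<Phi>_def)
      finally show ?thesis
        using Cauchy_Schwarz_ineq2[of "u (\<Phi> x)" "ct (fst x, Q x) - ct (fst x, fst (snd x))"] norm_u[OF \<Phi>_in[OF x]]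
        by simp
    qed
    then show ?thesis unfolding eventually_at_filter by (intro always_eventually) auto
  qed
  then have "((\<lambda>x. g (\<Phi> x) - snd (snd x)) \<longlongrightarrow> 0) (near s q p)"
    by (rule tendsto_0_le[OF ct0])
  moreover have "((\<lambda>x :: real \<times> (real \<times> real). snd (snd x)) \<longlongrightarrow> p) (near s q p)"
    by (auto intro!: tendsto_eq_intros)
  ultimately have "((\<lambda>x. (g (\<Phi> x) - snd (snd x)) + snd (snd x)) \<longlongrightarrow> 0 + p) (near s q p)"
    by (rule tendsto_add)
  then have "((\<lambda>x. g (\<Phi> x)) \<longlongrightarrow> p) (near s q p)" by simp
  with Q show ?thesis unfolding F_def by (intro exI[of _ n] tendsto_Pair)
qed

lemma G_boundary:
  assumes s: "s \<in> {0..1}" and p: "\<bar>p\<bar> = 1"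
  shows "\<exists>n::int. (G \<longlongrightarrow> (q + of_int n, p)) (near s q p)"
proof -
  obtain n :: int where "(F \<longlongrightarrow> (q + of_int n, - p)) (near s q (- p))"
    using F_boundary[OF s, of "- p" q] p by auto
  from filterlim_compose[OF this filterlim_reflect[OF p]]
  have "((\<lambda>x. (fst (F (fst x, (fst (snd x), - snd (snd x)))) - 1, - snd (F (fst x, (fst (snd x), - snd (snd x))))))
      \<longlongrightarrow> (fst (q + of_int n, - p) - 1, - snd (q + of_int n, - p))) (near s q p)"
    by (intro tendsto_intros)
  then have "(G \<longlongrightarrow> (q + of_int (n - 1), p)) (near s q p)"
    unfolding G_def Let_def by (simp add: algebra_simps)
  then show ?thesis by blast
qed

lemma abs_H_le:
  assumes x: "x \<in> cylinder"
  shows "\<bar>H x\<bar> \<le> norm (cs (fst x, fst (snd x)) - cs (fst x, fst (G x)))"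
  using Cauchy_Schwarz_ineq2[of "u (fst x, (fst (G x), fst (snd x)))" "cs (fst x, fst (snd x)) - cs (fst x, fst (G x))"]
    norm_u[OF chord_G[OF x]]
  by (simp add: H_def K_def)

lemma H_boundary:
  assumes s: "s \<in> {0..1}" and p: "\<bar>p\<bar> = 1"
  shows "(H \<longlongrightarrow> 0) (near s q p)"
proof -
  let ?R = "\<lambda>x :: real \<times> (real \<times> real). (fst x, (fst (snd x), - snd (snd x)))"
  have "((\<lambda>x. cs (fst x, Q x) - cs (fst x, fst (snd x))) \<longlongrightarrow> 0) (near s q (- p))"
    using s p by (intro periodic_boundary smooth_on_imp_continuous_on[OF cs_smooth] cs_per) auto
  from filterlim_compose[OF this filterlim_reflect[OF p]]
  have lim: "((\<lambda>x. cs (fst x, Q (?R x)) - cs (fst x, fst (snd x))) \<longlongrightarrow> 0) (near s q p)"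
    by simp
  have "norm (H x) \<le> norm (cs (fst x, Q (?R x)) - cs (fst x, fst (snd x))) * 1" if x: "x \<in> cylinder" for x
  proof -
    \<comment> \<open>The end of the reversed chord is the first coordinate of \<open>G x\<close>
      plus 1, and \<open>cs\<close> is periodic.\<close>
    have "cs (fst x, Q (?R x)) = cs (fst x, fst (G x) + 1)"
      by (simp add: G_def Let_def F_def)
    also have "\<dots> = cs (fst x, fst (G x))" using x by (intro cs_per) auto
    finally show ?thesis using abs_H_le[OF x] by (simp add: norm_minus_commute)
  qed
  then have "\<forall>\<^sub>F x in near s q p. norm (H x) \<le> norm (cs (fst x, Q (?R x)) - cs (fst x, fst (snd x))) * 1"
    unfolding eventually_at_filter by (intro always_eventually) auto
  then show ?thesis by (rule tendsto_0_le[OF lim])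
qed

lemma strip_isotopy_F: "strip_isotopy F G V H"
proof (rule strip_isotopy.intro)
  show "smooth_on cylinder F" by (rule F_smooth)
  show "smooth_on cylinder G" by (rule G_smooth)
  show "smooth_on cylinder H" by (rule H_smooth)
  fix s :: real assume s: "s \<in> {0..1}"
  show "F (s, z) \<in> strip" if "z \<in> strip" for z by (rule F_strip[OF s that])
  show "G (s, z) \<in> strip" if "z \<in> strip" for z by (rule G_strip[OF s that])
  show "F (s, G (s, z)) = z" if "z \<in> strip" for z by (rule FG[OF s that])
  show "G (s, F (s, z)) = z" if "z \<in> strip" for z by (rule GF[OF s that])
  show "F (s, (q + 1, p)) = F (s, (q, p)) + (1, 0)" if "\<bar>p\<bar> < 1" for q p by (rule F_shift[OF s that])
  show "H (s, (q + 1, p)) = H (s, (q, p))" if "\<bar>p\<bar> < 1" for q p by (rule H_shift[OF s that])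
  show "omega (D v) (D w) = omega v w"
    if "z \<in> strip" "((\<lambda>z. F (s, z)) has_derivative D) (at z)" for z D v w
    by (rule F_symplectic[OF s that])
  show "\<exists>n::int. (F \<longlongrightarrow> (q + of_int n, p)) (near s q p)" if "\<bar>p\<bar> = 1" for q p
    by (rule F_boundary[OF s that])
  show "(H \<longlongrightarrow> 0) (near s q p)" if "\<bar>p\<bar> = 1" for q p
    by (rule H_boundary[OF s that])
  show "((\<lambda>r. F (r, z)) has_vector_derivative V (s, z)) (at s within {0..1})" if "z \<in> strip" for z
    by (rule F_has_vector_derivative[OF s that])
  show "((\<lambda>y. H (s, y)) has_derivative (\<lambda>w. - omega (V (s, G (s, y))) w)) (at y)" if "y \<in> strip" for y
    by (rule H_has_derivative[OF s that])
qed

sublocale iso: strip_isotopy F G V H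
  by (rule strip_isotopy_F)

lemma G_boundary_slice:
  assumes p: "\<bar>p\<bar> = 1"
  shows "\<exists>n::int. ((\<lambda>z. G (0, z)) \<longlongrightarrow> (q + of_int n, p)) (at (q, p) within strip)"
proof -
  obtain n :: int where n: "(G \<longlongrightarrow> (q + of_int n, p)) (near 0 q p)"
    using G_boundary[of 0 p q] p by auto
  have "((\<lambda>z. (0, z)) \<longlongrightarrow> (0, (q, p))) (at (q, p) within strip)"
    by (auto intro!: tendsto_eq_intros)
  moreover have "\<forall>\<^sub>F z in at (q, p) within strip. (0, z) \<in> cylinder \<and> (0, z) \<noteq> (0, (q, p))"
    unfolding eventually_at_filter by (intro always_eventually) auto
  ultimately have "filterlim (\<lambda>z. (0, z)) (near 0 q p) (at (q, p) within strip)"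
    by (simp add: filterlim_at)
  from filterlim_compose[OF n this] show ?thesis by blast
qed

end

section \<open>Homotopies of billiard tables\<close>

text \<open>Makes the maximal speed of a homotopy integrable, so that integrals can be compared.
  Uniform continuity on the compact square bounds the change of all values at once.\<close>

lemma continuous_on_SUP:
  fixes n :: "real \<times> real \<Rightarrow> real"
  assumes n: "continuous_on ({0..1} \<times> {0..1}) n"
  shows "continuous_on {0..1} (\<lambda>s. SUP t\<in>{0..1}. n (s, t))"
  unfolding continuous_on_iff
proof (intro ballI allI impI)
  fix s e :: real assume s: "s \<in> {0..1}" and e: "0 < e"
  have "uniformly_continuous_on ({0..1} \<times> {0..1}) n"
    by (rule compact_uniformly_continuous[OF n]) (intro compact_Times compact_Icc)
  then obtain d where d: "d > 0"
    "\<And>x y. x \<in> {0..1} \<times> {0..1} \<Longrightarrow> y \<in> {0..1} \<times> {0..1} \<Longrightarrow> dist y x < d \<Longrightarrow> dist (n y) (n x) < e / 2"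
    unfolding uniformly_continuous_on_def using e by (meson half_gt_zero)
  have bdd: "bdd_above ((\<lambda>t. n (r, t)) ` {0..1})" if "r \<in> {0..1}" for r
  proof -
    have "continuous_on {0..1} (\<lambda>t. n (r, t))"
      using that by (intro continuous_on_compose2[OF n] continuous_intros) auto
    then have "compact ((\<lambda>t. n (r, t)) ` {0..1})" by (rule compact_continuous_image) auto
    then show ?thesis by (intro bounded_imp_bdd_above compact_imp_bounded)
  qed
  have le: "(SUP t\<in>{0..1}. n (a, t)) \<le> (SUP t\<in>{0..1}. n (b, t)) + e / 2"
    if ab: "a \<in> {0..1}" "b \<in> {0..1}" "dist a b < d" for a b
  proof (rule cSUP_least)
    fix t :: real assume t: "t \<in> {0..1}"
    have "dist (a, t) (b, t) < d" using ab by (simp add: dist_Pair_Pair)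
    then have "dist (n (a, t)) (n (b, t)) < e / 2" using ab t by (intro d) auto
    moreover have "n (b, t) \<le> (SUP t\<in>{0..1}. n (b, t))" by (rule cSUP_upper[OF t bdd[OF ab(2)]])
    ultimately show "n (a, t) \<le> (SUP t\<in>{0..1}. n (b, t)) + e / 2" unfolding dist_real_def by linarith
  qed auto
  show "\<exists>d>0. \<forall>x'\<in>{0..1}. dist x' s < d \<longrightarrow>
      dist (SUP t\<in>{0..1}. n (x', t)) (SUP t\<in>{0..1}. n (s, t)) < e"
  proof (intro exI[of _ d] conjI ballI impI d(1))
    fix r assume "r \<in> {0..1}" "dist r s < d"
    then have "(SUP t\<in>{0..1}. n (r, t)) \<le> (SUP t\<in>{0..1}. n (s, t)) + e / 2"
      "(SUP t\<in>{0..1}. n (s, t)) \<le> (SUP t\<in>{0..1}. n (r, t)) + e / 2"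
      using s by (auto intro!: le simp: dist_commute)
    with e show "dist (SUP t\<in>{0..1}. n (r, t)) (SUP t\<in>{0..1}. n (s, t)) < e"
      unfolding dist_real_def by linarith
  qed
qed

lemma table_homotopy_billiard_curves:
  assumes \<Gamma>: "table_homotopy \<Gamma> \<alpha> \<beta>"
  obtains cs ct css cst ctt where "billiard_curves (\<lambda>x. \<Gamma> (fst x) (circ (snd x))) cs ct css cst ctt"
proof -
  let ?c = "\<lambda>x :: real \<times> real. \<Gamma> (fst x) (circ (snd x))"
  have sm: "smooth_on ({0..1} \<times> UNIV) ?c" and tab: "\<And>s. s \<in> {0..1} \<Longrightarrow> \<Gamma> s \<in> billiard_tables"
    using \<Gamma> by (auto simp: table_homotopy_def case_prod_beta')
  obtain cs ct where cs: "smooth_on ({0..1} \<times> UNIV) cs" and ct: "smooth_on ({0..1} \<times> UNIV) ct"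
    and dc: "\<And>x. fst x \<in> {0..1} \<Longrightarrow> (?c has_derivative (\<lambda>v. fst v *\<^sub>R cs x + snd v *\<^sub>R ct x)) (at x within {0..1} \<times> UNIV)"
    using smooth_on_partials[OF sm, of thesis] by iprover
  obtain css cst' where "smooth_on ({0..1} \<times> UNIV) css" and "smooth_on ({0..1} \<times> UNIV) cst'"
    and dcs': "\<And>x. fst x \<in> {0..1} \<Longrightarrow> (cs has_derivative (\<lambda>v. fst v *\<^sub>R css x + snd v *\<^sub>R cst' x)) (at x within {0..1} \<times> UNIV)"
    using smooth_on_partials[OF cs, of thesis] by iprover
  obtain cst ctt where cst: "smooth_on ({0..1} \<times> UNIV) cst" and "smooth_on ({0..1} \<times> UNIV) ctt"
    and dct: "\<And>x. fst x \<in> {0..1} \<Longrightarrow> (ct has_derivative (\<lambda>v. fst v *\<^sub>R cst x + snd v *\<^sub>R ctt x)) (at x within {0..1} \<times> UNIV)"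
    using smooth_on_partials[OF ct, of thesis] by iprover
  have c_s: "((\<lambda>r. ?c (r, t)) has_vector_derivative cs (s, t)) (at s within {0..1})"
    and c_t: "((\<lambda>t. ?c (s, t)) has_vector_derivative ct (s, t)) (at t)"
    and ct_s: "((\<lambda>r. ct (r, t)) has_vector_derivative cst (s, t)) (at s within {0..1})"
    and cs_t: "((\<lambda>t. cs (s, t)) has_vector_derivative cst' (s, t)) (at t)"
    if "s \<in> {0..1}" for s t
    using partials_vector_derivative[of ?c cs ct s, OF dc that] partials_vector_derivative[of ct cst ctt s, OF dct that]
      partials_vector_derivative[of cs css cst' s, OF dcs' that]
    by auto
  \<comment> \<open>The second derivatives of \<open>cs\<close> and \<open>ct\<close> were obtained
    separately; the locale requires one common mixed derivative.\<close>
  have cst_eq: "cst' (s, t) = cst (s, t)" if s: "s \<in> {0..1}" for s t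
  proof -
    have "((\<lambda>t. cs (s, t)) has_vector_derivative cst (s, t)) (at t)"
      by (rule mixed_partials[OF c_s c_t ct_s
            smooth_on_imp_continuous_on[OF ct] smooth_on_imp_continuous_on[OF cst] s])
    with cs_t[OF s] show ?thesis by (rule vector_derivative_unique_at)
  qed
  have frame: "norm (ct (s, t)) = 1 \<and> (0 < T - t \<longrightarrow> T - t < 1 \<longrightarrow> 0 < det2 (ct (s, t)) (?c (s, T) - ?c (s, t)))"
    if s: "s \<in> {0..1}" for s t T
  proof -
    obtain c1 c2 where fr: "table_frame (\<Gamma> s) c1 c2" using table_frame_exists[OF tab[OF s]] .
    then have "((\<lambda>t. \<Gamma> s (circ t)) has_vector_derivative c1 t) (at t)" by (simp add: table_frame_def)
    then have "c1 t = ct (s, t)"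
      using c_t[OF s, of t] by (auto intro: vector_derivative_unique_at)
    then show ?thesis
      using fr unfolding table_frame_def fst_conv snd_conv by metis
  qed
  have "billiard_curves ?c cs ct css cst ctt"
  proof
    show "(cs has_derivative (\<lambda>v. fst v *\<^sub>R css x + snd v *\<^sub>R cst x)) (at x within {0..1} \<times> UNIV)"
      if "fst x \<in> {0..1}" for x
      using dcs'[OF that] cst_eq[of "fst x" "snd x"] that by simp
  qed (use sm cs ct dc dct frame in auto)
  then show thesis by (rule that)
qed

context billiard_curves
begin

text \<open>Every candidate for the image has a unique representative ahead of \<open>q\<close> by
  less than 1. Its momentum equation then reads \<open>f = p\<close>, whose solution is
  unique.\<close>

lemma flow_eq_billiard_map:
  assumes s: "s \<in> {0..1}" and \<gamma>: "\<And>t. \<gamma> (circ t) = c (s, t)"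
  shows "iso.flow s = billiard_map \<gamma>"
  unfolding iso.flow_def billiard_map_def
proof (rule restrict_ext)
  fix z assume z: "z \<in> annulus"
  have cd: "circle_deriv \<gamma> (circ t) = ct (s, t)" for t
    by (rule circle_deriv_circ) (simp add: \<gamma> c_t[OF s])
  have dir: "chord_dir \<gamma> (circ a) (circ b) = u (s, (a, b))" for a b
    by (simp add: chord_dir_def \<gamma> u_def chord_def divide_inverse)
  obtain q p where qp: "lft z = (q, p)" by fastforce
  then have z_eq: "z = (circ q, p)" using cov_lft[of z] by (simp add: cov_def)
  have p: "\<bar>p\<bar> < 1" using z qp by (metis lft_in_strip strip_iff)
  let ?Q = "Q (s, (q, p))"
  have ch: "(s, (q, ?Q)) \<in> chords" and fp: "f (s, (q, ?Q)) = p"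
    using \<Phi>_in[of "(s, (q, p))"] f_\<Phi>[of "(s, (q, p))"] s p by (auto simp: \<Phi>_def)
  have F_eq: "F (s, lft z) = (?Q, g (s, (q, ?Q)))" by (simp add: F_def \<Phi>_def qp)
  show "cov (F (s, lft z)) = (THE Z. fst Z \<noteq> fst z \<and>
     snd z = chord_dir \<gamma> (fst z) (fst Z) \<bullet> circle_deriv \<gamma> (fst z) \<and>
     snd Z = chord_dir \<gamma> (fst z) (fst Z) \<bullet> circle_deriv \<gamma> (fst Z))"
  proof (rule the_equality[symmetric])
    show "fst (cov (F (s, lft z))) \<noteq> fst z \<and>
      snd z = chord_dir \<gamma> (fst z) (fst (cov (F (s, lft z)))) \<bullet> circle_deriv \<gamma> (fst z) \<and>
      snd (cov (F (s, lft z))) = chord_dir \<gamma> (fst z) (fst (cov (F (s, lft z)))) \<bullet> circle_deriv \<gamma> (fst (cov (F (s, lft z))))"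
      unfolding F_eq using ch fp circ_ne[of ?Q q] by (simp add: cov_def z_eq dir cd f_def g_def)
  next
    fix Z assume Z: "fst Z \<noteq> fst z \<and>
      snd z = chord_dir \<gamma> (fst z) (fst Z) \<bullet> circle_deriv \<gamma> (fst z) \<and>
      snd Z = chord_dir \<gamma> (fst z) (fst Z) \<bullet> circle_deriv \<gamma> (fst Z)"
    obtain T0 where "fst Z = circ T0" by (rule circ_cases)
    with Z have "circ T0 \<noteq> circ q" by (simp add: z_eq)
    then obtain T where "circ T = circ T0" and T: "0 < T - q" "T - q < 1" by (rule circ_ne_cases)
    then have ZT: "fst Z = circ T" using \<open>fst Z = circ T0\<close> by simp
    then have "f (s, (q, T)) = p" "snd Z = g (s, (q, T))"
      using Z by (simp_all add: z_eq dir cd f_def g_def)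
    with F_eqI[OF s T] ZT show "Z = cov (F (s, lft z))"
      by (simp add: qp cov_def prod_eq_iff)
  qed
qed

text \<open>\<open>|H| \<le> |cs(s,Q)| + |cs(s,q)|\<close>, so that the oscillation of \<open>H\<close> is at most four times the speed of the
  homotopy. If the oscillation were not integrable, its \<open>integral\<close> would be \<open>0\<close>.\<close>

lemma hofer_length_le:
  assumes \<Gamma>: "\<And>s t. \<Gamma> s (circ t) = c (s, t)"
  shows "hofer_length iso.ham \<le> 4 * homotopy_length \<Gamma>"
proof -
  define M where "M s = (SUP t\<in>{0..1}. norm (cs (s, t)))" for s
  have cont: "continuous_on ({0..1} \<times> UNIV) (\<lambda>x. norm (cs x))"
    by (intro continuous_intros smooth_on_imp_continuous_on[OF cs_smooth])
  have M_cont: "continuous_on {0..1} M"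
    unfolding M_def by (rule continuous_on_SUP) (rule continuous_on_subset[OF cont], auto)
  have vd: "vector_derivative (\<lambda>r. \<Gamma> r (circ t)) (at s within {0..1}) = cs (s, t)" if "s \<in> {0..1}" for s t
    using vector_derivative_within_cbox[of 0 1 s "\<lambda>r. c (r, t)" "cs (s, t)"] c_s[OF that, of t] that
    by (simp add: \<Gamma>)
  have M_eq: "(SUP q. norm (vector_derivative (\<lambda>r. \<Gamma> r q) (at s within {0..1}))) = M s" if "s \<in> {0..1}" for s
    unfolding range_circle[of "\<lambda>q. norm (vector_derivative (\<lambda>r. \<Gamma> r q) (at s within {0..1}))"] M_def vd[OF that] ..
  have cs_le: "norm (cs (s, t)) \<le> M s" if s: "s \<in> {0..1}" for s t
  proof -
    have "continuous_on {0..1} (\<lambda>t. norm (cs (s, t)))"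
      using s by (intro continuous_on_compose2[OF cont] continuous_intros) auto
    then have bdd: "bdd_above ((\<lambda>t. norm (cs (s, t))) ` {0..1})"
      by (intro bounded_imp_bdd_above compact_imp_bounded compact_continuous_image) auto
    have "norm (cs (s, t)) \<in> range (\<lambda>q. norm (vector_derivative (\<lambda>r. \<Gamma> r q) (at s within {0..1})))"
      using vd[OF s, of t] by (metis rangeI)
    then have "norm (cs (s, t)) \<in> (\<lambda>t. norm (cs (s, t))) ` {0..1}"
      unfolding range_circle[of "\<lambda>q. norm (vector_derivative (\<lambda>r. \<Gamma> r q) (at s within {0..1}))"] vd[OF s] .
    then show ?thesis unfolding M_def by (rule cSup_upper[OF _ bdd])
  qed
  have len: "homotopy_length \<Gamma> = integral {0..1} M"
    unfolding homotopy_length_def by (rule integral_cong) (rule M_eq)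
  have M_int: "M integrable_on {0..1}" by (rule integrable_continuous_real[OF M_cont])
  have M_nonneg: "0 \<le> M s" if "s \<in> {0..1}" for s
    using cs_le[OF that, of 0] norm_ge_zero order_trans by blast
  have ham_le: "\<bar>iso.ham s z\<bar> \<le> 2 * M s" if s: "s \<in> {0..1}" and z: "z \<in> annulus" for s z
  proof -
    have "\<bar>iso.ham s z\<bar> \<le> norm (cs (s, fst (lft z)) - cs (s, fst (G (s, lft z))))"
      using abs_H_le[of "(s, lft z)"] s z by (simp add: iso.ham_def)
    also have "\<dots> \<le> M s + M s"
      by (rule order_trans[OF norm_triangle_ineq4 add_mono[OF cs_le[OF s] cs_le[OF s]]])
    finally show ?thesis by simp
  qed
  let ?osc = "\<lambda>s. (SUP z\<in>annulus. iso.ham s z) - (INF z\<in>annulus. iso.ham s z)"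
  have osc_le: "?osc s \<le> 4 * M s" if s: "s \<in> {0..1}" for s
  proof -
    have ne: "annulus \<noteq> {}" unfolding annulus_def by auto
    have "(SUP z\<in>annulus. iso.ham s z) \<le> 2 * M s"
      using ham_le[OF s] by (intro cSUP_least ne) (auto simp: abs_le_iff)
    moreover have "- (2 * M s) \<le> (INF z\<in>annulus. iso.ham s z)"
      using ham_le[OF s] by (intro cINF_greatest ne) (auto simp: abs_le_iff minus_le_iff)
    ultimately show ?thesis by linarith
  qed
  have "integral {0..1} ?osc \<le> 4 * integral {0..1} M"
  proof (cases "?osc integrable_on {0..1}")
    case True
    have "integral {0..1} ?osc \<le> integral {0..1} (\<lambda>s. 4 * M s)"
      by (rule integral_le[OF True _ osc_le])
        (intro integrable_continuous_real continuous_intros M_cont)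
    then show ?thesis by simp
  next
    case False
    have "0 \<le> integral {0..1} M" by (rule integral_nonneg[OF M_int M_nonneg])
    with False show ?thesis by (simp add: not_integrable_integral)
  qed
  then show ?thesis unfolding hofer_length_def len .
qed

end

lemma table_homotopy_hamiltonian_path:
  assumes \<Gamma>: "table_homotopy \<Gamma> \<alpha> \<beta>"
  obtains \<psi> H \<phi> where "hamiltonian_path_with \<psi> H" "\<psi> 0 = billiard_map \<alpha>" "\<psi> 1 = billiard_map \<beta>"
    "hofer_length H \<le> 4 * homotopy_length \<Gamma>"
    "\<phi> \<in> Ham" "billiard_map \<beta> = compose annulus (billiard_map \<alpha>) \<phi>"
proof -
  let ?c = "\<lambda>x :: real \<times> real. \<Gamma> (fst x) (circ (snd x))"
  obtain cs ct css cst ctt where "billiard_curves ?c cs ct css cst ctt"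
    using table_homotopy_billiard_curves[OF \<Gamma>] .
  then interpret billiard_curves ?c cs ct css cst ctt .
  have ends: "\<Gamma> 0 = \<alpha>" "\<Gamma> 1 = \<beta>" using \<Gamma> by (auto simp: table_homotopy_def)
  have 0: "iso.flow 0 = billiard_map \<alpha>" by (rule flow_eq_billiard_map) (auto simp: ends)
  have 1: "iso.flow 1 = billiard_map \<beta>" by (rule flow_eq_billiard_map) (auto simp: ends)
  obtain \<phi> where "\<phi> \<in> Ham" "iso.flow 1 = compose annulus (iso.flow 0) \<phi>"
    using strip_isotopy_endpoint_Ham[OF strip_isotopy_F G_boundary_slice] .
  then show thesis
    using that[OF iso.hamiltonian_path_with_flow 0 1 hofer_length_le] by (simp add: 0 1)
qed

theorem theorem3p1:
  shows "(\<forall>\<alpha>\<in>billiard_tables. \<forall>\<beta>\<in>billiard_tables.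
            \<exists>\<psi>. hamiltonian_path \<psi> \<and> \<psi> 0 = billiard_map \<alpha> \<and> \<psi> 1 = billiard_map \<beta>) \<and>
         (\<forall>\<gamma>\<in>billiard_tables. billiard_map \<gamma> \<in> BM) \<and>
         (\<forall>\<alpha>\<in>billiard_tables. \<forall>\<beta>\<in>billiard_tables.
            hofer_dist (billiard_map \<alpha>) (billiard_map \<beta>) \<le> 4 * geometric_dist \<alpha> \<beta>)"
proof (intro conjI ballI)
  fix \<alpha> \<beta> assume tables: "\<alpha> \<in> billiard_tables" "\<beta> \<in> billiard_tables"
  obtain \<Gamma> where \<Gamma>: "table_homotopy \<Gamma> \<alpha> \<beta>" using table_homotopy_exists[OF tables] .
  then obtain \<psi> H where "hamiltonian_path_with \<psi> H" "\<psi> 0 = billiard_map \<alpha>" "\<psi> 1 = billiard_map \<beta>"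
    by (rule table_homotopy_hamiltonian_path)
  then show "\<exists>\<psi>. hamiltonian_path \<psi> \<and> \<psi> 0 = billiard_map \<alpha> \<and> \<psi> 1 = billiard_map \<beta>"
    unfolding hamiltonian_path_def by blast
next
  fix \<gamma> assume \<gamma>: "\<gamma> \<in> billiard_tables"
  \<comment> \<open>Starting at the disc makes its billiard ball map the left factor.\<close>
  obtain \<Gamma> where \<Gamma>: "table_homotopy \<Gamma> disc_table \<gamma>"
    using table_homotopy_exists[OF disc_table_in_billiard_tables \<gamma>] .
  then obtain \<phi> where "\<phi> \<in> Ham" "billiard_map \<gamma> = compose annulus (billiard_map disc_table) \<phi>"
    by (rule table_homotopy_hamiltonian_path)
  then show "billiard_map \<gamma> \<in> BM" unfolding BM_def by blast
next
  fix \<alpha> \<beta> :: "circle \<Rightarrow> real^2"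
  have "hofer_dist (billiard_map \<alpha>) (billiard_map \<beta>) \<le> 4 * ereal (homotopy_length \<Gamma>)"
    if \<Gamma>: "table_homotopy \<Gamma> \<alpha> \<beta>" for \<Gamma>
  proof -
    obtain \<psi> H where "hamiltonian_path_with \<psi> H" "\<psi> 0 = billiard_map \<alpha>" "\<psi> 1 = billiard_map \<beta>"
      and len: "hofer_length H \<le> 4 * homotopy_length \<Gamma>"
      using \<Gamma> by (rule table_homotopy_hamiltonian_path)
    then have "hofer_dist (billiard_map \<alpha>) (billiard_map \<beta>) \<le> ereal (hofer_length H)"
      unfolding hofer_dist_def by (intro Inf_lower) auto
    also have "\<dots> \<le> 4 * ereal (homotopy_length \<Gamma>)" using len by simp
    finally show ?thesis .
  qed
  \<comment> \<open>Dividing by 4 turns the claim into a lower bound for an infimum, which can be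
    tested on each homotopy separately.\<close>
  then have "hofer_dist (billiard_map \<alpha>) (billiard_map \<beta>) / 4 \<le> geometric_dist \<alpha> \<beta>"
    unfolding geometric_dist_def by (intro Inf_greatest) (auto simp: ereal_divide_le_pos)
  then show "hofer_dist (billiard_map \<alpha>) (billiard_map \<beta>) \<le> 4 * geometric_dist \<alpha> \<beta>"
    by (simp add: ereal_divide_le_pos)
qed

end
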